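(* Let $\mathbf F$ be a field and fix a multigrading $g=(r_1,\dots,r_k)$, with $0\le r_1\le\dots\le r_k$ integers. Then the sequence $\mathbf F[\mathcal B_n]_g$ is representation stable for $n$ sufficiently large. That is, there are finitely many compositions $\alpha_i$ and integers $k_j\ge-1$, and non-negative integers $c_{\alpha_i,k_j}$ independent of $n$, such that for all sufficiently large $n$, in the Grothendieck group of finite dimensional $H_n(0)$-modules, $$[\mathbf F[\mathcal B_n]_g]=\sum_{i,j}c_{\alpha_i,k_j}[M(\alpha_i,k_j)_n].$$
   Context: The base field is $\mathbf k=\mathbf F$. For $n\ge 0$ let $[n]=\{1,\dots,n\}$, and let $H_n(0)$ be the unital associative $\mathbf k$-algebra generated by $\pi_1,\dots,\pi_{n-1}$ with relations $\pi_i^2=\pi_i$, $\pi_i\pi_{i+1}\pi_i=\pi_{i+1}\pi_i\pi_{i+1}$, and $\pi_i\pi_j=\pi_j\pi_i$ for $|i-j|>1$. For $w\in\mathfrak S_n$ with reduced expression $w=s_{i_1}\cdots s_{i_r}$ in the adjacent transpositions $s_i=(i,i+1)$, put $\pi_w=\pi_{i_1}\cdots\pi_{i_r}$; the $\pi_w$ form a basis of $H_n(0)$ and a monoid $\mathcal M_n$ under multiplication. For $n\le m$, $\mathcal M_n\subseteq\mathcal M_m$ via $\pi_i\mapsto\pi_i$. The $0$-Hecke category $\mathcal H$ has objects $[n]$, $n\ge0$. For $n\le m$, $\mathrm{Hom}_{\mathcal H}([n],[m])$ is the set of braid diagrams from $n$ top vertices to $m$ bottom vertices with only positive crossings, modulo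 $\pi_i^2=\pi_i$, composed by padding with dummy strands, multiplying in the $0$-Hecke monoid and deleting dummy strands; there are no morphisms if $n>m$. Algebraically, $\mathrm{Hom}_{\mathcal H}([n],[m])$ is the quotient of $\mathcal M_m$ by the equivalence relation generated by $x\sim x\pi_j$ for $n+1\le j\le m-1$, and the composite of the class of $y\in\mathcal M_\ell$ in $\mathrm{Hom}([m],[\ell])$ with the class of $x\in\mathcal M_m$ in $\mathrm{Hom}([n],[m])$ is the class of $yx\in\mathcal M_\ell$. Injections $f:[n]\to[m]$ correspond bijectively to morphisms: $f$ corresponds to the class of $\pi_w$, $w\in\mathfrak S_m$ with $w(i)=f(i)$ for $i\le n$ and $w(n+1)<\dots<w(m)$; in particular order preserving injections are regarded as morphisms. An $\mathcal H$-module is a functor $V$ from $\mathcal H$ to $\mathbf k$-vector spaces; $V_n=V([n])$ is an $H_n(0)$-module since $\mathrm{End}_{\mathcal H}([n])=\mathcal M_n$. A composition $\alpha=(\alpha_1,\dots,\alpha_r)$ of $n=|\alpha|\ge 0$ is a sequence of positive integers with sum $n$; $D(\alpha)=\{\alpha_1,\alpha_1+\alpha_2,\dots,\alpha_1+\dots+\alpha_{r-1}\}$. $\mathbf C_\alpha$ is the one-dimensional $H_n(0)$-module spanned by $v_\alpha$ with $\pi_iv_\alpha=0$ if $i\in D(\alpha)$ and $\pi_iv_\alpha=v_\alpha$ otherwise. $M(\alpha)$ is the $\mathcal H$-module $M(\alpha)_m=\mathbf k[\mathrm{Hom}_{\mathcal H}([n],[m])]\otimes_{H_n(0)}\mathbf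 C_\alpha$, with $\mathcal H$ acting by composition on the left factor. $M(\alpha,k)$ is defined for $-1\le k\le n$: $M(\alpha,n)=M(\alpha)$; $M(\alpha,-1)$ is the quotient equal to $\mathbf C_\alpha$ in degree $n$ and zero in other degrees; and for $0\le k<n$, $M(\alpha,k)$ is the quotient of $M(\alpha)$ by the submodule generated by $g_k\otimes v_\alpha\in M(\alpha)_{n+1}$, with $g_k:[n]\to[n+1]$ the order preserving injection $g_k(i)=i+1$ for $i\ge n-k$ and $g_k(i)=i$ otherwise. In the sum only pairs with $k_j\le|\alpha_i|$ occur. $\mathcal B_n$ is the poset of all subsets of $[n]$ ordered by inclusion. $\mathbf F[\mathcal B_n]=\mathbf F[y_A\mid A\subseteq[n]]/\langle y_Ay_B\mid A,B\text{ incomparable}\rangle$; it has $\mathbf F$-basis the monomials $y_M=y_{A_1}\cdots y_{A_k}$ indexed by multichains $M=(A_1\subseteq\dots\subseteq A_k)$ of subsets of $[n]$. With $A_0=\emptyset$ and $A_{k+1}=[n]$, put $p_i(M)=\min\{j\in[k+1]\mid i\in A_j\}$ for $i\in[n]$. $H_n(0)$ acts by $\pi_i(y_M)=0$ if $p_i(M)>p_{i+1}(M)$, $\pi_i(y_M)=y_M$ if $p_i(M)=p_{i+1}(M)$, and $\pi_i(y_M)=s_i(y_M)+y_M$ if $p_i(M)<p_{i+1}(M)$, where $s_i(y_M)=y_{s_i(M)}$ with $s_i=(i,i+1)$ applied to every set in the multichain. A multichain $A_1\subseteq\dots\subseteq A_k$ has multigrading $g=(r_1,\dots,r_k)$ if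 $|A_j|=r_j$ for all $j$, and $\mathbf F[\mathcal B_n]_g$ is the span of the $y_M$ with $M$ of multigrading $g$; it is an $H_n(0)$-submodule. *)

theory Defs
  imports
    "HOL-Algebra.Algebra"
    "HOL-Algebra.Algebraic_Closure_Type"
    "HOL-Combinatorics.Permutations"
    "HOL-Library.Poly_Mapping"
begin

section \<open>Linear algebra over a field\<close>

text \<open>
  The base field is a type of class \<open>field\<close>; viewed as a ring with a carrier it is
  \<open>ring_of_type_algebra\<close>. Vector spaces are \<open>module\<close> records over it and subspaces are
  \<open>submodule\<close>s. The same record with a meaningful multiplication is used for algebras; for
  a mere vector space the fields \<open>mult\<close> and \<open>one\<close> carry no information.
\<close>

abbreviation scale :: "'a::field \<Rightarrow> ('b \<Rightarrow>\<^sub>0 'a) \<Rightarrow> ('b \<Rightarrow>\<^sub>0 'a)"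
  where "scale c p \<equiv> Poly_Mapping.map ((*) c) p"

definition subspace_span :: "('a::field, 'v) module \<Rightarrow> 'v set \<Rightarrow> 'v set"
  where "subspace_span V S = (\<lambda>U. submodule U ring_of_type_algebra V) hull S"

definition free_space :: "'b set \<Rightarrow> ('a::field, 'b \<Rightarrow>\<^sub>0 'a) module"
  where "free_space S =
    \<lparr>carrier = {p. Poly_Mapping.keys p \<subseteq> S}, monoid.mult = undefined, one = undefined,
     ring.zero = 0, add = (+), module.smult = scale\<rparr>"

definition line :: "('a::field, 'a) module"
  where "line = \<lparr>carrier = UNIV, monoid.mult = (*), one = 1, ring.zero = 0, add = (+), module.smult = (*)\<rparr>"

text \<open>
  The quotient of a vector space by a subspace. On the ring part this is
  \<open>FactRing\<close>, so that it is also the quotient of an algebra by an ideal.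
\<close>

definition quot_module :: "('a::field, 'v) module \<Rightarrow> 'v set \<Rightarrow> ('a, 'v set) module"
  where "quot_module V U =
    \<lparr>carrier = a_rcosets\<^bsub>V\<^esub> U, monoid.mult = rcoset_mult V U, one = U +>\<^bsub>V\<^esub> \<one>\<^bsub>V\<^esub>,
     ring.zero = U, add = set_add V, module.smult = (\<lambda>c C. \<Union>x\<in>C. U +>\<^bsub>V\<^esub> (c \<odot>\<^bsub>V\<^esub> x))\<rparr>"

text \<open>The map into \<open>quot_module V U\<close> induced on cosets by a map into \<open>V\<close>.\<close>

definition quot_map :: "('a::field, 'v) module \<Rightarrow> 'v set \<Rightarrow> ('w \<Rightarrow> 'v) \<Rightarrow> 'w set \<Rightarrow> 'v set"
  where "quot_map V U f C = (\<Union>x\<in>C. U +>\<^bsub>V\<^esub> f x)"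


section \<open>Left modules over an algebra and the Grothendieck group\<close>

text \<open>The locale \<open>module\<close> is restricted to commutative rings.\<close>

locale left_module = R?: ring R + M?: abelian_group M
    for R :: "('r, 'c) ring_scheme" (structure) and M :: "('r, 'v, 'd) module_scheme" (structure) +
  assumes lsmult_closed:
      "\<lbrakk>a \<in> carrier R; x \<in> carrier M\<rbrakk> \<Longrightarrow> a \<odot>\<^bsub>M\<^esub> x \<in> carrier M"
    and lsmult_l_distr:
      "\<lbrakk>a \<in> carrier R; b \<in> carrier R; x \<in> carrier M\<rbrakk> \<Longrightarrow>
       (a \<oplus>\<^bsub>R\<^esub> b) \<odot>\<^bsub>M\<^esub> x = a \<odot>\<^bsub>M\<^esub> x \<oplus>\<^bsub>M\<^esub> b \<odot>\<^bsub>M\<^esub> x"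
    and lsmult_r_distr:
      "\<lbrakk>a \<in> carrier R; x \<in> carrier M; y \<in> carrier M\<rbrakk> \<Longrightarrow>
       a \<odot>\<^bsub>M\<^esub> (x \<oplus>\<^bsub>M\<^esub> y) = a \<odot>\<^bsub>M\<^esub> x \<oplus>\<^bsub>M\<^esub> a \<odot>\<^bsub>M\<^esub> y"
    and lsmult_assoc:
      "\<lbrakk>a \<in> carrier R; b \<in> carrier R; x \<in> carrier M\<rbrakk> \<Longrightarrow>
       (a \<otimes>\<^bsub>R\<^esub> b) \<odot>\<^bsub>M\<^esub> x = a \<odot>\<^bsub>M\<^esub> (b \<odot>\<^bsub>M\<^esub> x)"
    and lsmult_one: "x \<in> carrier M \<Longrightarrow> \<one>\<^bsub>R\<^esub> \<odot>\<^bsub>M\<^esub> x = x"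

definition fin_dim :: "('a::field, 'r) module \<Rightarrow> ('r, 'v) module \<Rightarrow> bool"
  where "fin_dim A V \<longleftrightarrow>
    (\<exists>B \<subseteq> carrier V. finite B \<and>
      (\<forall>v\<in>carrier V. \<exists>c :: 'v \<Rightarrow> 'a. v = (\<Oplus>\<^bsub>V\<^esub>b\<in>B. (c b \<odot>\<^bsub>A\<^esub> \<one>\<^bsub>A\<^esub>) \<odot>\<^bsub>V\<^esub> b)))"

definition lmod_hom ::
    "('r, 'c) ring_scheme \<Rightarrow> ('r, 'v) module \<Rightarrow> ('r, 'w) module \<Rightarrow> ('v \<Rightarrow> 'w) set"
  where "lmod_hom A V W =
    {f \<in> carrier V \<rightarrow> carrier W.
      (\<forall>x\<in>carrier V. \<forall>y\<in>carrier V. f (x \<oplus>\<^bsub>V\<^esub> y) = f x \<oplus>\<^bsub>W\<^esub> f y) \<and>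
      (\<forall>a\<in>carrier A. \<forall>x\<in>carrier V. f (a \<odot>\<^bsub>V\<^esub> x) = a \<odot>\<^bsub>W\<^esub> f x)}"

definition lmod_iso :: "('r, 'c) ring_scheme \<Rightarrow> ('r, 'v) module \<Rightarrow> ('r, 'w) module \<Rightarrow> bool"
  where "lmod_iso A V W \<longleftrightarrow> (\<exists>f\<in>lmod_hom A V W. bij_betw f (carrier V) (carrier W))"

text \<open>There is a short exact sequence \<open>0 \<rightarrow> U \<rightarrow> V \<rightarrow> W \<rightarrow> 0\<close>.\<close>

definition short_exact ::
    "('r, 'c) ring_scheme \<Rightarrow> ('r, 'u) module \<Rightarrow> ('r, 'v) module \<Rightarrow> ('r, 'w) module \<Rightarrow> bool"
  where "short_exact A U V W \<longleftrightarrow>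
    (\<exists>f\<in>lmod_hom A U V. \<exists>g\<in>lmod_hom A V W.
      inj_on f (carrier U) \<and> g ` carrier V = carrier W \<and>
      f ` carrier U = {v \<in> carrier V. g v = \<zero>\<^bsub>W\<^esub>})"

text \<open>
  The generators of the Grothendieck group must live on one type. The type
  \<open>nat \<Rightarrow>\<^sub>0 'a\<close> contains vector spaces of every finite dimension, hence
  an isomorphic copy of every finite dimensional \<open>A\<close>-module. Isomorphic modules get the same
  class because an isomorphism is a short exact sequence with one term zero. The group is
  written multiplicatively: \<open>\<otimes>\<close> and \<open>[^]\<close> are addition and multiplication by a number.
\<close>

definition fd_modules :: "('a::field, 'r) module \<Rightarrow> ('r, nat \<Rightarrow>\<^sub>0 'a) module set"
  where "fd_modules A = {V. left_module A V \<and> fin_dim A V}"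

definition K0_relations ::
    "('a::field, 'r) module \<Rightarrow> (('r, nat \<Rightarrow>\<^sub>0 'a) module \<Rightarrow>\<^sub>0 int) set"
  where "K0_relations A =
    generate (free_Abelian_group (fd_modules A))
      {frag_of V - frag_of U - frag_of W | U V W.
        U \<in> fd_modules A \<and> V \<in> fd_modules A \<and> W \<in> fd_modules A \<and> short_exact A U V W}"

definition K0 ::
    "('a::field, 'r) module \<Rightarrow> (('r, nat \<Rightarrow>\<^sub>0 'a) module \<Rightarrow>\<^sub>0 int) set monoid"
  where "K0 A = free_Abelian_group (fd_modules A) Mod K0_relations A"

definition K0_class ::
    "('a::field, 'r) module \<Rightarrow> ('r, 'v) module \<Rightarrow> (('r, nat \<Rightarrow>\<^sub>0 'a) module \<Rightarrow>\<^sub>0 int) set"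
  where "K0_class A V =
    K0_relations A #>\<^bsub>free_Abelian_group (fd_modules A)\<^esub>
      frag_of (SOME W. W \<in> fd_modules A \<and> lmod_iso A V W)"


section \<open>The 0-Hecke algebra\<close>

text \<open>
  The word \<open>[i\<^sub>1, \<dots>, i\<^sub>r]\<close> stands for the noncommutative monomial in the generators
  with these indices. Concatenation of words makes \<open>nat list \<Rightarrow>\<^sub>0 'a\<close>
  with its library multiplication the free algebra.
\<close>

instantiation list :: (type) monoid_add
begin

definition zero_list :: "'a list" where "zero_list = []"
definition plus_list :: "'a list \<Rightarrow> 'a list \<Rightarrow> 'a list" where "plus_list = (@)"

instance by standard (simp_all add: zero_list_def plus_list_def)

end

type_synonym 'a hecke = "(nat list \<Rightarrow>\<^sub>0 'a) set"

abbreviation gen_words :: "nat \<Rightarrow> nat list set"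
  where "gen_words n \<equiv> lists {1..<n}"

abbreviation word_monom :: "nat list \<Rightarrow> nat list \<Rightarrow>\<^sub>0 'a::field"
  where "word_monom w \<equiv> Poly_Mapping.single w 1"

definition free_algebra :: "nat \<Rightarrow> ('a::field, nat list \<Rightarrow>\<^sub>0 'a) module"
  where "free_algebra n =
    \<lparr>carrier = {p. Poly_Mapping.keys p \<subseteq> gen_words n}, monoid.mult = (*), one = 1,
     ring.zero = 0, add = (+), module.smult = scale\<rparr>"

definition hecke_ideal :: "nat \<Rightarrow> (nat list \<Rightarrow>\<^sub>0 'a::field) set"
  where "hecke_ideal n = Idl\<^bsub>free_algebra n\<^esub>
    ({word_monom [i, i] - word_monom [i] | i. i \<in> {1..<n}} \<union>
     {word_monom [i, i + 1, i] - word_monom [i + 1, i, i + 1] | i. i \<in> {1..<n} \<and> i + 1 \<in> {1..<n}} \<union>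
     {word_monom [i, j] - word_monom [j, i] | i j. i \<in> {1..<n} \<and> j \<in> {1..<n} \<and> \<bar>int i - int j\<bar> > 1})"

definition hecke :: "nat \<Rightarrow> ('a::field, 'a hecke) module"
  where "hecke n = quot_module (free_algebra n) (hecke_ideal n)"

definition pi_word :: "nat \<Rightarrow> nat list \<Rightarrow> 'a::field hecke"
  where "pi_word n w = hecke_ideal n +>\<^bsub>free_algebra n\<^esub> word_monom w"

definition word_perm :: "nat list \<Rightarrow> nat \<Rightarrow> nat"
  where "word_perm u = foldr (\<lambda>i f. transpose i (i + 1) \<circ> f) u id"

definition pi_perm :: "nat \<Rightarrow> (nat \<Rightarrow> nat) \<Rightarrow> 'a::field hecke"
  where "pi_perm n w =
    pi_word n (arg_min length (\<lambda>u. u \<in> gen_words n \<and> word_perm u = w))"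

text \<open>
  The monoid \<open>\<M>\<^sub>n\<close>: the basis elements \<open>pi_perm n w\<close> are exactly the products of generators.
\<close>

definition hecke_monoid :: "nat \<Rightarrow> 'a::field hecke set"
  where "hecke_monoid n = pi_word n ` gen_words n"

text \<open>The inclusion of \<open>\<M>\<^sub>n\<close> into \<open>\<M>\<^sub>m\<close> for \<open>n \<le> m\<close> sends generators to generators.\<close>

definition hecke_incl :: "nat \<Rightarrow> 'a::field hecke \<Rightarrow> 'a hecke"
  where "hecke_incl m x = quot_map (free_algebra m) (hecke_ideal m) (\<lambda>p. p) x"

text \<open>
  The module on the vector space \<open>V\<close> on which the \<open>i\<close>-th generator acts by \<open>T i\<close>. It is a module
  when the \<open>T i\<close> are linear and satisfy the defining relations; the choice of the
  representative \<open>p\<close> is then immaterial.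
\<close>

definition hecke_module ::
    "nat \<Rightarrow> ('a::field, 'v) module \<Rightarrow> (nat \<Rightarrow> 'v \<Rightarrow> 'v) \<Rightarrow> ('a hecke, 'v) module"
  where "hecke_module n V T =
    \<lparr>carrier = carrier V, monoid.mult = monoid.mult V, one = \<one>\<^bsub>V\<^esub>, ring.zero = \<zero>\<^bsub>V\<^esub>, add = add V,
     module.smult = (\<lambda>h v. let p = (SOME p. p \<in> h) in
       \<Oplus>\<^bsub>V\<^esub>w\<in>Poly_Mapping.keys p. Poly_Mapping.lookup p w \<odot>\<^bsub>V\<^esub> foldr T w v)\<rparr>"


section \<open>The 0-Hecke category and its modules\<close>

type_synonym 'a morph = "'a hecke set"

definition hom_rel :: "nat \<Rightarrow> nat \<Rightarrow> ('a::field hecke \<times> 'a hecke) set"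
  where "hom_rel n m =
    (let r = {(x, x \<otimes>\<^bsub>hecke m\<^esub> pi_word m [j]) | x j. x \<in> hecke_monoid m \<and> j \<in> {n + 1..<m}}
     in (r \<union> r\<inverse>)\<^sup>*)"

definition Hom :: "nat \<Rightarrow> nat \<Rightarrow> 'a::field morph set"
  where "Hom n m = (if n \<le> m then hecke_monoid m // hom_rel n m else {})"

definition hom_class :: "nat \<Rightarrow> nat \<Rightarrow> 'a::field hecke \<Rightarrow> 'a morph"
  where "hom_class n m x = hom_rel n m `` {x}"

text \<open>\<open>hcomp n m l G F\<close> is the composite of \<open>G : [m] \<rightarrow> [l]\<close> after \<open>F : [n] \<rightarrow> [m]\<close>.\<close>

definition hcomp :: "nat \<Rightarrow> nat \<Rightarrow> nat \<Rightarrow> 'a::field morph \<Rightarrow> 'a morph \<Rightarrow> 'a morph"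
  where "hcomp n m l G F =
    (\<Union>y\<in>G. \<Union>x\<in>F. hom_class n l (y \<otimes>\<^bsub>hecke l\<^esub> hecke_incl l x))"

definition inj_morph :: "nat \<Rightarrow> nat \<Rightarrow> (nat \<Rightarrow> nat) \<Rightarrow> 'a::field morph"
  where "inj_morph n m f =
    hom_class n m (pi_perm m (THE w. w permutes {1..m} \<and> (\<forall>i\<in>{1..n}. w i = f i) \<and>
      strict_mono_on {n + 1..m} w))"

text \<open>
  The data of a functor to vector spaces: \<open>act V m l f\<close> is the map
  \<open>space V m \<rightarrow> space V l\<close> of the morphism \<open>f \<in> Hom m l\<close>.
\<close>

record ('a, 'v, 'f) functor_data =
  space :: "nat \<Rightarrow> ('a, 'v) module"
  act :: "nat \<Rightarrow> nat \<Rightarrow> 'f \<Rightarrow> 'v \<Rightarrow> 'v"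

type_synonym ('a, 'v) hmodule = "('a, 'v, 'a morph) functor_data"

text \<open>The degree \<open>m\<close> part as a module over \<open>H\<^sub>m(0)\<close>, via \<open>Hom m m = {{x} | x \<in> \<M>\<^sub>m}\<close>.\<close>

definition degree_part :: "('a::field, 'v) hmodule \<Rightarrow> nat \<Rightarrow> ('a hecke, 'v) module"
  where "degree_part V m =
    hecke_module m (space V m) (\<lambda>i. act V m m (hom_class m m (pi_word m [i])))"

definition hsubmodule :: "('a::field, 'v) hmodule \<Rightarrow> (nat \<Rightarrow> 'v set) \<Rightarrow> bool"
  where "hsubmodule V U \<longleftrightarrow>
    (\<forall>m. submodule (U m) ring_of_type_algebra (space V m)) \<and>
    (\<forall>m l. \<forall>f\<in>Hom m l. \<forall>u\<in>U m. act V m l f u \<in> U l)"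

definition hsubmodule_gen :: "('a::field, 'v) hmodule \<Rightarrow> nat \<Rightarrow> 'v \<Rightarrow> nat \<Rightarrow> 'v set"
  where "hsubmodule_gen V d v m = \<Inter>{U m | U. hsubmodule V U \<and> v \<in> U d}"

definition hquot :: "('a::field, 'v) hmodule \<Rightarrow> (nat \<Rightarrow> 'v set) \<Rightarrow> ('a, 'v set) hmodule"
  where "hquot V U =
    \<lparr>space = (\<lambda>m. quot_module (space V m) (U m)),
     act = (\<lambda>m l f. quot_map (space V l) (U l) (act V m l f))\<rparr>"


section \<open>The modules \<open>M(\<alpha>, k)\<close>\<close>

definition composition :: "nat list \<Rightarrow> bool"
  where "composition \<alpha> \<longleftrightarrow> (\<forall>a\<in>set \<alpha>. 0 < a)"

definition descent_set :: "nat list \<Rightarrow> nat set"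
  where "descent_set \<alpha> = {sum_list (take j \<alpha>) | j. 1 \<le> j \<and> j < length \<alpha>}"

text \<open>The one-dimensional module \<open>C\<^sub>\<alpha>\<close>, with basis vector \<open>v\<^sub>\<alpha> = 1\<close>.\<close>

definition C_mod :: "nat list \<Rightarrow> ('a::field hecke, 'a) module"
  where "C_mod \<alpha> =
    hecke_module (sum_list \<alpha>) line (\<lambda>i v. if i \<in> descent_set \<alpha> then 0 else v)"

text \<open>Composition extended linearly: a morphism on the left, an algebra element on the right.\<close>

definition hom_lact ::
    "nat \<Rightarrow> nat \<Rightarrow> nat \<Rightarrow> 'a::field morph \<Rightarrow> ('a morph \<Rightarrow>\<^sub>0 'a) \<Rightarrow> ('a morph \<Rightarrow>\<^sub>0 'a)"
  where "hom_lact n m l f a =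
    (\<Sum>g\<in>Poly_Mapping.keys a.
       Poly_Mapping.single (hcomp n m l f g) (Poly_Mapping.lookup a g))"

definition hom_ract ::
    "nat \<Rightarrow> nat \<Rightarrow> ('a::field morph \<Rightarrow>\<^sub>0 'a) \<Rightarrow> 'a hecke \<Rightarrow> ('a morph \<Rightarrow>\<^sub>0 'a)"
  where "hom_ract n m a h =
    (let p = (SOME p. p \<in> h) in
     \<Sum>g\<in>Poly_Mapping.keys a. \<Sum>w\<in>Poly_Mapping.keys p.
       Poly_Mapping.single (hcomp n n m g (hom_class n n (pi_word n w)))
         (Poly_Mapping.lookup a g * Poly_Mapping.lookup p w))"

text \<open>
  The tensor product over the algebra \<open>A\<close> of a vector space \<open>P\<close> with right action \<open>r\<close> of \<open>A\<close>
  and a left \<open>A\<close>-module \<open>W\<close>, as a quotient of the vector space on \<open>P \<times> W\<close>. Homogeneity in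
  the second argument follows from homogeneity in the first and balancing.
\<close>

definition tensor_rel ::
    "('a::field, 'r) module \<Rightarrow> ('a, 'v) module \<Rightarrow> ('v \<Rightarrow> 'r \<Rightarrow> 'v) \<Rightarrow> ('r, 'w) module \<Rightarrow>
     ('v \<times> 'w \<Rightarrow>\<^sub>0 'a) set"
  where "tensor_rel A P r W =
    (let e = (\<lambda>x y. Poly_Mapping.single (x, y) 1) in
     subspace_span (free_space (carrier P \<times> carrier W))
      ({e (x \<oplus>\<^bsub>P\<^esub> x') y - e x y - e x' y | x x' y.
          x \<in> carrier P \<and> x' \<in> carrier P \<and> y \<in> carrier W} \<union>
       {e x (y \<oplus>\<^bsub>W\<^esub> y') - e x y - e x y' | x y y'.
          x \<in> carrier P \<and> y \<in> carrier W \<and> y' \<in> carrier W} \<union>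
       {e (c \<odot>\<^bsub>P\<^esub> x) y - scale c (e x y) | c x y. x \<in> carrier P \<and> y \<in> carrier W} \<union>
       {e (r x h) y - e x (h \<odot>\<^bsub>W\<^esub> y) | x h y.
          x \<in> carrier P \<and> h \<in> carrier A \<and> y \<in> carrier W}))"

type_synonym 'a tensor = "(('a morph \<Rightarrow>\<^sub>0 'a) \<times> 'a \<Rightarrow>\<^sub>0 'a) set"

definition M_space :: "nat list \<Rightarrow> nat \<Rightarrow> ('a::field, ('a morph \<Rightarrow>\<^sub>0 'a) \<times> 'a \<Rightarrow>\<^sub>0 'a) module"
  where "M_space \<alpha> m =
    free_space (carrier (free_space (Hom (sum_list \<alpha>) m) :: ('a, _) module)
      \<times> carrier (C_mod \<alpha>))"

definition M_rel :: "nat list \<Rightarrow> nat \<Rightarrow> (('a::field morph \<Rightarrow>\<^sub>0 'a) \<times> 'a \<Rightarrow>\<^sub>0 'a) set"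
  where "M_rel \<alpha> m =
    tensor_rel (hecke (sum_list \<alpha>)) (free_space (Hom (sum_list \<alpha>) m))
      (hom_ract (sum_list \<alpha>) m) (C_mod \<alpha>)"

definition M_hmod :: "nat list \<Rightarrow> ('a::field, 'a tensor) hmodule"
  where "M_hmod \<alpha> =
    \<lparr>space = (\<lambda>m. quot_module (M_space \<alpha> m) (M_rel \<alpha> m)),
     act = (\<lambda>m l f. quot_map (M_space \<alpha> l) (M_rel \<alpha> l)
       (\<lambda>q. \<Sum>(a, b)\<in>Poly_Mapping.keys q.
          Poly_Mapping.single (hom_lact (sum_list \<alpha>) m l f a, b)
            (Poly_Mapping.lookup q (a, b))))\<rparr>"

text \<open>The element \<open>f \<otimes> v\<^sub>\<alpha>\<close> in degree \<open>m\<close>.\<close>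

definition M_elt :: "nat list \<Rightarrow> nat \<Rightarrow> 'a::field morph \<Rightarrow> 'a tensor"
  where "M_elt \<alpha> m f =
    M_rel \<alpha> m +>\<^bsub>M_space \<alpha> m\<^esub> Poly_Mapping.single (Poly_Mapping.single f 1, 1) 1"

definition g_inj :: "nat \<Rightarrow> int \<Rightarrow> nat \<Rightarrow> nat"
  where "g_inj n k i = (if int i \<ge> int n - k then i + 1 else i)"

text \<open>
  The submodule of \<open>M_hmod \<alpha>\<close> divided out in \<open>Mk_hmod \<alpha> k\<close>. For \<open>k = |\<alpha>|\<close> it is zero, so that
  \<open>Mk_hmod \<alpha> k\<close> is \<open>M_hmod \<alpha>\<close> up to the canonical isomorphism.
\<close>

definition Mk_sub :: "nat list \<Rightarrow> int \<Rightarrow> nat \<Rightarrow> 'a::field tensor set"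
  where "Mk_sub \<alpha> k m =
    (let n = sum_list \<alpha> in
     if k = int n then {\<zero>\<^bsub>space (M_hmod \<alpha>) m\<^esub>}
     else if k = -1 then
       (if m = n then {\<zero>\<^bsub>space (M_hmod \<alpha>) m\<^esub>} else carrier (space (M_hmod \<alpha>) m))
     else hsubmodule_gen (M_hmod \<alpha>) (n + 1)
       (M_elt \<alpha> (n + 1) (inj_morph n (n + 1) (g_inj n k))) m)"

definition Mk_hmod :: "nat list \<Rightarrow> int \<Rightarrow> ('a::field, 'a tensor set) hmodule"
  where "Mk_hmod \<alpha> k = hquot (M_hmod \<alpha>) (Mk_sub \<alpha> k)"


section \<open>The Stanley-Reisner ring of the Boolean algebra\<close>

text \<open>
  A polynomial in variables indexed by sets of numbers is a finitely supported function on
  exponent vectors \<open>nat set \<Rightarrow>\<^sub>0 nat\<close>.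
\<close>

type_synonym 'a mpoly = "(nat set \<Rightarrow>\<^sub>0 nat) \<Rightarrow>\<^sub>0 'a"

definition poly_algebra :: "nat \<Rightarrow> ('a::field, 'a mpoly) module"
  where "poly_algebra n =
    \<lparr>carrier = {p. \<forall>e\<in>Poly_Mapping.keys p. Poly_Mapping.keys e \<subseteq> Pow {1..n}},
     monoid.mult = (*), one = 1, ring.zero = 0, add = (+), module.smult = scale\<rparr>"

definition yvar :: "nat set \<Rightarrow> 'a::field mpoly"
  where "yvar A = Poly_Mapping.single (Poly_Mapping.single A 1) 1"

definition boolean_ideal :: "nat \<Rightarrow> 'a::field mpoly set"
  where "boolean_ideal n = Idl\<^bsub>poly_algebra n\<^esub>
    {yvar A * yvar B | A B. A \<subseteq> {1..n} \<and> B \<subseteq> {1..n} \<and> \<not> A \<subseteq> B \<and> \<not> B \<subseteq> A}"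

definition boolean_ring :: "nat \<Rightarrow> ('a::field, 'a mpoly set) module"
  where "boolean_ring n = quot_module (poly_algebra n) (boolean_ideal n)"

definition multichain :: "nat \<Rightarrow> nat set list \<Rightarrow> bool"
  where "multichain n M \<longleftrightarrow> sorted_wrt (\<subseteq>) M \<and> (\<forall>A\<in>set M. A \<subseteq> {1..n})"

definition y_mono :: "nat \<Rightarrow> nat set list \<Rightarrow> 'a::field mpoly set"
  where "y_mono n M = boolean_ideal n +>\<^bsub>poly_algebra n\<^esub> prod_list (map yvar M)"

definition p_index :: "nat \<Rightarrow> nat set list \<Rightarrow> nat \<Rightarrow> nat"
  where "p_index n M i =
    (LEAST j. 1 \<le> j \<and> j \<le> length M + 1 \<and> i \<in> (M @ [{1..n}]) ! (j - 1))"

definition swap_chain :: "nat \<Rightarrow> nat set list \<Rightarrow> nat set list"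
  where "swap_chain i M = map (\<lambda>A. transpose i (i + 1) ` A) M"

text \<open>
  The linear operator given on the basis of monomials of multichains; its values
  outside the carrier are irrelevant.
\<close>

definition boolean_op :: "nat \<Rightarrow> nat \<Rightarrow> 'a::field mpoly set \<Rightarrow> 'a mpoly set"
  where "boolean_op n i =
    (SOME T. T \<in> lmod_hom (ring_of_type_algebra :: 'a ring) (boolean_ring n) (boolean_ring n) \<and>
      (\<forall>M. multichain n M \<longrightarrow> T (y_mono n M) =
        (if p_index n M i > p_index n M (i + 1) then \<zero>\<^bsub>boolean_ring n\<^esub>
         else if p_index n M i = p_index n M (i + 1) then y_mono n M
         else y_mono n (swap_chain i M) \<oplus>\<^bsub>boolean_ring n\<^esub> y_mono n M)))"

definition boolean_piece :: "nat \<Rightarrow> nat list \<Rightarrow> ('a::field hecke, 'a mpoly set) module"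
  where "boolean_piece n g =
    hecke_module n
      ((boolean_ring n)
        \<lparr>carrier := subspace_span (boolean_ring n)
           {y_mono n M | M. multichain n M \<and> map card M = g}\<rparr>)
      (boolean_op n)"

end

theory Submission
  imports Defs "HOL-Library.Product_Lexorder"
begin

text \<open>
  Reading off the positions of the letters identifies a multichain of multigrading \<open>g\<close> with a word of
  length \<open>n\<close> in the letters \<open>1, \<dots>, k + 1\<close>. The action is triangular for the order by \<open>\<Sum>j. j * p j\<close>, so
  the class of \<open>F[B\<^sub>n]\<^sub>g\<close> is the sum over these words of the one-dimensional classes given by their
  descent sets. In the same way \<open>M(\<alpha>)\<^sub>n\<close> has a basis indexed by the subsets of \<open>{1..n}\<close> of size \<open>|\<alpha>|\<close>, and
  its class is the sum over the words obtained by shuffling a fixed word with descent set \<open>D(\<alpha>)\<close>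
  with dummy letters that are \<^emph>\<open>smaller\<close> than all others. In the multichain words the letter \<open>k + 1\<close>
  occurs \<open>n - r\<^sub>k\<close> times and is the \<^emph>\<open>largest\<close> one, but the distribution of descent sets over words of given
  content does not depend on the order of the letters. Hence the class of \<open>F[B\<^sub>n]\<^sub>g\<close> is the sum of the
  classes of \<open>M(\<alpha>, r\<^sub>k)\<^sub>n\<close> over the words in \<open>1, \<dots>, k\<close> of length \<open>r\<^sub>k\<close>, with \<open>\<alpha>\<close> the composition of the
  descent set of the word; this already holds for \<open>n \<ge> r\<^sub>k\<close>.
\<close>

text \<open>The order of the letters does not matter because a word with descents inside D increases
  weakly on each block cut out by D, so it is determined by how its content is distributed over the
  blocks; inclusion-exclusion then isolates the descent set D itself. Equivalently, ribbon Schur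
  functions are symmetric. The dummies are small in M(\<alpha>) because a generator moves a strand
  over a dummy on its right, so its diagonal entry is 0 there as at a descent, while a dummy
  followed by a strand is fixed. The obstacle is that the objects are given by presentations: the
  algebra by relations, the Hom sets by an equivalence relation, M(\<alpha>) by a tensor product. An
  action on subsets of positions bounds M(\<alpha>) from below, and rewriting words to normal forms
  bounds it from above. The coefficients can be independent of n since they count words of the fixed
  length \<open>r\<^sub>k\<close>; only the number of dummies grows.\<close>

declare One_nat_def [simp del] single_one [simp del]

section \<open>Vector spaces with a chosen basis\<close>

section \<open>Linear extension\<close>

lemma lookup_scale [simp]: "Poly_Mapping.lookup (scale c p) k = c * Poly_Mapping.lookup p k"
  by (simp add: Poly_Mapping.map.rep_eq when_def)

lemma scale_single [simp]: "scale c (Poly_Mapping.single k d) = Poly_Mapping.single k (c * d)"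
  by (rule poly_mapping_eqI) (simp add: lookup_single when_def)

lemma scale_simps [simp]: "scale c 0 = 0" "scale 0 p = 0" "scale 1 p = p"
  by (rule poly_mapping_eqI, simp)+

lemma scale_add: "scale c (p + q) = scale c p + scale c q"
  by (rule poly_mapping_eqI) (simp add: lookup_add algebra_simps)

lemma scale_diff: "scale c (p - q) = scale c p - scale c q"
  by (rule poly_mapping_eqI) (simp add: lookup_minus algebra_simps)

lemma scale_scale: "scale c (scale d p) = scale (c * d) p"
  by (rule poly_mapping_eqI) simp

lemma scale_add_left: "scale (c + d) p = scale c p + scale d p"
  by (rule poly_mapping_eqI) (simp add: lookup_add algebra_simps)

lemma scale_sum: "scale c (sum f A) = (\<Sum>x\<in>A. scale c (f x))"
  by (induction A rule: infinite_finite_induct) (simp_all add: scale_add)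

lemma keys_scale: "Poly_Mapping.keys (scale c p) \<subseteq> Poly_Mapping.keys p"
  by (auto simp: in_keys_iff)

text \<open>Linear maps between spaces with a basis are put in this form, so that identities between
  composites reduce to basis elements through \<open>lin_lin\<close> and
  \<open>lin_cong\<close>.\<close>

definition lin :: "('b \<Rightarrow> 'c \<Rightarrow>\<^sub>0 'a::field) \<Rightarrow> ('b \<Rightarrow>\<^sub>0 'a) \<Rightarrow> ('c \<Rightarrow>\<^sub>0 'a)"
  where "lin F p = (\<Sum>w\<in>Poly_Mapping.keys p. scale (Poly_Mapping.lookup p w) (F w))"

lemma lin_superset:
  assumes "finite S" "Poly_Mapping.keys p \<subseteq> S"
  shows "lin F p = (\<Sum>w\<in>S. scale (Poly_Mapping.lookup p w) (F w))"
  unfolding lin_def by (rule sum.mono_neutral_left) (use assms in \<open>auto simp: in_keys_iff\<close>)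

lemma lin_add: "lin F (p + q) = lin F p + lin F q"
proof -
  let ?S = "Poly_Mapping.keys p \<union> Poly_Mapping.keys q"
  have "lin F (p + q) = (\<Sum>w\<in>?S. scale (Poly_Mapping.lookup (p + q) w) (F w))"
    by (rule lin_superset) (use Poly_Mapping.keys_add[of p q] in auto)
  also have "\<dots> = lin F p + lin F q"
    by (simp add: lin_superset[of ?S] lookup_add scale_add_left sum.distrib)
  finally show ?thesis .
qed

lemma lin_single [simp]: "lin F (Poly_Mapping.single w c) = scale c (F w)"
  by (cases "c = 0") (simp_all add: lin_def)

lemma lin_0 [simp]: "lin F 0 = 0"
  by (simp add: lin_def)

lemma lin_scale: "lin F (scale c p) = scale c (lin F p)"
proof -
  have "lin F (scale c p) = (\<Sum>w\<in>Poly_Mapping.keys p. scale (Poly_Mapping.lookup (scale c p) w) (F w))"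
    by (rule lin_superset) (auto simp: in_keys_iff)
  then show ?thesis by (simp add: lin_def scale_sum scale_scale)
qed

lemma lin_uminus: "lin F (- p) = - lin F p"
  using lin_add[of F p "- p"] by (simp add: eq_neg_iff_add_eq_0 add.commute)

lemma lin_diff: "lin F (p - q) = lin F p - lin F q"
  using lin_add[of F p "- q"] by (simp add: lin_uminus)

lemma lin_sum: "lin F (sum f A) = (\<Sum>x\<in>A. lin F (f x))"
  by (induction A rule: infinite_finite_induct) (simp_all add: lin_add)

lemma lin_lin: "lin G (lin F p) = lin (\<lambda>w. lin G (F w)) p"
  unfolding lin_def[of F] lin_sum lin_scale by (simp add: lin_def)

lemma lin_id [simp]: "lin (\<lambda>w. Poly_Mapping.single w 1) p = p"
proof (rule poly_mapping_eqI)
  fix k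
  show "Poly_Mapping.lookup (lin (\<lambda>w. Poly_Mapping.single w 1) p) k = Poly_Mapping.lookup p k"
    by (cases "k \<in> Poly_Mapping.keys p")
       (simp_all add: lin_def lookup_sum lookup_single when_def in_keys_iff sum.delta)
qed

lemma lin_cong: "(\<And>w. w \<in> Poly_Mapping.keys p \<Longrightarrow> F w = G w) \<Longrightarrow> lin F p = lin G p"
  by (simp add: lin_def)

lemma lin_fun_add: "lin (\<lambda>w. F w + G w) p = lin F p + lin G p"
  by (simp add: lin_def scale_add sum.distrib)

lemma lin_fun_scale: "lin (\<lambda>w. scale c (F w)) p = scale c (lin F p)"
  by (simp add: lin_def scale_sum scale_scale mult.commute)

lemma lin_fun_zero [simp]: "lin (\<lambda>w. 0) p = 0"
  by (simp add: lin_def)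

lemma keys_lin: "Poly_Mapping.keys (lin F p) \<subseteq> (\<Union>w\<in>Poly_Mapping.keys p. Poly_Mapping.keys (F w))"
  unfolding lin_def by (rule order_trans[OF keys_sum]) (rule UN_mono[OF subset_refl keys_scale])

lemma keys_lin_subset:
  assumes "Poly_Mapping.keys p \<subseteq> S" "\<And>w. w \<in> S \<Longrightarrow> Poly_Mapping.keys (F w) \<subseteq> T"
  shows "Poly_Mapping.keys (lin F p) \<subseteq> T"
  using keys_lin[of F p] assms by blast

lemma keys_uminus_subset: "Poly_Mapping.keys p \<subseteq> S \<Longrightarrow> Poly_Mapping.keys (- p) \<subseteq> S"
  for p :: "'b \<Rightarrow>\<^sub>0 'a::ab_group_add"
  by (auto simp: in_keys_iff)

lemma keys_add_subset:
  "Poly_Mapping.keys p \<subseteq> S \<Longrightarrow> Poly_Mapping.keys q \<subseteq> S \<Longrightarrow> Poly_Mapping.keys (p + q) \<subseteq> S"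
  using Poly_Mapping.keys_add[of p q] by blast

lemma keys_diff_subset:
  "Poly_Mapping.keys p \<subseteq> S \<Longrightarrow> Poly_Mapping.keys q \<subseteq> S \<Longrightarrow> Poly_Mapping.keys (p - q) \<subseteq> S"
  for p :: "'b \<Rightarrow>\<^sub>0 'a::ab_group_add"
  by (auto simp: in_keys_iff lookup_minus) (metis diff_0_right diff_self subsetD in_keys_iff)

text \<open>Induction through the finite support. The summands keep their support in
  \<open>S\<close>, which the applications need for closure conditions.\<close>

lemma poly_mapping_span_induct [consumes 1, case_names zero add single]:
  assumes "Poly_Mapping.keys p \<subseteq> S" "P 0"
    "\<And>p q. Poly_Mapping.keys p \<subseteq> S \<Longrightarrow> Poly_Mapping.keys q \<subseteq> S \<Longrightarrow> P p \<Longrightarrow> P q \<Longrightarrow> P (p + q)"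
    "\<And>k c. k \<in> S \<Longrightarrow> P (Poly_Mapping.single k c)"
  shows "P (p :: 'b \<Rightarrow>\<^sub>0 'a::field)"
proof -
  have "P (lin (\<lambda>w. Poly_Mapping.single w 1) p)"
  proof -
    have "Poly_Mapping.keys (\<Sum>w\<in>A. scale (Poly_Mapping.lookup p w) (Poly_Mapping.single w 1)) \<subseteq> S \<and>
      P (\<Sum>w\<in>A. scale (Poly_Mapping.lookup p w) (Poly_Mapping.single w 1))"
      if "finite A" "A \<subseteq> S" for A
      using that
    proof (induction A)
      case empty then show ?case by (simp add: assms(2))
    next
      case (insert x F)
      have "Poly_Mapping.keys (Poly_Mapping.single x (Poly_Mapping.lookup p x)) \<subseteq> S"
        using insert.prems by auto
      then show ?case using insert assms(3,4) by (simp add: keys_add_subset)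
    qed
    then show ?thesis unfolding lin_def using assms(1) finite_keys by blast
  qed
  then show ?thesis by simp
qed

text \<open>Multiplication is convolution, so a linear map on a product becomes a double sum over
  concatenated words. Ideal membership and associativity of the action are computed this
  way.\<close>

lemma lin_mult:
  "lin G (p * q) = lin (\<lambda>u. lin (\<lambda>v. G (u + v)) q) p"
  for p q :: "'b::monoid_add \<Rightarrow>\<^sub>0 'a::field"
proof -
  have 1: "lin G (Poly_Mapping.single u c * q) = scale c (lin (\<lambda>v. G (u + v)) q)" for u c
  proof -
    have "Poly_Mapping.keys q \<subseteq> UNIV" by simp
    then show ?thesis
    proof (induction q rule: poly_mapping_span_induct)
      case zero then show ?case by simp
    next
      case (add p q) then show ?case by (simp add: distrib_left lin_add scale_add)
    next
      case (single k d) then show ?case by (simp add: mult_single scale_scale)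
    qed
  qed
  have "Poly_Mapping.keys p \<subseteq> UNIV" by simp
  then show ?thesis
  proof (induction p rule: poly_mapping_span_induct)
    case zero then show ?case by simp
  next
    case (add p q) then show ?case by (simp add: distrib_right lin_add)
  next
    case (single k d) then show ?case by (simp add: 1)
  qed
qed


section \<open>The 0-Hecke monoid as words modulo a congruence, and its algebra\<close>

section \<open>Words and the 0-Hecke algebra\<close>

inductive hrel :: "nat \<Rightarrow> nat list \<Rightarrow> nat list \<Rightarrow> bool" for n where
  idem: "i \<in> {1..<n} \<Longrightarrow> hrel n [i, i] [i]"
| braid: "i \<in> {1..<n} \<Longrightarrow> i + 1 \<in> {1..<n} \<Longrightarrow> hrel n [i, i + 1, i] [i + 1, i, i + 1]"
| comm: "i \<in> {1..<n} \<Longrightarrow> j \<in> {1..<n} \<Longrightarrow> \<bar>int i - int j\<bar> > 1 \<Longrightarrow> hrel n [i, j] [j, i]"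

text \<open>The two-sided congruence of the presentation. Contexts are restricted to
  \<open>gen_words n\<close> so that rewriting never leaves the words in the generators;
  \<open>pi_word_eq_iff\<close> identifies it with equality of monomials in the algebra.\<close>

inductive hcong :: "nat \<Rightarrow> nat list \<Rightarrow> nat list \<Rightarrow> bool" for n where
  step: "hrel n l r \<Longrightarrow> u \<in> gen_words n \<Longrightarrow> v \<in> gen_words n \<Longrightarrow> hcong n (u @ l @ v) (u @ r @ v)"
| reflI: "hcong n w w"
| symI: "hcong n w w' \<Longrightarrow> hcong n w' w"
| transI: "hcong n w w' \<Longrightarrow> hcong n w' w'' \<Longrightarrow> hcong n w w''"

lemma hrel_words: "hrel n l r \<Longrightarrow> l \<in> gen_words n \<and> r \<in> gen_words n"
  by (auto elim!: hrel.cases)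

lemma hcong_words: "hcong n w w' \<Longrightarrow> w \<in> gen_words n \<longleftrightarrow> w' \<in> gen_words n"
  by (induction rule: hcong.induct) (auto dest: hrel_words)

lemma hcong_append:
  assumes "hcong n w w'" "u \<in> gen_words n" "v \<in> gen_words n"
  shows "hcong n (u @ w @ v) (u @ w' @ v)"
  using assms
proof (induction rule: hcong.induct)
  case (step l r a b)
  then have "hcong n ((u @ a) @ l @ (b @ v)) ((u @ a) @ r @ (b @ v))"
    by (intro hcong.step) auto
  then show ?case by simp
qed (auto intro: hcong.intros)

lemma hcong_respects:
  assumes "hcong n w w'"
    "\<And>l r u v. hrel n l r \<Longrightarrow> u \<in> gen_words n \<Longrightarrow> v \<in> gen_words n \<Longrightarrow> F (u @ l @ v) = F (u @ r @ v)"
  shows "F w = F w'"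
  using assms by (induction rule: hcong.induct) auto

text \<open>Operators satisfying the relations on an invariant set \<open>C\<close> give an action
  of the monoid of words. It serves both for linear operators on vectors and for partial maps on
  subsets.\<close>

lemma hrel_respects_foldr:
  assumes "hcong n w w'" "w \<in> gen_words n" "x \<in> C"
    and cl: "\<And>i x. i \<in> {1..<n} \<Longrightarrow> x \<in> C \<Longrightarrow> T i x \<in> C"
    and "\<And>i x. i \<in> {1..<n} \<Longrightarrow> x \<in> C \<Longrightarrow> T i (T i x) = T i x"
    and "\<And>i x. i \<in> {1..<n} \<Longrightarrow> i + 1 \<in> {1..<n} \<Longrightarrow> x \<in> C \<Longrightarrow>
           T i (T (i + 1) (T i x)) = T (i + 1) (T i (T (i + 1) x))"
    and "\<And>i j x. i \<in> {1..<n} \<Longrightarrow> j \<in> {1..<n} \<Longrightarrow> \<bar>int i - int j\<bar> > 1 \<Longrightarrow> x \<in> C \<Longrightarrow> T i (T j x) = T j (T i x)"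
  shows "foldr T w x = foldr T w' x"
proof (rule hcong_respects[OF assms(1), where F = "\<lambda>w. foldr T w x"])
  fix l r u v assume *: "hrel n l r" "u \<in> gen_words n" "v \<in> gen_words n"
  have "foldr T v x \<in> C" using *(3) assms(3) by (induction v) (auto intro: cl)
  with *(1) have "foldr T l (foldr T v x) = foldr T r (foldr T v x)"
  proof cases
    case (braid i)
    then show ?thesis using assms(6)[of i "foldr T v x"] \<open>foldr T v x \<in> C\<close> by simp
  next
    case (comm i j)
    then show ?thesis using assms(7)[of i j "foldr T v x"] \<open>foldr T v x \<in> C\<close> by simp
  qed (simp add: assms(5))
  then show "foldr T (u @ l @ v) x = foldr T (u @ r @ v) x" by simp
qed

lemma free_algebra_simps [simp]:
  "carrier (free_algebra n) = {p. Poly_Mapping.keys p \<subseteq> gen_words n}"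
  "p \<oplus>\<^bsub>free_algebra n\<^esub> q = p + q" "p \<otimes>\<^bsub>free_algebra n\<^esub> q = p * q"
  "\<zero>\<^bsub>free_algebra n\<^esub> = 0" "\<one>\<^bsub>free_algebra n\<^esub> = 1" "c \<odot>\<^bsub>free_algebra n\<^esub> p = scale c p"
  by (simp_all add: free_algebra_def)

lemma keys_mult_words:
  assumes "Poly_Mapping.keys p \<subseteq> gen_words n" "Poly_Mapping.keys q \<subseteq> gen_words n"
  shows "Poly_Mapping.keys (p * q) \<subseteq> gen_words n"
  using keys_mult[of p q] assms by (fastforce simp: plus_list_def)

lemma free_algebra_ring: "ring (free_algebra n :: ('a::field, nat list \<Rightarrow>\<^sub>0 'a) module)"
proof (rule ringI)
  show "abelian_group (free_algebra n :: ('a, nat list \<Rightarrow>\<^sub>0 'a) module)"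
  proof (rule abelian_groupI)
    fix x :: "nat list \<Rightarrow>\<^sub>0 'a" assume "x \<in> carrier (free_algebra n)"
    then show "\<exists>y\<in>carrier (free_algebra n). y \<oplus>\<^bsub>free_algebra n\<^esub> x = \<zero>\<^bsub>free_algebra n\<^esub>"
      by (intro bexI[of _ "- x"]) (simp_all add: keys_uminus_subset)
  qed (simp_all add: keys_add_subset add_ac)
  show "monoid (free_algebra n :: ('a, nat list \<Rightarrow>\<^sub>0 'a) module)"
    by (rule monoidI) (simp_all add: keys_mult_words mult.assoc zero_list_def)
qed (simp_all add: algebra_simps)

definition hecke_rels :: "nat \<Rightarrow> (nat list \<Rightarrow>\<^sub>0 'a::field) set"
  where "hecke_rels n = {word_monom l - word_monom r | l r. hrel n l r}"

lemma hecke_ideal_eq: "hecke_ideal n = Idl\<^bsub>free_algebra n\<^esub> (hecke_rels n)"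
  unfolding hecke_ideal_def hecke_rels_def
  by (rule arg_cong[of _ _ "\<lambda>S. Idl\<^bsub>free_algebra n\<^esub> S"]) (auto simp: hrel.simps, blast+)

lemma hecke_rels_carrier: "(hecke_rels n :: (nat list \<Rightarrow>\<^sub>0 'a::field) set) \<subseteq> carrier (free_algebra n)"
proof
  fix p :: "nat list \<Rightarrow>\<^sub>0 'a" assume "p \<in> hecke_rels n"
  then obtain l r where p: "p = word_monom l - word_monom r" "hrel n l r"
    by (auto simp: hecke_rels_def)
  then show "p \<in> carrier (free_algebra n)"
    using hrel_words[of n l r] by (simp add: keys_diff_subset)
qed

lemma hecke_ideal_ideal: "ideal (hecke_ideal n) (free_algebra n :: ('a::field, nat list \<Rightarrow>\<^sub>0 'a) module)"
  unfolding hecke_ideal_eq by (rule ring.genideal_ideal[OF free_algebra_ring hecke_rels_carrier])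

text \<open>Being a ring involves only these fields, so the quotient ring \<open>Quot\<close>
  transfers to a record of type \<open>module\<close>.\<close>

lemma ring_cong:
  assumes "ring R" "carrier R = carrier S" "add R = add S" "monoid.mult R = monoid.mult S"
    "\<zero>\<^bsub>R\<^esub> = \<zero>\<^bsub>S\<^esub>" "\<one>\<^bsub>R\<^esub> = \<one>\<^bsub>S\<^esub>"
  shows "ring S"
proof -
  interpret ring R by fact
  have "abelian_group S"
  proof (rule abelian_groupI)
    fix x assume "x \<in> carrier S"
    then show "\<exists>y\<in>carrier S. y \<oplus>\<^bsub>S\<^esub> x = \<zero>\<^bsub>S\<^esub>"
      using assms(2,3,5) l_neg a_inv_closed by metis
  qed (simp_all add: assms(2-6)[symmetric] a_ac)
  moreover have "monoid S"
    by (rule monoidI) (simp_all add: assms(2-6)[symmetric] m_assoc)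
  ultimately show ?thesis
    by (rule ringI) (simp_all add: assms(2-6)[symmetric] l_distr r_distr)
qed

lemma hecke_ring: "ring (hecke n :: ('a::field, 'a hecke) module)"
proof -
  have "ring (free_algebra n Quot (hecke_ideal n) :: 'a hecke ring)"
    by (rule ideal.quotient_is_ring[OF hecke_ideal_ideal])
  then show ?thesis
    by (rule ring_cong) (simp_all add: hecke_def quot_module_def FactRing_def)
qed

text \<open>Universal property of the quotient: maps constant on congruence classes factor through
  the algebra. This keeps distinct classes apart and makes choices of representatives
  harmless.\<close>

lemma hecke_ideal_kill:
  fixes F :: "nat list \<Rightarrow> 'b \<Rightarrow>\<^sub>0 'a::field"
  assumes "p \<in> hecke_ideal n"
    and F: "\<And>w w'. hcong n w w' \<Longrightarrow> w \<in> gen_words n \<Longrightarrow> F w = F w'"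
  shows "lin F p = 0"
proof -
  \<comment> \<open>Demanding that all two-sided translates vanish makes the set closed under
    multiplication from both sides; the claim itself is the case of empty \<open>u\<close> and
    \<open>v\<close>.\<close>
  define J where "J = {p. Poly_Mapping.keys p \<subseteq> gen_words n \<and>
    (\<forall>u\<in>gen_words n. \<forall>v\<in>gen_words n. lin (\<lambda>w. F (u @ w @ v)) p = 0)}"
  have "ideal J (free_algebra n :: ('a, nat list \<Rightarrow>\<^sub>0 'a) module)"
  proof (rule idealI[OF free_algebra_ring])
    show "subgroup J (add_monoid (free_algebra n :: ('a, nat list \<Rightarrow>\<^sub>0 'a) module))"
    proof (rule group.subgroupI)
      show "group (add_monoid (free_algebra n :: ('a, nat list \<Rightarrow>\<^sub>0 'a) module))"
        using free_algebra_ring abelian_group.a_group ring_def by blast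
      show "J \<subseteq> carrier (add_monoid (free_algebra n :: ('a, nat list \<Rightarrow>\<^sub>0 'a) module))"
        by (auto simp: J_def)
      show "J \<noteq> {}" by (auto simp: J_def intro!: exI[of _ 0])
    next
      fix a assume "a \<in> J"
      moreover from this have "inv\<^bsub>add_monoid (free_algebra n)\<^esub> a = - a"
        using abelian_group.minus_equality[of "free_algebra n" "- a" a] free_algebra_ring[of n]
        by (auto simp: ring_def a_inv_def J_def keys_uminus_subset)
      ultimately show "inv\<^bsub>add_monoid (free_algebra n)\<^esub> a \<in> J"
        by (simp add: J_def lin_uminus keys_uminus_subset)
    qed (simp_all add: J_def lin_add keys_add_subset)
  next
    fix a x assume a: "a \<in> J" and "x \<in> carrier (free_algebra n :: ('a, nat list \<Rightarrow>\<^sub>0 'a) module)"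
    then have x: "Poly_Mapping.keys x \<subseteq> gen_words n" by simp
    have "lin (\<lambda>w. F (u @ w @ v)) (x * a) = 0" if "u \<in> gen_words n" "v \<in> gen_words n" for u v
    proof -
      have "lin (\<lambda>w. F (u @ w @ v)) (x * a) = lin (\<lambda>w1. lin (\<lambda>w2. F ((u @ w1) @ w2 @ v)) a) x"
        by (simp add: lin_mult plus_list_def)
      also have "\<dots> = lin (\<lambda>w1. 0) x"
      proof (rule lin_cong)
        fix w assume "w \<in> Poly_Mapping.keys x"
        then have "u @ w \<in> gen_words n" using x that by auto
        with a that show "lin (\<lambda>w2. F ((u @ w) @ w2 @ v)) a = 0" unfolding J_def by blast
      qed
      finally show ?thesis by simp
    qed
    then show "x \<otimes>\<^bsub>free_algebra n\<^esub> a \<in> J" using a x by (simp add: J_def keys_mult_words)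
    have "lin (\<lambda>w. F (u @ w @ v)) (a * x) = 0" if "u \<in> gen_words n" "v \<in> gen_words n" for u v
    proof -
      \<comment> \<open>Here the element of \<open>J\<close> is the left factor, so the sums are
        exchanged to bring it inside, where its translates vanish.\<close>
      have swap: "lin (\<lambda>u. lin (\<lambda>v. G u v) x) a = lin (\<lambda>v. lin (\<lambda>u. G u v) a) x"
        for G :: "nat list \<Rightarrow> nat list \<Rightarrow> 'b \<Rightarrow>\<^sub>0 'a"
        unfolding lin_def scale_sum scale_scale by (subst sum.swap) (simp add: mult.commute)
      have "lin (\<lambda>w. F (u @ w @ v)) (a * x) = lin (\<lambda>w2. lin (\<lambda>w1. F (u @ w1 @ (w2 @ v))) a) x"
        by (simp add: lin_mult plus_list_def swap)
      also have "\<dots> = lin (\<lambda>w1. 0) x"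
      proof (rule lin_cong)
        fix w assume "w \<in> Poly_Mapping.keys x"
        then have "w @ v \<in> gen_words n" using x that by auto
        with a that show "lin (\<lambda>w1. F (u @ w1 @ (w @ v))) a = 0" unfolding J_def by blast
      qed
      finally show ?thesis by simp
    qed
    then show "a \<otimes>\<^bsub>free_algebra n\<^esub> x \<in> J" using a x by (simp add: J_def keys_mult_words)
  qed
  moreover have "hecke_rels n \<subseteq> J"
  proof
    fix p :: "nat list \<Rightarrow>\<^sub>0 'a" assume "p \<in> hecke_rels n"
    then obtain l r where p: "p = word_monom l - word_monom r" and lr: "hrel n l r"
      by (auto simp: hecke_rels_def)
    have "F (u @ l @ v) = F (u @ r @ v)" if "u \<in> gen_words n" "v \<in> gen_words n" for u v
      using that lr hrel_words[OF lr] by (intro F hcong.step) auto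
    then show "p \<in> J"
      using hrel_words[OF lr] by (simp add: J_def p lin_diff keys_diff_subset)
  qed
  ultimately have "hecke_ideal n \<subseteq> J"
    unfolding hecke_ideal_eq by (rule ring.genideal_minimal[OF free_algebra_ring])
  with assms(1) have "p \<in> J" by blast
  then have "lin (\<lambda>w. F ([] @ w @ [])) p = 0" unfolding J_def by blast
  then show ?thesis by simp
qed

lemma mem_coset_plus:
  fixes x :: "'v::ab_group_add"
  assumes "add V = (+)"
  shows "q \<in> U +>\<^bsub>V\<^esub> x \<longleftrightarrow> q - x \<in> U"
  unfolding a_r_coset_def' assms by (auto simp: algebra_simps intro!: bexI[of _ "q - x"])

lemma hecke_ideal_closed:
  "(0 :: nat list \<Rightarrow>\<^sub>0 'a::field) \<in> hecke_ideal n"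
  "p \<in> hecke_ideal n \<Longrightarrow> q \<in> hecke_ideal n \<Longrightarrow> p + q \<in> hecke_ideal n"
  "p \<in> hecke_ideal n \<Longrightarrow> - (p :: nat list \<Rightarrow>\<^sub>0 'a) \<in> hecke_ideal n"
  "p \<in> hecke_ideal n \<Longrightarrow> q \<in> hecke_ideal n \<Longrightarrow> p - q \<in> hecke_ideal n"
  "p \<in> hecke_ideal n \<Longrightarrow> Poly_Mapping.keys p \<subseteq> gen_words n"
proof -
  interpret ideal "hecke_ideal n" "free_algebra n :: ('a, nat list \<Rightarrow>\<^sub>0 'a) module"
    by (rule hecke_ideal_ideal)
  show "(0 :: nat list \<Rightarrow>\<^sub>0 'a) \<in> hecke_ideal n"
    using additive_subgroup.zero_closed[OF is_additive_subgroup] by simp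
  show *: "p \<in> hecke_ideal n \<Longrightarrow> q \<in> hecke_ideal n \<Longrightarrow> p + q \<in> hecke_ideal n" for p q :: "nat list \<Rightarrow>\<^sub>0 'a"
    using additive_subgroup.a_closed[OF is_additive_subgroup, of p q] by simp
  show keys: "p \<in> hecke_ideal n \<Longrightarrow> Poly_Mapping.keys p \<subseteq> gen_words n" for p :: "nat list \<Rightarrow>\<^sub>0 'a"
    using a_Hcarr[of p] by simp
  show **: "p \<in> hecke_ideal n \<Longrightarrow> - p \<in> hecke_ideal n" for p :: "nat list \<Rightarrow>\<^sub>0 'a"
  proof -
    assume p: "p \<in> hecke_ideal n"
    have "- 1 \<in> carrier (free_algebra n :: ('a, nat list \<Rightarrow>\<^sub>0 'a) module)"
      by (simp add: keys_uminus_subset zero_list_def)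
    from I_l_closed[OF p this] show ?thesis by simp
  qed
  show "p \<in> hecke_ideal n \<Longrightarrow> q \<in> hecke_ideal n \<Longrightarrow> p - q \<in> hecke_ideal n" for p q :: "nat list \<Rightarrow>\<^sub>0 'a"
    using *[of p "- q"] **[of q] by simp
qed

text \<open>The larger ideal meets the smaller free algebra in an ideal that contains the smaller
  set of relations. This makes \<open>hecke_incl\<close> well defined on cosets.\<close>

lemma hecke_ideal_mono:
  assumes "n \<le> m"
  shows "(hecke_ideal n :: (nat list \<Rightarrow>\<^sub>0 'a::field) set) \<subseteq> hecke_ideal m"
proof -
  let ?A = "free_algebra n :: ('a, nat list \<Rightarrow>\<^sub>0 'a) module"
  let ?J = "hecke_ideal m \<inter> carrier ?A"
  have sub: "gen_words n \<subseteq> gen_words m" using assms by auto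
  interpret m: ideal "hecke_ideal m" "free_algebra m :: ('a, nat list \<Rightarrow>\<^sub>0 'a) module"
    by (rule hecke_ideal_ideal)
  interpret A: ring ?A by (rule free_algebra_ring)
  have inv: "inv\<^bsub>add_monoid ?A\<^esub> a = - a" if "a \<in> carrier ?A" for a
    using A.minus_equality[of "- a" a] that by (simp add: a_inv_def keys_uminus_subset)
  have "ideal ?J ?A"
  proof (rule idealI[OF free_algebra_ring])
    show "subgroup ?J (add_monoid ?A)"
    proof (rule group.subgroupI)
      show "group (add_monoid ?A)" by (rule A.a_group)
      have "0 \<in> ?J" by (simp add: hecke_ideal_closed)
      then show "?J \<noteq> {}" by blast
      show "inv\<^bsub>add_monoid ?A\<^esub> a \<in> ?J" if "a \<in> ?J" for a
        using that inv[of a] by (simp add: hecke_ideal_closed keys_uminus_subset)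
    qed (simp_all add: hecke_ideal_closed keys_add_subset)
  next
    fix a x assume a: "a \<in> ?J" and x: "x \<in> carrier ?A"
    then have "x \<in> carrier (free_algebra m)" using sub by (simp add: order_trans[OF _ sub])
    then have "x * a \<in> hecke_ideal m" "a * x \<in> hecke_ideal m"
      using a m.I_l_closed[of a x] m.I_r_closed[of a x] by simp_all
    then show "x \<otimes>\<^bsub>?A\<^esub> a \<in> ?J" "a \<otimes>\<^bsub>?A\<^esub> x \<in> ?J"
      using a x by (simp_all add: keys_mult_words)
  qed
  moreover have "hecke_rels n \<subseteq> ?J"
  proof -
    have "(hecke_rels n :: (nat list \<Rightarrow>\<^sub>0 'a) set) \<subseteq> hecke_rels m"
      using assms unfolding hecke_rels_def by (fastforce simp: hrel.simps)
    moreover have "(hecke_rels m :: (nat list \<Rightarrow>\<^sub>0 'a) set) \<subseteq> hecke_ideal m"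
      unfolding hecke_ideal_eq using ring.genideal_self[OF free_algebra_ring hecke_rels_carrier] by blast
    ultimately show ?thesis using hecke_rels_carrier by blast
  qed
  ultimately have "hecke_ideal n \<subseteq> ?J"
    unfolding hecke_ideal_eq[of n] by (rule ring.genideal_minimal[OF free_algebra_ring])
  then show ?thesis by blast
qed

abbreviation hcoset :: "nat \<Rightarrow> (nat list \<Rightarrow>\<^sub>0 'a::field) \<Rightarrow> 'a hecke"
  where "hcoset n p \<equiv> hecke_ideal n +>\<^bsub>free_algebra n\<^esub> p"

lemma mem_hcoset: "q \<in> hcoset n p \<longleftrightarrow> q - p \<in> hecke_ideal n"
  by (rule mem_coset_plus) (simp add: free_algebra_def)

lemma hcoset_eq_iff: "hcoset n p = hcoset n q \<longleftrightarrow> p - q \<in> hecke_ideal n"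
proof
  assume "hcoset n p = hcoset n q"
  moreover have "p \<in> hcoset n p" by (simp add: mem_hcoset hecke_ideal_closed)
  ultimately show "p - q \<in> hecke_ideal n" by (simp add: mem_hcoset)
next
  assume *: "p - q \<in> hecke_ideal n"
  have "x - p \<in> hecke_ideal n \<longleftrightarrow> x - q \<in> hecke_ideal n" for x
    using hecke_ideal_closed(2)[OF _ *, of "x - p"] hecke_ideal_closed(4)[OF _ *, of "x - q"] by auto
  then show "hcoset n p = hcoset n q" by (auto simp: mem_hcoset)
qed

lemma hecke_simps:
  fixes p q :: "nat list \<Rightarrow>\<^sub>0 'a::field"
  shows "carrier (hecke n) = {hcoset n p | p :: nat list \<Rightarrow>\<^sub>0 'a. Poly_Mapping.keys p \<subseteq> gen_words n}"
  "Poly_Mapping.keys p \<subseteq> gen_words n \<Longrightarrow> Poly_Mapping.keys q \<subseteq> gen_words n \<Longrightarrow>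
     hcoset n p \<otimes>\<^bsub>hecke n\<^esub> hcoset n q = hcoset n (p * q)"
  "Poly_Mapping.keys p \<subseteq> gen_words n \<Longrightarrow> Poly_Mapping.keys q \<subseteq> gen_words n \<Longrightarrow>
     hcoset n p \<oplus>\<^bsub>hecke n\<^esub> hcoset n q = hcoset n (p + q)"
  "\<one>\<^bsub>hecke n\<^esub> = (hcoset n 1 :: 'a hecke)"
  "Poly_Mapping.keys p \<subseteq> gen_words n \<Longrightarrow> c \<odot>\<^bsub>hecke n\<^esub> hcoset n p = hcoset n (scale c p)"
proof -
  interpret ideal "hecke_ideal n" "free_algebra n :: ('a, nat list \<Rightarrow>\<^sub>0 'a) module"
    by (rule hecke_ideal_ideal)
  show "carrier (hecke n) = {hcoset n p | p :: nat list \<Rightarrow>\<^sub>0 'a. Poly_Mapping.keys p \<subseteq> gen_words n}"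
    by (auto simp: hecke_def quot_module_def A_RCOSETS_def')
  show "hcoset n p \<otimes>\<^bsub>hecke n\<^esub> hcoset n q = hcoset n (p * q)"
    if "Poly_Mapping.keys p \<subseteq> gen_words n" "Poly_Mapping.keys q \<subseteq> gen_words n" for p q :: "nat list \<Rightarrow>\<^sub>0 'a"
    using rcoset_mult_add[of p q] that by (simp add: hecke_def quot_module_def)
  show "hcoset n p \<oplus>\<^bsub>hecke n\<^esub> hcoset n q = hcoset n (p + q)"
    if "Poly_Mapping.keys p \<subseteq> gen_words n" "Poly_Mapping.keys q \<subseteq> gen_words n" for p q :: "nat list \<Rightarrow>\<^sub>0 'a"
    using a_rcos_sum[of p q] that by (simp add: hecke_def quot_module_def)
  show "\<one>\<^bsub>hecke n\<^esub> = (hcoset n 1 :: 'a hecke)" by (simp add: hecke_def quot_module_def)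
  show "c \<odot>\<^bsub>hecke n\<^esub> hcoset n p = hcoset n (scale c p)"
    if "Poly_Mapping.keys p \<subseteq> gen_words n" for p :: "nat list \<Rightarrow>\<^sub>0 'a" and c
  proof -
    have "hcoset n (scale c x) = hcoset n (scale c p)" if x: "x \<in> hcoset n p" for x
    proof -
      have "x - p \<in> hecke_ideal n" using x by (simp add: mem_hcoset)
      moreover have "Poly_Mapping.single [] c \<in> carrier (free_algebra n :: ('a, nat list \<Rightarrow>\<^sub>0 'a) module)"
        by simp
      ultimately have "Poly_Mapping.single [] c * (x - p) \<in> hecke_ideal n"
        using I_l_closed by force
      moreover have "Poly_Mapping.single [] c * q = scale c q" for q :: "nat list \<Rightarrow>\<^sub>0 'a"
        using mult_map_scale_conv_mult[of c q] by (simp add: zero_list_def)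
      ultimately show ?thesis by (simp add: hcoset_eq_iff scale_diff)
    qed
    moreover have "p \<in> hcoset n p" by (simp add: mem_hcoset hecke_ideal_closed)
    moreover have "c \<odot>\<^bsub>hecke n\<^esub> hcoset n p = (\<Union>x\<in>hcoset n p. hcoset n (scale c x))"
      by (simp add: hecke_def quot_module_def)
    ultimately show ?thesis by blast
  qed
qed

text \<open>The representative picked inside \<open>hecke_module\<close> and
  \<open>hom_ract\<close>; by \<open>lin_hrep\<close> the choice is immaterial for functions
  constant on congruence classes.\<close>

definition hrep :: "'a::field hecke \<Rightarrow> nat list \<Rightarrow>\<^sub>0 'a"
  where "hrep h = (SOME p. p \<in> h)"

lemma hrep_hcoset:
  assumes "Poly_Mapping.keys p \<subseteq> gen_words n"
  shows "hrep (hcoset n p) - p \<in> hecke_ideal n" "Poly_Mapping.keys (hrep (hcoset n p)) \<subseteq> gen_words n"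
proof -
  have "p \<in> hcoset n p" by (simp add: mem_hcoset hecke_ideal_closed)
  then have "hrep (hcoset n p) \<in> hcoset n p" unfolding hrep_def by (rule someI)
  then show *: "hrep (hcoset n p) - p \<in> hecke_ideal n" by (simp add: mem_hcoset)
  show "Poly_Mapping.keys (hrep (hcoset n p)) \<subseteq> gen_words n"
    using keys_add_subset[OF hecke_ideal_closed(5)[OF *] assms] by simp
qed

lemma hrep_keys: "h \<in> carrier (hecke n) \<Longrightarrow> Poly_Mapping.keys (hrep h) \<subseteq> gen_words n"
  unfolding hecke_simps(1) using hrep_hcoset(2) by blast

lemma lin_hrep:
  assumes "Poly_Mapping.keys p \<subseteq> gen_words n"
    and "\<And>w w'. hcong n w w' \<Longrightarrow> w \<in> gen_words n \<Longrightarrow> F w = F w'"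
  shows "lin F (hrep (hcoset n p)) = lin F p"
  using hecke_ideal_kill[OF hrep_hcoset(1)[OF assms(1)] assms(2)] by (simp add: lin_diff)

lemma word_monom_diff_ideal:
  assumes "hcong n w w'" "w \<in> gen_words n"
  shows "word_monom w - word_monom w' \<in> (hecke_ideal n :: (nat list \<Rightarrow>\<^sub>0 'a::field) set)"
  using assms
proof (induction rule: hcong.induct)
  case (step l r u v)
  interpret ideal "hecke_ideal n" "free_algebra n :: ('a, nat list \<Rightarrow>\<^sub>0 'a) module"
    by (rule hecke_ideal_ideal)
  have "word_monom l - word_monom r \<in> (hecke_ideal n :: (nat list \<Rightarrow>\<^sub>0 'a) set)"
    using ring.genideal_self[OF free_algebra_ring hecke_rels_carrier, of n] step.hyps(1)
    unfolding hecke_ideal_eq by (auto simp: hecke_rels_def)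
  then have "word_monom u * (word_monom l - word_monom r) \<in> (hecke_ideal n :: (nat list \<Rightarrow>\<^sub>0 'a) set)"
    using I_l_closed[of "word_monom l - word_monom r" "word_monom u"] step.hyps by simp
  then have "word_monom u * (word_monom l - word_monom r) * word_monom v \<in> (hecke_ideal n :: (nat list \<Rightarrow>\<^sub>0 'a) set)"
    using I_r_closed[of _ "word_monom v"] step.hyps by simp
  then show ?case
    by (simp add: left_diff_distrib right_diff_distrib mult_single plus_list_def)
next
  case (reflI w) then show ?case by (simp add: hecke_ideal_closed)
next
  case (symI w w')
  then show ?case using hecke_ideal_closed(3)[of "word_monom w - word_monom w'" n] hcong_words by auto
next
  case (transI w w' w'')
  then have "w' \<in> gen_words n" using hcong_words by blast
  with transI have "(word_monom w - word_monom w') + (word_monom w' - word_monom w'') \<in> (hecke_ideal n :: (nat list \<Rightarrow>\<^sub>0 'a) set)"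
    by (intro hecke_ideal_closed(2))
  then show ?case by simp
qed

text \<open>The quotient identifies no more words than the congruence: sending a word to the basis
  vector indexed by its class respects the relations and separates classes.\<close>

lemma pi_word_eq_iff:
  assumes "w \<in> gen_words n" "w' \<in> gen_words n"
  shows "(pi_word n w :: 'a::field hecke) = pi_word n w' \<longleftrightarrow> hcong n w w'"
proof
  assume "(pi_word n w :: 'a hecke) = pi_word n w'"
  then have *: "word_monom w - word_monom w' \<in> (hecke_ideal n :: (nat list \<Rightarrow>\<^sub>0 'a) set)"
    by (simp add: pi_word_def hcoset_eq_iff)
  define F :: "nat list \<Rightarrow> nat list set \<Rightarrow>\<^sub>0 'a" where "F = (\<lambda>w. Poly_Mapping.single {v. hcong n w v} 1)"
  have "lin F (word_monom w - word_monom w') = 0"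
    by (rule hecke_ideal_kill[OF *])
       (auto simp: F_def intro!: arg_cong[of _ _ "\<lambda>S. Poly_Mapping.single S 1"] intro: hcong.intros)
  then have "F w = F w'" by (simp add: lin_diff)
  then have "Poly_Mapping.keys (F w) = Poly_Mapping.keys (F w')" by simp
  then have "{v. hcong n w v} = {v. hcong n w' v}" by (simp add: F_def)
  then show "hcong n w w'" using hcong.reflI[of n w'] by blast
qed (use assms word_monom_diff_ideal in \<open>auto simp: pi_word_def hcoset_eq_iff\<close>)

lemma pi_word_mult:
  "u \<in> gen_words n \<Longrightarrow> v \<in> gen_words n \<Longrightarrow> pi_word n u \<otimes>\<^bsub>hecke n\<^esub> pi_word n v = pi_word n (u @ v)"
  by (simp add: pi_word_def hecke_simps mult_single plus_list_def)


section \<open>Representations given by the images of basis vectors under the generators\<close>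

section \<open>Modules given by operators\<close>

lemma free_space_simps [simp]:
  "carrier (free_space S) = {p. Poly_Mapping.keys p \<subseteq> S}" "\<zero>\<^bsub>free_space S\<^esub> = 0"
  "p \<oplus>\<^bsub>free_space S\<^esub> q = p + q" "c \<odot>\<^bsub>free_space S\<^esub> p = scale c p"
  by (simp_all add: free_space_def)

lemma ring_of_type_simps [simp]:
  "carrier ring_of_type_algebra = UNIV" "x \<oplus>\<^bsub>ring_of_type_algebra\<^esub> y = x + y"
  "x \<otimes>\<^bsub>ring_of_type_algebra\<^esub> y = x * y" "\<one>\<^bsub>ring_of_type_algebra\<^esub> = 1" "\<zero>\<^bsub>ring_of_type_algebra\<^esub> = 0"
  by (simp_all add: ring_of_type_algebra_def)

lemma poly_mapping_module:
  fixes V :: "('a::field, 'b \<Rightarrow>\<^sub>0 'a) module"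
  assumes V: "add V = (+)" "\<zero>\<^bsub>V\<^esub> = 0" "module.smult V = scale"
    and "0 \<in> carrier V" "\<And>p q. p \<in> carrier V \<Longrightarrow> q \<in> carrier V \<Longrightarrow> p + q \<in> carrier V"
    and sc: "\<And>c p. p \<in> carrier V \<Longrightarrow> scale c p \<in> carrier V"
  shows "module ring_of_type_algebra V"
proof (rule moduleI)
  show "cring (ring_of_type_algebra :: 'a ring)" by (rule cring_from_type_algebra)
  show "abelian_group V"
  proof (rule abelian_groupI)
    fix x assume "x \<in> carrier V"
    then show "\<exists>y\<in>carrier V. y \<oplus>\<^bsub>V\<^esub> x = \<zero>\<^bsub>V\<^esub>"
      using sc[of x "-1"] by (intro bexI[of _ "scale (-1) x"]) (simp_all add: V poly_mapping_eq_iff lookup_add fun_eq_iff)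
  qed (simp_all add: assms add_ac)
qed (simp_all add: assms scale_add scale_add_left scale_scale)

lemma free_space_module: "module ring_of_type_algebra (free_space S :: ('a::field, 'b \<Rightarrow>\<^sub>0 'a) module)"
  by (rule poly_mapping_module)
     (simp_all add: free_space_def keys_add_subset order_trans[OF keys_scale])

lemma finsum_eq_sum:
  fixes V :: "('r, 'v::comm_monoid_add) module"
  assumes "abelian_monoid V" "add V = (+)" "\<zero>\<^bsub>V\<^esub> = 0" "f \<in> A \<rightarrow> carrier V"
  shows "finsum V f A = sum f A"
proof -
  interpret abelian_monoid V by fact
  show ?thesis
    using assms(4)
  proof (induction A rule: infinite_finite_induct)
    case (insert x F)
    then show ?case by (subst finsum_insert) (auto simp: assms)
  qed (simp_all add: assms finsum_infinite)
qed

abbreviation wact :: "(nat \<Rightarrow> 'b \<Rightarrow> 'b \<Rightarrow>\<^sub>0 'a::field) \<Rightarrow> nat list \<Rightarrow> ('b \<Rightarrow>\<^sub>0 'a) \<Rightarrow> ('b \<Rightarrow>\<^sub>0 'a)"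
  where "wact t w v \<equiv> foldr (\<lambda>i. lin (t i)) w v"

lemma wact_linear:
  "wact t w (p + q) = wact t w p + wact t w q" "wact t w (scale c p) = scale c (wact t w p)" "wact t w 0 = 0"
  by (induction w) (simp_all add: lin_add lin_scale)

lemma wact_lin: "wact t w (lin F p) = lin (\<lambda>b. wact t w (F b)) p"
  by (induction w) (simp_all add: lin_lin)

text \<open>The common form to which the modules are brought: \<open>t i b\<close> is the column of
  the generator \<open>i\<close> at the basis element \<open>b\<close>. With \<open>nat\<close> as
  index type such a module can belong to \<open>fd_modules\<close>.\<close>

definition op_module :: "nat \<Rightarrow> 'b set \<Rightarrow> (nat \<Rightarrow> 'b \<Rightarrow> 'b \<Rightarrow>\<^sub>0 'a) \<Rightarrow> ('a::field hecke, 'b \<Rightarrow>\<^sub>0 'a) module"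
  where "op_module n S t = hecke_module n (free_space S) (\<lambda>i. lin (t i))"

lemma op_module_simps [simp]:
  "carrier (op_module n S t) = {p. Poly_Mapping.keys p \<subseteq> S}"
  "p \<oplus>\<^bsub>op_module n S t\<^esub> q = p + q" "\<zero>\<^bsub>op_module n S t\<^esub> = 0"
  by (simp_all add: op_module_def hecke_module_def)

locale hecke_rep =
  fixes n :: nat and S :: "'b set" and t :: "nat \<Rightarrow> 'b \<Rightarrow> 'b \<Rightarrow>\<^sub>0 'a::field"
  assumes keys_t: "i \<in> {1..<n} \<Longrightarrow> b \<in> S \<Longrightarrow> Poly_Mapping.keys (t i b) \<subseteq> S"
    and idem: "i \<in> {1..<n} \<Longrightarrow> b \<in> S \<Longrightarrow> lin (t i) (t i b) = t i b"
    and braid: "i \<in> {1..<n} \<Longrightarrow> i + 1 \<in> {1..<n} \<Longrightarrow> b \<in> S \<Longrightarrow>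
      lin (t i) (lin (t (i + 1)) (t i b)) = lin (t (i + 1)) (lin (t i) (t (i + 1) b))"
    and comm: "i \<in> {1..<n} \<Longrightarrow> j \<in> {1..<n} \<Longrightarrow> \<bar>int i - int j\<bar> > 1 \<Longrightarrow> b \<in> S \<Longrightarrow>
      lin (t i) (t j b) = lin (t j) (t i b)"
begin

lemma keys_op: "i \<in> {1..<n} \<Longrightarrow> Poly_Mapping.keys v \<subseteq> S \<Longrightarrow> Poly_Mapping.keys (lin (t i) v) \<subseteq> S"
  by (rule keys_lin_subset) (use keys_t in auto)

lemma keys_wact: "w \<in> gen_words n \<Longrightarrow> Poly_Mapping.keys v \<subseteq> S \<Longrightarrow> Poly_Mapping.keys (wact t w v) \<subseteq> S"
  by (induction w) (use keys_op in auto)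

lemma wact_hcong:
  assumes "hcong n w w'" "w \<in> gen_words n" "Poly_Mapping.keys v \<subseteq> S"
  shows "wact t w v = wact t w' v"
proof (rule hrel_respects_foldr[OF assms(1,2), where C = "{v. Poly_Mapping.keys v \<subseteq> S}"])
  show "v \<in> {v. Poly_Mapping.keys v \<subseteq> S}" using assms(3) by simp
  show "lin (t i) x \<in> {v. Poly_Mapping.keys v \<subseteq> S}"
    if "i \<in> {1..<n}" "x \<in> {v. Poly_Mapping.keys v \<subseteq> S}" for i x
    using that keys_op[of i x] by simp
  show "lin (t i) (lin (t i) x) = lin (t i) x" if "i \<in> {1..<n}" "x \<in> {v. Poly_Mapping.keys v \<subseteq> S}" for i x
    unfolding lin_lin using that idem by (intro lin_cong) auto
  show "lin (t i) (lin (t (i + 1)) (lin (t i) x)) = lin (t (i + 1)) (lin (t i) (lin (t (i + 1)) x))"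
    if "i \<in> {1..<n}" "i + 1 \<in> {1..<n}" "x \<in> {v. Poly_Mapping.keys v \<subseteq> S}" for i x
    unfolding lin_lin using that braid by (intro lin_cong) (auto simp: lin_lin)
  show "lin (t i) (lin (t j) x) = lin (t j) (lin (t i) x)"
    if "i \<in> {1..<n}" "j \<in> {1..<n}" "\<bar>int i - int j\<bar> > 1" "x \<in> {v. Poly_Mapping.keys v \<subseteq> S}" for i j x
    unfolding lin_lin using that comm by (intro lin_cong) blast
qed

lemma smult_op_module:
  assumes "h \<in> carrier (hecke n)" "Poly_Mapping.keys v \<subseteq> S"
  shows "h \<odot>\<^bsub>op_module n S t\<^esub> v = lin (\<lambda>w. wact t w v) (hrep h)"
proof -
  interpret V: module ring_of_type_algebra "free_space S :: ('a, _) module" by (rule free_space_module)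
  have "h \<odot>\<^bsub>op_module n S t\<^esub> v =
      (\<Oplus>\<^bsub>free_space S\<^esub>w\<in>Poly_Mapping.keys (hrep h). scale (Poly_Mapping.lookup (hrep h) w) (wact t w v))"
    by (simp add: op_module_def hecke_module_def hrep_def Let_def)
  also have "\<dots> = lin (\<lambda>w. wact t w v) (hrep h)"
    unfolding lin_def[of "\<lambda>w. wact t w v"]
  proof (rule finsum_eq_sum)
    show "abelian_monoid (free_space S :: ('a, _) module)" by (rule V.M.abelian_monoid_axioms)
    show "(\<lambda>w. scale (Poly_Mapping.lookup (hrep h) w) (wact t w v)) \<in>
      Poly_Mapping.keys (hrep h) \<rightarrow> carrier (free_space S)"
    proof (rule Pi_I)
      fix w assume "w \<in> Poly_Mapping.keys (hrep h)"
      then have "w \<in> gen_words n" using hrep_keys[OF assms(1)] by blast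
      from keys_wact[OF this assms(2)]
      show "scale (Poly_Mapping.lookup (hrep h) w) (wact t w v) \<in> carrier (free_space S)"
        by (simp add: order_trans[OF keys_scale])
    qed
  qed (simp_all add: free_space_def)
  finally show ?thesis .
qed

lemma lin_wact_hrep:
  "Poly_Mapping.keys p \<subseteq> gen_words n \<Longrightarrow> Poly_Mapping.keys v \<subseteq> S \<Longrightarrow>
   lin (\<lambda>w. wact t w v) (hrep (hcoset n p)) = lin (\<lambda>w. wact t w v) p"
  using wact_hcong by (intro lin_hrep)

lemma smult_hcoset:
  "Poly_Mapping.keys p \<subseteq> gen_words n \<Longrightarrow> Poly_Mapping.keys v \<subseteq> S \<Longrightarrow>
    hcoset n p \<odot>\<^bsub>op_module n S t\<^esub> v = lin (\<lambda>w. wact t w v) p"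
  by (subst smult_op_module) (auto simp: hecke_simps(1) lin_wact_hrep)

lemma keys_lin_wact:
  "Poly_Mapping.keys p \<subseteq> gen_words n \<Longrightarrow> Poly_Mapping.keys v \<subseteq> S \<Longrightarrow>
    Poly_Mapping.keys (lin (\<lambda>w. wact t w v) p) \<subseteq> S"
  by (erule keys_lin_subset) (rule keys_wact)

lemma left_module_op_module: "left_module (hecke n) (op_module n S t)"
proof -
  interpret V: module ring_of_type_algebra "free_space S :: ('a, _) module" by (rule free_space_module)
  have "abelian_group (op_module n S t)"
  proof (rule abelian_groupI)
    fix x assume "x \<in> carrier (op_module n S t)"
    then show "\<exists>y\<in>carrier (op_module n S t). y \<oplus>\<^bsub>op_module n S t\<^esub> x = \<zero>\<^bsub>op_module n S t\<^esub>"
      by (intro bexI[of _ "- x"]) (simp_all add: keys_uminus_subset)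
  qed (simp_all add: keys_add_subset add_ac)
  moreover have "left_module_axioms (hecke n) (op_module n S t)"
  proof
    fix a x assume a: "a \<in> carrier (hecke n :: ('a, 'a hecke) module)" and x: "x \<in> carrier (op_module n S t)"
    show "a \<odot>\<^bsub>op_module n S t\<^esub> x \<in> carrier (op_module n S t)"
      using a x keys_lin_wact[OF hrep_keys] by (simp add: smult_op_module)
  next
    fix a b x assume a: "a \<in> carrier (hecke n :: ('a, 'a hecke) module)" and
      b: "b \<in> carrier (hecke n :: ('a, 'a hecke) module)" and x: "x \<in> carrier (op_module n S t)"
    obtain p q where ab: "a = hcoset n p" "b = hcoset n q" and
      pq: "Poly_Mapping.keys p \<subseteq> gen_words n" "Poly_Mapping.keys q \<subseteq> gen_words n"
      using a b unfolding hecke_simps(1) by blast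
    show "(a \<oplus>\<^bsub>hecke n\<^esub> b) \<odot>\<^bsub>op_module n S t\<^esub> x =
      a \<odot>\<^bsub>op_module n S t\<^esub> x \<oplus>\<^bsub>op_module n S t\<^esub> b \<odot>\<^bsub>op_module n S t\<^esub> x"
      using pq x by (simp add: ab hecke_simps(3) smult_hcoset keys_add_subset lin_add)
    have "lin (\<lambda>w. wact t w x) (p * q) = lin (\<lambda>w. wact t w (lin (\<lambda>w. wact t w x) q)) p"
      by (simp add: lin_mult plus_list_def wact_lin)
    then show "(a \<otimes>\<^bsub>hecke n\<^esub> b) \<odot>\<^bsub>op_module n S t\<^esub> x = a \<odot>\<^bsub>op_module n S t\<^esub> (b \<odot>\<^bsub>op_module n S t\<^esub> x)"
      using pq x by (simp add: ab hecke_simps(2) smult_hcoset keys_mult_words keys_lin_wact)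
  next
    fix a x y assume a: "a \<in> carrier (hecke n :: ('a, 'a hecke) module)" and
      x: "x \<in> carrier (op_module n S t)" and y: "y \<in> carrier (op_module n S t)"
    show "a \<odot>\<^bsub>op_module n S t\<^esub> (x \<oplus>\<^bsub>op_module n S t\<^esub> y) =
      a \<odot>\<^bsub>op_module n S t\<^esub> x \<oplus>\<^bsub>op_module n S t\<^esub> a \<odot>\<^bsub>op_module n S t\<^esub> y"
      using a x y by (simp add: smult_op_module keys_add_subset wact_linear lin_fun_add)
  next
    fix x assume x: "x \<in> carrier (op_module n S t)"
    have "hcoset n 1 \<odot>\<^bsub>op_module n S t\<^esub> x = lin (\<lambda>w. wact t w x) (Poly_Mapping.single [] 1)"
      by (subst smult_hcoset) (use x in \<open>simp_all add: zero_list_def flip: single_one\<close>)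
    then show "\<one>\<^bsub>hecke n\<^esub> \<odot>\<^bsub>op_module n S t\<^esub> x = x"
      by (simp add: hecke_simps(4))
  qed
  ultimately show ?thesis
    by (intro left_module.intro hecke_ring)
qed

lemma fin_dim_op_module:
  assumes "finite S"
  shows "fin_dim (hecke n) (op_module n S t)"
proof -
  let ?e = "\<lambda>b. Poly_Mapping.single b (1::'a)"
  interpret V: left_module "hecke n" "op_module n S t" by (rule left_module_op_module)
  \<comment> \<open>\<open>fin_dim\<close> indexes coefficients by vectors, so labels have to be
    recovered from basis vectors.\<close>
  have inj: "inj_on ?e S" by (auto intro!: inj_onI) (metis keys_single singletonD insertI1 one_neq_zero)
  have "\<exists>c. v = (\<Oplus>\<^bsub>op_module n S t\<^esub>b\<in>?e ` S. (c b \<odot>\<^bsub>hecke n\<^esub> \<one>\<^bsub>hecke n\<^esub>) \<odot>\<^bsub>op_module n S t\<^esub> b)"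
    if v: "v \<in> carrier (op_module n S t)" for v
  proof (intro exI)
    let ?c = "\<lambda>b. Poly_Mapping.lookup v (the_inv_into S ?e b)"
    have sm: "(c \<odot>\<^bsub>hecke n\<^esub> \<one>\<^bsub>hecke n\<^esub>) \<odot>\<^bsub>op_module n S t\<^esub> b = scale c b"
      if "Poly_Mapping.keys b \<subseteq> S" for c :: 'a and b
    proof -
      have "c \<odot>\<^bsub>hecke n\<^esub> \<one>\<^bsub>hecke n\<^esub> = hcoset n (Poly_Mapping.single [] c)"
        by (simp add: hecke_simps(4)) (subst hecke_simps(5), simp_all add: zero_list_def flip: single_one)
      then show ?thesis using that by (simp add: smult_hcoset)
    qed
    have "(\<Oplus>\<^bsub>op_module n S t\<^esub>b\<in>?e ` S. (?c b \<odot>\<^bsub>hecke n\<^esub> \<one>\<^bsub>hecke n\<^esub>) \<odot>\<^bsub>op_module n S t\<^esub> b) =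
      (\<Oplus>\<^bsub>op_module n S t\<^esub>b\<in>?e ` S. scale (?c b) b)"
      by (rule V.M.add.finprod_cong') (auto simp: sm dest!: keys_scale[THEN subsetD] split: if_splits)
    also have "\<dots> = (\<Sum>b\<in>?e ` S. scale (?c b) b)"
      by (rule finsum_eq_sum[OF V.M.abelian_monoid_axioms])
        (auto simp: op_module_def hecke_module_def free_space_def
          dest!: keys_scale[THEN subsetD] split: if_splits)
    also have "\<dots> = (\<Sum>b\<in>S. scale (Poly_Mapping.lookup v b) (?e b))"
      by (simp add: sum.reindex[OF inj] the_inv_into_f_f[OF inj])
    also have "\<dots> = lin ?e v"
      using v by (subst lin_superset[OF assms]) simp_all
    finally show "v = (\<Oplus>\<^bsub>op_module n S t\<^esub>b\<in>?e ` S. (?c b \<odot>\<^bsub>hecke n\<^esub> \<one>\<^bsub>hecke n\<^esub>) \<odot>\<^bsub>op_module n S t\<^esub> b)"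
      by simp
  qed
  then show ?thesis unfolding fin_dim_def
    by (intro exI[of _ "?e ` S"]) (use assms in auto)
qed

end

text \<open>Both sides act through the same chosen representatives, so only the generators have to be compared.\<close>

lemma lmod_iso_op_module:
  fixes V :: "('a::field, 'v) module" and t :: "nat \<Rightarrow> 'b \<Rightarrow> 'b \<Rightarrow>\<^sub>0 'a"
  assumes rep: "hecke_rep n S t" and V: "abelian_group V"
    and sm: "\<And>c x. x \<in> carrier V \<Longrightarrow> c \<odot>\<^bsub>V\<^esub> x \<in> carrier V"
    and bij: "bij_betw \<Phi> (carrier V) {p. Poly_Mapping.keys p \<subseteq> S}"
    and add: "\<And>x y. x \<in> carrier V \<Longrightarrow> y \<in> carrier V \<Longrightarrow> \<Phi> (x \<oplus>\<^bsub>V\<^esub> y) = \<Phi> x + \<Phi> y"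
    and scale: "\<And>c x. x \<in> carrier V \<Longrightarrow> \<Phi> (c \<odot>\<^bsub>V\<^esub> x) = scale c (\<Phi> x)"
    and T: "\<And>i x. i \<in> {1..<n} \<Longrightarrow> x \<in> carrier V \<Longrightarrow> T i x \<in> carrier V"
    and \<Phi>T: "\<And>i x. i \<in> {1..<n} \<Longrightarrow> x \<in> carrier V \<Longrightarrow> \<Phi> (T i x) = lin (t i) (\<Phi> x)"
  shows "lmod_iso (hecke n) (hecke_module n V T) (op_module n S t)"
    and "x \<in> carrier V \<Longrightarrow> h \<in> carrier (hecke n) \<Longrightarrow> h \<odot>\<^bsub>hecke_module n V T\<^esub> x \<in> carrier V"
proof -
  interpret V: abelian_group V by fact
  interpret hecke_rep n S t by fact
  have zero: "\<Phi> \<zero>\<^bsub>V\<^esub> = 0" using add[of "\<zero>\<^bsub>V\<^esub>" "\<zero>\<^bsub>V\<^esub>"] by simp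
  have fin: "finsum V f A \<in> carrier V \<and> \<Phi> (finsum V f A) = (\<Sum>x\<in>A. \<Phi> (f x))" if "f \<in> A \<rightarrow> carrier V" for f and A :: "nat list set"
    using that
  proof (induction A rule: infinite_finite_induct)
    case (insert x F)
    then show ?case by (subst (1 2) V.finsum_insert) (auto simp: add)
  qed (simp_all add: zero V.finsum_infinite)
  have word: "foldr T w x \<in> carrier V \<and> \<Phi> (foldr T w x) = wact t w (\<Phi> x)"
    if "w \<in> gen_words n" "x \<in> carrier V" for w x
    using that by (induction w) (use T \<Phi>T in auto)
  have smult: "h \<odot>\<^bsub>hecke_module n V T\<^esub> x \<in> carrier V \<and>
      \<Phi> (h \<odot>\<^bsub>hecke_module n V T\<^esub> x) = h \<odot>\<^bsub>op_module n S t\<^esub> \<Phi> x"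
    if h: "h \<in> carrier (hecke n)" and x: "x \<in> carrier V" for h x
  proof -
    have sx: "h \<odot>\<^bsub>hecke_module n V T\<^esub> x = (\<Oplus>\<^bsub>V\<^esub>w\<in>Poly_Mapping.keys (hrep h). Poly_Mapping.lookup (hrep h) w \<odot>\<^bsub>V\<^esub> foldr T w x)"
      by (simp add: hecke_module_def hrep_def Let_def)
    have words: "w \<in> gen_words n" if "w \<in> Poly_Mapping.keys (hrep h)" for w
      using hrep_keys[OF h] that by blast
    then have cl: "(\<lambda>w. Poly_Mapping.lookup (hrep h) w \<odot>\<^bsub>V\<^esub> foldr T w x) \<in> Poly_Mapping.keys (hrep h) \<rightarrow> carrier V"
      using word x sm by blast
    have "\<Phi> x \<in> {p. Poly_Mapping.keys p \<subseteq> S}" using bij x by (auto simp: bij_betw_def)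
    then have "h \<odot>\<^bsub>op_module n S t\<^esub> \<Phi> x = lin (\<lambda>w. wact t w (\<Phi> x)) (hrep h)"
      using h by (simp add: smult_op_module)
    also have "\<dots> = (\<Sum>w\<in>Poly_Mapping.keys (hrep h). \<Phi> (Poly_Mapping.lookup (hrep h) w \<odot>\<^bsub>V\<^esub> foldr T w x))"
      unfolding lin_def[of "\<lambda>w. wact t w (\<Phi> x)"] using words word x scale by (intro sum.cong) simp_all
    finally show ?thesis using fin[OF cl] sx by simp
  qed
  then show "x \<in> carrier V \<Longrightarrow> h \<in> carrier (hecke n) \<Longrightarrow> h \<odot>\<^bsub>hecke_module n V T\<^esub> x \<in> carrier V" by blast
  have "\<Phi> \<in> lmod_hom (hecke n) (hecke_module n V T) (op_module n S t)"
    unfolding lmod_hom_def using smult bij add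
    by (auto simp: hecke_module_def[of n V T] bij_betw_def)
  moreover have "bij_betw \<Phi> (carrier (hecke_module n V T)) (carrier (op_module n S t))"
    using bij by (simp add: hecke_module_def)
  ultimately show "lmod_iso (hecke n) (hecke_module n V T) (op_module n S t)"
    unfolding lmod_iso_def by blast
qed

lemma lmod_iso_trans:
  assumes "lmod_iso A U V" "lmod_iso A V W"
  shows "lmod_iso A U W"
proof -
  obtain f g where f: "f \<in> lmod_hom A U V" "bij_betw f (carrier U) (carrier V)"
    and g: "g \<in> lmod_hom A V W" "bij_betw g (carrier V) (carrier W)"
    using assms unfolding lmod_iso_def by blast
  have "g \<circ> f \<in> lmod_hom A U W"
    using f(1) g(1) unfolding lmod_hom_def Pi_iff by auto
  with bij_betw_trans[OF f(2) g(2)] show ?thesis unfolding lmod_iso_def by blast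
qed

section \<open>Classes of modules and triangular filtrations\<close>

section \<open>The Grothendieck group\<close>

definition fr_class :: "('a::field, 'r) module \<Rightarrow> (('r, nat \<Rightarrow>\<^sub>0 'a) module \<Rightarrow>\<^sub>0 int) \<Rightarrow> (('r, nat \<Rightarrow>\<^sub>0 'a) module \<Rightarrow>\<^sub>0 int) set"
  where "fr_class A x = K0_relations A #>\<^bsub>free_Abelian_group (fd_modules A)\<^esub> x"

lemma K0_rel_generators:
  "{frag_of V - frag_of U - frag_of W | U V W.
        U \<in> fd_modules A \<and> V \<in> fd_modules A \<and> W \<in> fd_modules A \<and> short_exact A U V W}
   \<subseteq> carrier (free_Abelian_group (fd_modules A))"
proof clarify
  fix U V W assume "U \<in> fd_modules A" "V \<in> fd_modules A" "W \<in> fd_modules A"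
  then have "Poly_Mapping.keys (frag_of V - frag_of U - frag_of W) \<subseteq> fd_modules A"
    by (intro keys_diff_subset) (simp_all add: keys_frag_of)
  then show "frag_of V - frag_of U - frag_of W \<in> carrier (free_Abelian_group (fd_modules A))" by simp
qed

lemma K0_relations_subgroup: "subgroup (K0_relations A) (free_Abelian_group (fd_modules A))"
  unfolding K0_relations_def
  by (rule group.generate_is_subgroup[OF group_free_Abelian_group K0_rel_generators])

lemma K0_relations_normal: "K0_relations A \<lhd> free_Abelian_group (fd_modules A)"
  by (rule comm_group.normal_iff_subgroup[THEN iffD2, OF abelian_free_Abelian_group K0_relations_subgroup])

lemma K0_comm_group: "comm_group (K0 A)"
  unfolding K0_def
  by (rule comm_group.abelian_FactGroup[OF abelian_free_Abelian_group K0_relations_subgroup])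

lemma fr_class_hom: "fr_class A \<in> hom (free_Abelian_group (fd_modules A)) (K0 A)"
  unfolding fr_class_def[abs_def] K0_def by (rule normal.r_coset_hom_Mod[OF K0_relations_normal])

lemma fr_class_eqI:
  assumes "x - y \<in> K0_relations A" "Poly_Mapping.keys y \<subseteq> fd_modules A"
  shows "fr_class A x = fr_class A y"
proof -
  interpret group "free_Abelian_group (fd_modules A)" by (rule group_free_Abelian_group)
  have "x \<in> K0_relations A #>\<^bsub>free_Abelian_group (fd_modules A)\<^esub> y"
    unfolding r_coset_def using assms(1) by (auto intro!: bexI[of _ "x - y"])
  then show ?thesis
    unfolding fr_class_def using repr_independence[OF _ _ K0_relations_subgroup, of x y] assms(2) by simp
qed

lemma K0_relations_closed:
  "x \<in> K0_relations A \<Longrightarrow> y \<in> K0_relations A \<Longrightarrow> x + y \<in> K0_relations A"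
  "x \<in> K0_relations A \<Longrightarrow> - x \<in> K0_relations A"
proof -
  interpret subgroup "K0_relations A" "free_Abelian_group (fd_modules A)" by (rule K0_relations_subgroup)
  show "x \<in> K0_relations A \<Longrightarrow> y \<in> K0_relations A \<Longrightarrow> x + y \<in> K0_relations A"
    using m_closed[of x y] by simp
  show "- x \<in> K0_relations A" if x: "x \<in> K0_relations A"
    using m_inv_closed[OF x] mem_carrier[OF x] inv_free_Abelian_group[of x "fd_modules A"] by simp
qed

lemma short_exact_relation:
  assumes "U \<in> fd_modules A" "V \<in> fd_modules A" "W \<in> fd_modules A" "short_exact A U V W"
  shows "frag_of V - frag_of U - frag_of W \<in> K0_relations A"
  unfolding K0_relations_def by (rule generate.incl) (use assms in blast)

lemma fr_class_short_exact:
  assumes "U \<in> fd_modules A" "V \<in> fd_modules A" "W \<in> fd_modules A" "short_exact A U V W"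
  shows "fr_class A (frag_of V) = fr_class A (frag_of U) \<otimes>\<^bsub>K0 A\<^esub> fr_class A (frag_of W)"
proof -
  have "fr_class A (frag_of V) = fr_class A (frag_of U + frag_of W)"
    using short_exact_relation[OF assms] assms
    by (intro fr_class_eqI keys_add_subset) (simp_all add: keys_frag_of diff_diff_eq)
  then show ?thesis using hom_mult[OF fr_class_hom, of "frag_of U" A "frag_of W"] assms by simp
qed

lemma op_module_in_fd_modules:
  assumes "hecke_rep n S t" "finite (S :: nat set)"
  shows "op_module n S t \<in> fd_modules (hecke n)"
  using assms hecke_rep.left_module_op_module hecke_rep.fin_dim_op_module
  unfolding fd_modules_def by blast

abbreviation zero_op_module :: "nat \<Rightarrow> ('a::field hecke, nat \<Rightarrow>\<^sub>0 'a) module"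
  where "zero_op_module n \<equiv> op_module n {} (\<lambda>_ _. 0)"

lemma hecke_rep_empty: "hecke_rep n {} t"
  by standard simp_all

text \<open>\<open>K0_class\<close> chooses a copy of the module, so the class must not depend on
  the copy. Composing one isomorphism with the inverse of the other gives an exact sequence whose
  last term is zero, and the zero module is itself a relation.\<close>

lemma lmod_iso_fr_class:
  fixes V :: "('a::field hecke, 'v) module"
  assumes W: "W \<in> fd_modules (hecke n)" "W' \<in> fd_modules (hecke n)"
    and iso: "lmod_iso (hecke n) V W" "lmod_iso (hecke n) V W'"
    and cl: "\<And>x y. x \<in> carrier V \<Longrightarrow> y \<in> carrier V \<Longrightarrow> x \<oplus>\<^bsub>V\<^esub> y \<in> carrier V"
      "\<And>h x. x \<in> carrier V \<Longrightarrow> h \<in> carrier (hecke n) \<Longrightarrow> h \<odot>\<^bsub>V\<^esub> x \<in> carrier V"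
  shows "fr_class (hecke n) (frag_of W) = fr_class (hecke n) (frag_of W')"
proof -
  obtain f g where f: "f \<in> lmod_hom (hecke n) V W" "bij_betw f (carrier V) (carrier W)"
    and g: "g \<in> lmod_hom (hecke n) V W'" "bij_betw g (carrier V) (carrier W')"
    using iso unfolding lmod_iso_def by blast
  let ?i = "inv_into (carrier V) f"
  have i: "bij_betw ?i (carrier W) (carrier V)" by (rule bij_betw_inv_into[OF f(2)])
  have icl: "?i x \<in> carrier V" "f (?i x) = x" if "x \<in> carrier W" for x
    using that i f(2) by (auto simp: bij_betw_def f_inv_into_f)
  have iadd: "?i (x \<oplus>\<^bsub>W\<^esub> y) = ?i x \<oplus>\<^bsub>V\<^esub> ?i y" if "x \<in> carrier W" "y \<in> carrier W" for x y
  proof -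
    have "f (?i x \<oplus>\<^bsub>V\<^esub> ?i y) = x \<oplus>\<^bsub>W\<^esub> y"
      using f(1) icl[OF that(1)] icl[OF that(2)] unfolding lmod_hom_def by simp
    then show ?thesis
      using f(2) cl(1) icl that by (metis bij_betw_inv_into_left)
  qed
  have ism: "?i (h \<odot>\<^bsub>W\<^esub> x) = h \<odot>\<^bsub>V\<^esub> ?i x" if "x \<in> carrier W" "h \<in> carrier (hecke n)" for x h
  proof -
    have "f (h \<odot>\<^bsub>V\<^esub> ?i x) = h \<odot>\<^bsub>W\<^esub> x"
      using f(1) icl[OF that(1)] that unfolding lmod_hom_def by simp
    then show ?thesis
      using f(2) cl(2) icl that by (metis bij_betw_inv_into_left)
  qed
  have gi: "g \<circ> ?i \<in> lmod_hom (hecke n) W W'"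
    using g(1) icl iadd ism unfolding lmod_hom_def by auto
  have gib: "bij_betw (g \<circ> ?i) (carrier W) (carrier W')" by (rule bij_betw_trans[OF i g(2)])
  let ?Z = "zero_op_module n :: ('a hecke, _) module"
  have Z: "?Z \<in> fd_modules (hecke n)" by (intro op_module_in_fd_modules hecke_rep_empty) simp
  have sZ: "h \<odot>\<^bsub>?Z\<^esub> 0 = 0" if "h \<in> carrier (hecke n)" for h
    using that by (simp add: hecke_rep.smult_op_module[OF hecke_rep_empty] wact_linear)
  have "short_exact (hecke n) W W' ?Z"
    unfolding short_exact_def
  proof (intro bexI conjI)
    show "g \<circ> ?i \<in> lmod_hom (hecke n) W W'" by (rule gi)
    show "(\<lambda>_. 0) \<in> lmod_hom (hecke n) W' ?Z"
      using sZ by (auto simp: lmod_hom_def)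
    show "inj_on (g \<circ> ?i) (carrier W)" using gib by (simp add: bij_betw_def)
    show "(g \<circ> ?i) ` carrier W = {v \<in> carrier W'. 0 = \<zero>\<^bsub>?Z\<^esub>}" using gib by (simp add: bij_betw_def)
    show "(\<lambda>_. 0) ` carrier W' = carrier ?Z"
      using W(2) by (auto simp: fd_modules_def left_module_def dest!: abelian_group.axioms(1) abelian_monoid.zero_closed)
  qed
  from short_exact_relation[OF W Z this]
  have r1: "frag_of W' - frag_of W - frag_of ?Z \<in> K0_relations (hecke n)" .
  have "short_exact (hecke n) ?Z ?Z ?Z"
    unfolding short_exact_def
  proof (intro bexI conjI)
    show "(\<lambda>x. x) \<in> lmod_hom (hecke n) ?Z ?Z" by (auto simp: lmod_hom_def)
    show "(\<lambda>_. 0) \<in> lmod_hom (hecke n) ?Z ?Z"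
      using sZ by (auto simp: lmod_hom_def)
  qed auto
  \<comment> \<open>The sequence of three zero modules contributes Z - Z - Z = -Z.\<close>
  from short_exact_relation[OF Z Z Z this]
  have "- frag_of ?Z \<in> K0_relations (hecke n)" by simp
  from K0_relations_closed(1)[OF r1 K0_relations_closed(2)[OF this]]
  have "(frag_of W' - frag_of W - frag_of ?Z) + - (- frag_of ?Z) \<in> K0_relations (hecke n)" .
  then have "frag_of W' - frag_of W \<in> K0_relations (hecke n)"
    by simp
  from K0_relations_closed(2)[OF this] have "frag_of W - frag_of W' \<in> K0_relations (hecke n)"
    by simp
  then show ?thesis using W by (intro fr_class_eqI) (simp_all add: keys_frag_of)
qed

lemma K0_class_eq:
  fixes V :: "('a::field hecke, 'v) module"
  assumes "W \<in> fd_modules (hecke n)" "lmod_iso (hecke n) V W"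
    and "\<And>x y. x \<in> carrier V \<Longrightarrow> y \<in> carrier V \<Longrightarrow> x \<oplus>\<^bsub>V\<^esub> y \<in> carrier V"
      "\<And>h x. x \<in> carrier V \<Longrightarrow> h \<in> carrier (hecke n) \<Longrightarrow> h \<odot>\<^bsub>V\<^esub> x \<in> carrier V"
  shows "K0_class (hecke n) V = fr_class (hecke n) (frag_of W)"
proof -
  let ?W = "SOME W. W \<in> fd_modules (hecke n) \<and> lmod_iso (hecke n) V W"
  have "?W \<in> fd_modules (hecke n) \<and> lmod_iso (hecke n) V ?W"
    by (rule someI[of _ W]) (use assms in blast)
  then show ?thesis
    unfolding K0_class_def fr_class_def[symmetric] using lmod_iso_fr_class[OF _ assms(1) _ assms(2-4)] by blast
qed

text \<open>The operators of \<open>C_\<alpha>\<close> with \<open>D\<close> in place of the descent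
  set of \<alpha>, on the basis \<open>{0}\<close> so that the module lives on the type of
  \<open>fd_modules\<close>.\<close>

definition one_op :: "nat set \<Rightarrow> nat \<Rightarrow> nat \<Rightarrow> nat \<Rightarrow>\<^sub>0 'a::field"
  where "one_op D i = (\<lambda>_. if i \<in> D then 0 else Poly_Mapping.single 0 1)"

definition one_class :: "nat \<Rightarrow> nat set \<Rightarrow> (('a::field hecke, nat \<Rightarrow>\<^sub>0 'a) module \<Rightarrow>\<^sub>0 int) set"
  where "one_class n D = fr_class (hecke n) (frag_of (op_module n {0} (one_op D)))"

lemma hecke_rep_one: "hecke_rep n {0} (one_op D)"
  by standard (auto simp: one_op_def)

lemma fr_class_carrier: "W \<in> fd_modules A \<Longrightarrow> fr_class A (frag_of W) \<in> carrier (K0 A)"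
  using fr_class_hom[of A] by (auto simp: hom_def)

lemma one_class_carrier: "one_class n D \<in> carrier (K0 (hecke n))"
  unfolding one_class_def
  by (intro fr_class_carrier op_module_in_fd_modules hecke_rep_one) simp

lemma fr_class_zero_op_module: "fr_class (hecke n) (frag_of (op_module n {} t)) = \<one>\<^bsub>K0 (hecke n)\<^esub>"
proof -
  interpret K: comm_group "K0 (hecke n :: ('a::field, 'a hecke) module)" by (rule K0_comm_group)
  let ?Z = "op_module n {} t :: ('a hecke, _) module"
  have Z: "?Z \<in> fd_modules (hecke n)" by (intro op_module_in_fd_modules hecke_rep_empty) simp
  have sZ: "h \<odot>\<^bsub>?Z\<^esub> 0 = 0" if "h \<in> carrier (hecke n)" for h
    using that by (simp add: hecke_rep.smult_op_module[OF hecke_rep_empty] wact_linear)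
  have "short_exact (hecke n) ?Z ?Z ?Z"
    unfolding short_exact_def
  proof (intro bexI conjI)
    show "(\<lambda>x. x) \<in> lmod_hom (hecke n) ?Z ?Z" by (auto simp: lmod_hom_def)
    show "(\<lambda>_. 0) \<in> lmod_hom (hecke n) ?Z ?Z"
      using sZ by (auto simp: lmod_hom_def)
  qed auto
  from fr_class_short_exact[OF Z Z Z this] show ?thesis
    using fr_class_carrier[OF Z] K.l_cancel_one by metis
qed

text \<open>The spans of initial segments of the basis are invariant, which filters the module with
  one-dimensional quotients read off from the diagonal.\<close>

lemma fr_class_triangular:
  fixes t :: "nat \<Rightarrow> nat \<Rightarrow> nat \<Rightarrow>\<^sub>0 'a::field"
  assumes "hecke_rep n {..<N} t"
    and "\<And>i k. i \<in> {1..<n} \<Longrightarrow> k < N \<Longrightarrow> Poly_Mapping.keys (t i k) \<subseteq> {..k}"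
    and "\<And>i k. i \<in> {1..<n} \<Longrightarrow> k < N \<Longrightarrow> Poly_Mapping.lookup (t i k) k = (if i \<in> D k then 0 else 1)"
  shows "fr_class (hecke n) (frag_of (op_module n {..<N} t)) = finprod (K0 (hecke n)) (\<lambda>k. one_class n (D k)) {..<N}"
  using assms
proof (induction N)
  case 0
  interpret K: comm_group "K0 (hecke n :: ('a, 'a hecke) module)" by (rule K0_comm_group)
  show ?case by (simp add: fr_class_zero_op_module)
next
  case (Suc N)
  interpret K: comm_group "K0 (hecke n :: ('a, 'a hecke) module)" by (rule K0_comm_group)
  interpret V: hecke_rep n "{..<Suc N}" t by (rule Suc.prems)
  interpret U: hecke_rep n "{..<N}" t
  proof
    show "Poly_Mapping.keys (t i b) \<subseteq> {..<N}" if "i \<in> {1..<n}" "b \<in> {..<N}" for i b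
      using Suc.prems(2)[of i b] that by fastforce
  qed (use V.idem V.braid V.comm in auto)
  interpret W: hecke_rep n "{0}" "one_op (D N) :: nat \<Rightarrow> nat \<Rightarrow> nat \<Rightarrow>\<^sub>0 'a" by (rule hecke_rep_one)
  let ?U = "op_module n {..<N} t" and ?V = "op_module n {..<Suc N} t"
    and ?W = "op_module n {0} (one_op (D N)) :: ('a hecke, _) module"
  \<comment> \<open>The coordinate at the last basis vector; its kernel is the span of the earlier
    ones and its image is the top quotient.\<close>
  define g :: "(nat \<Rightarrow>\<^sub>0 'a) \<Rightarrow> (nat \<Rightarrow>\<^sub>0 'a)" where "g v = Poly_Mapping.single 0 (Poly_Mapping.lookup v N)" for v
  have g_lin: "g v = lin (\<lambda>k. if k = N then Poly_Mapping.single 0 1 else 0) v" for v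
  proof -
    have "lin (\<lambda>k. if k = N then Poly_Mapping.single 0 1 else 0) v =
      (\<Sum>k\<in>insert N (Poly_Mapping.keys v). if k = N then Poly_Mapping.single 0 (Poly_Mapping.lookup v k) else 0)"
      by (rule trans[OF lin_superset[of "insert N (Poly_Mapping.keys v)"]], simp, blast, rule sum.cong) simp_all
    also have "\<dots> = g v" by (subst sum.delta) (simp_all add: g_def)
    finally show ?thesis ..
  qed
  have g_t: "g (lin (t i) v) = lin (one_op (D N) i) (g v)"
    if i: "i \<in> {1..<n}" and "Poly_Mapping.keys v \<subseteq> {..<Suc N}" for i v
    unfolding g_lin lin_lin
  proof (rule lin_cong)
    fix k assume "k \<in> Poly_Mapping.keys v"
    then have k: "k < Suc N" using that(2) by auto
    show "lin (\<lambda>k. if k = N then Poly_Mapping.single 0 1 else 0) (t i k) =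
      lin (one_op (D N) i) (if k = N then Poly_Mapping.single 0 1 else 0)"
    proof (cases "k = N")
      case True
      then show ?thesis unfolding g_lin[symmetric] g_def
        using Suc.prems(3)[OF i k] by (simp add: one_op_def)
    next
      case False
      then have "N \<notin> Poly_Mapping.keys (t i k)" using Suc.prems(2)[OF i k] k by auto
      then show ?thesis unfolding g_lin[symmetric] g_def
        using False by (simp add: in_keys_iff)
    qed
  qed
  have g_wact: "g (wact t w v) = wact (one_op (D N)) w (g v)"
    if "w \<in> gen_words n" "Poly_Mapping.keys v \<subseteq> {..<Suc N}" for w v
    using that by (induction w) (use g_t V.keys_wact in auto)
  have g_keys: "Poly_Mapping.keys (g v) \<subseteq> {0}" for v by (simp add: g_def)
  have "short_exact (hecke n) ?U ?V ?W"
    unfolding short_exact_def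
  proof (intro bexI conjI)
    show "(\<lambda>v. v) \<in> lmod_hom (hecke n) ?U ?V"
      unfolding lmod_hom_def
    proof (intro CollectI conjI ballI Pi_I)
      show "v \<in> carrier ?V" if "v \<in> carrier ?U" for v using that by fastforce
      show "a \<odot>\<^bsub>?U\<^esub> x = a \<odot>\<^bsub>?V\<^esub> x" if "a \<in> carrier (hecke n)" "x \<in> carrier ?U" for a x
        using that by (subst U.smult_op_module, simp_all, subst V.smult_op_module) fastforce+
    qed simp
    show "g \<in> lmod_hom (hecke n) ?V ?W"
      unfolding lmod_hom_def
    proof (intro CollectI conjI ballI Pi_I)
      show "g v \<in> carrier ?W" for v using g_keys by simp
      show "g (x \<oplus>\<^bsub>?V\<^esub> y) = g x \<oplus>\<^bsub>?W\<^esub> g y" for x y by (simp add: g_lin lin_add)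
      show "g (a \<odot>\<^bsub>?V\<^esub> x) = a \<odot>\<^bsub>?W\<^esub> g x" if "a \<in> carrier (hecke n)" "x \<in> carrier ?V" for a x
      proof -
        have "g (a \<odot>\<^bsub>?V\<^esub> x) = lin (\<lambda>w. g (wact t w x)) (hrep a)"
          using that unfolding g_lin by (simp add: V.smult_op_module lin_lin)
        also have "\<dots> = lin (\<lambda>w. wact (one_op (D N)) w (g x)) (hrep a)"
          using hrep_keys[OF that(1)] that(2) by (intro lin_cong g_wact) auto
        also have "\<dots> = a \<odot>\<^bsub>?W\<^esub> g x"
          using that(1) g_keys by (simp add: W.smult_op_module)
        finally show ?thesis .
      qed
    qed
    show "inj_on (\<lambda>v. v) (carrier ?U)" by simp
    show "g ` carrier ?V = carrier ?W"
    proof (intro equalityI subsetI)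
      fix q assume "q \<in> carrier ?W"
      then have q: "Poly_Mapping.keys q \<subseteq> {0}" by simp
      have "q = g (Poly_Mapping.single N (Poly_Mapping.lookup q 0))"
        using q by (intro poly_mapping_eqI) (auto simp: g_def lookup_single when_def in_keys_iff)
      then show "q \<in> g ` carrier ?V" by (rule image_eqI) simp
    qed (use g_keys in auto)
    show "(\<lambda>v. v) ` carrier ?U = {v \<in> carrier ?V. g v = \<zero>\<^bsub>?W\<^esub>}"
    proof -
      have "Poly_Mapping.keys v \<subseteq> {..<N} \<longleftrightarrow> Poly_Mapping.keys v \<subseteq> {..<Suc N} \<and> g v = 0" for v
        unfolding lessThan_Suc subset_insert_iff
        by (auto simp: g_def in_keys_iff subset_iff)
          (metis keys_eq_empty keys_single insert_not_empty)+
      then show ?thesis by auto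
    qed
  qed
  then have "fr_class (hecke n) (frag_of ?V) = fr_class (hecke n) (frag_of ?U) \<otimes>\<^bsub>K0 (hecke n)\<^esub> fr_class (hecke n) (frag_of ?W)"
    by (intro fr_class_short_exact op_module_in_fd_modules V.hecke_rep_axioms U.hecke_rep_axioms W.hecke_rep_axioms) simp_all
  also have "fr_class (hecke n) (frag_of ?U) = finprod (K0 (hecke n)) (\<lambda>k. one_class n (D k)) {..<N}"
    by (rule Suc.IH[OF U.hecke_rep_axioms]) (use Suc.prems in auto)
  finally show ?case
    by (simp add: lessThan_Suc one_class_carrier K.m_comm Pi_iff flip: one_class_def)
qed

text \<open>If off-diagonal terms strictly drop \<open>rank\<close>, listing the basis by increasing
  rank makes all matrices triangular at once; ties may be broken arbitrarily.\<close>

lemma K0_class_triangular: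
  fixes t :: "nat \<Rightarrow> 'b \<Rightarrow> 'b \<Rightarrow>\<^sub>0 'a::field" and rank :: "'b \<Rightarrow> nat"
  assumes rep: "hecke_rep n S t" and fin: "finite S"
    and tri: "\<And>i b. i \<in> {1..<n} \<Longrightarrow> b \<in> S \<Longrightarrow>
      \<exists>q. t i b = q + (if i \<in> D b then 0 else Poly_Mapping.single b 1) \<and> (\<forall>k\<in>Poly_Mapping.keys q. rank k < rank b)"
    and iso: "lmod_iso (hecke n) V (op_module n S t)"
    and cl: "\<And>x y. x \<in> carrier V \<Longrightarrow> y \<in> carrier V \<Longrightarrow> x \<oplus>\<^bsub>V\<^esub> y \<in> carrier V"
      "\<And>h x. x \<in> carrier V \<Longrightarrow> h \<in> carrier (hecke n) \<Longrightarrow> h \<odot>\<^bsub>V\<^esub> x \<in> carrier V"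
  shows "K0_class (hecke n) V = finprod (K0 (hecke n)) (\<lambda>b. one_class n (D b)) S"
proof -
  interpret K: comm_group "K0 (hecke n :: ('a, 'a hecke) module)" by (rule K0_comm_group)
  interpret S: hecke_rep n S t by fact
  obtain ys where ys: "set ys = S" "distinct ys" using fin finite_distinct_list by blast
  define xs where "xs = sort_key rank ys"
  have xs: "set xs = S" "distinct xs" "sorted (map rank xs)"
    using ys by (simp_all add: xs_def)
  define N where "N = length xs"
  define e where "e k = xs ! k" for k
  have e: "bij_betw e {..<N} S"
    unfolding N_def e_def using bij_betw_nth[OF xs(2) refl] xs(1) by (simp add: fun_eq_iff)
  have eS: "e k \<in> S" if "k < N" for k using e that by (auto simp: bij_betw_def)
  define idx where "idx = inv_into {..<N} e"
  have idx: "idx b < N" "e (idx b) = b" if "b \<in> S" for b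
    using e that unfolding idx_def bij_betw_def
    by (metis inv_into_into lessThan_iff, metis f_inv_into_f)
  have idx_e: "idx (e k) = k" if "k < N" for k
    using e that unfolding idx_def by (simp add: bij_betw_def)
  have mono: "idx b < idx b'" if "rank b < rank b'" "b \<in> S" "b' \<in> S" for b b'
  proof (rule ccontr)
    assume "\<not> idx b < idx b'"
    then have "rank (e (idx b')) \<le> rank (e (idx b))"
      using sorted_nth_mono[OF xs(3), of "idx b'" "idx b"] idx(1)[OF that(2)] idx(1)[OF that(3)]
      by (simp add: e_def N_def)
    with that idx show False by simp
  qed
  \<comment> \<open>\<open>?P\<close> and \<open>?Q\<close> renumber the basis in both directions,
    and \<open>t'\<close> is the action carried along.\<close>
  let ?P = "lin (\<lambda>b. Poly_Mapping.single (idx b) (1::'a))"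
  let ?Q = "lin (\<lambda>k. Poly_Mapping.single (e k) (1::'a))"
  define t' where "t' i k = ?P (t i (e k))" for i k
  have P_keys: "Poly_Mapping.keys (?P v) \<subseteq> {..<N}" if "Poly_Mapping.keys v \<subseteq> S" for v
    by (rule keys_lin_subset[OF that]) (simp add: idx)
  have Q_keys: "Poly_Mapping.keys (?Q v) \<subseteq> S" if "Poly_Mapping.keys v \<subseteq> {..<N}" for v
    by (rule keys_lin_subset[OF that]) (simp add: eS)
  have QP: "?Q (?P v) = v" if "Poly_Mapping.keys v \<subseteq> S" for v
  proof -
    have "?Q (?P v) = lin (\<lambda>b. Poly_Mapping.single b 1) v"
      unfolding lin_lin by (rule lin_cong) (use that idx in auto)
    then show ?thesis by simp
  qed
  have PQ: "?P (?Q v) = v" if "Poly_Mapping.keys v \<subseteq> {..<N}" for v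
  proof -
    have "?P (?Q v) = lin (\<lambda>b. Poly_Mapping.single b 1) v"
      unfolding lin_lin by (rule lin_cong) (use that idx_e in auto)
    then show ?thesis by simp
  qed
  have tP: "lin (t' i) (?P v) = ?P (lin (t i) v)" if "Poly_Mapping.keys v \<subseteq> S" for i v
    unfolding lin_lin by (rule lin_cong) (use that idx in \<open>auto simp: t'_def\<close>)
  have rep': "hecke_rep n {..<N} t'"
  proof
    show "Poly_Mapping.keys (t' i b) \<subseteq> {..<N}" if "i \<in> {1..<n}" "b \<in> {..<N}" for i b
      unfolding t'_def using that by (intro P_keys S.keys_t eS) auto
    show "lin (t' i) (t' i b) = t' i b" if "i \<in> {1..<n}" "b \<in> {..<N}" for i b
      using that eS by (simp add: t'_def[of i b] tP S.keys_t S.idem)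
    show "lin (t' i) (lin (t' (i + 1)) (t' i b)) = lin (t' (i + 1)) (lin (t' i) (t' (i + 1) b))"
      if "i \<in> {1..<n}" "i + 1 \<in> {1..<n}" "b \<in> {..<N}" for i b
      using that eS S.braid[of i "e b"]
      by (simp add: t'_def[of _ b] tP S.keys_t S.keys_op del: Suc_eq_plus1 add_Suc_right)
    show "lin (t' i) (t' j b) = lin (t' j) (t' i b)"
      if "i \<in> {1..<n}" "j \<in> {1..<n}" "\<bar>int i - int j\<bar> > 1" "b \<in> {..<N}" for i j b
      using that eS S.comm[of i j "e b"] by (simp add: t'_def[of _ b] tP S.keys_t)
  qed
  interpret F: module ring_of_type_algebra "free_space S :: ('a, _) module" by (rule free_space_module)
  have "lmod_iso (hecke n) (hecke_module n (free_space S) (\<lambda>i. lin (t i))) (op_module n {..<N} t')"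
  proof (rule lmod_iso_op_module(1)[OF rep' F.M.abelian_group_axioms, where \<Phi> = ?P])
    show "bij_betw ?P (carrier (free_space S :: ('a, _) module)) {p. Poly_Mapping.keys p \<subseteq> {..<N}}"
      by (rule bij_betwI[where g = ?Q]) (use P_keys Q_keys QP PQ in auto)
  qed (simp_all add: lin_add lin_scale tP S.keys_op order_trans[OF keys_scale])
  then have "lmod_iso (hecke n) V (op_module n {..<N} t')"
    using lmod_iso_trans[OF iso] by (simp add: op_module_def)
  then have "K0_class (hecke n) V = fr_class (hecke n) (frag_of (op_module n {..<N} t'))"
    by (intro K0_class_eq cl op_module_in_fd_modules rep') simp_all
  also have "\<dots> = finprod (K0 (hecke n)) (\<lambda>k. one_class n (D (e k))) {..<N}"
  proof (rule fr_class_triangular[OF rep'])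
    fix i k assume i: "i \<in> {1..<n}" and k: "k < N"
    obtain q where q: "t i (e k) = q + (if i \<in> D (e k) then 0 else Poly_Mapping.single (e k) 1)"
      "\<forall>b\<in>Poly_Mapping.keys q. rank b < rank (e k)"
      using tri[OF i eS[OF k]] by blast
    have "q = t i (e k) - (if i \<in> D (e k) then 0 else Poly_Mapping.single (e k) 1)"
      using q(1) by simp
    also have "Poly_Mapping.keys \<dots> \<subseteq> S"
      using S.keys_t[OF i eS[OF k]] eS[OF k] by (intro keys_diff_subset) simp_all
    finally have qS: "Poly_Mapping.keys q \<subseteq> S" .
    have Pq: "Poly_Mapping.keys (?P q) \<subseteq> {..<k}"
    proof (rule keys_lin_subset[OF order_refl])
      fix b assume b: "b \<in> Poly_Mapping.keys q"
      then have "idx b < idx (e k)" using q(2) qS eS[OF k] by (intro mono) auto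
      then show "Poly_Mapping.keys (Poly_Mapping.single (idx b) (1::'a)) \<subseteq> {..<k}"
        using k by (simp add: idx_e)
    qed
    have t': "t' i k = ?P q + (if i \<in> D (e k) then 0 else Poly_Mapping.single k 1)"
      unfolding t'_def q(1) using k by (simp add: lin_add idx_e)
    show "Poly_Mapping.keys (t' i k) \<subseteq> {..k}"
      unfolding t' using Pq by (intro keys_add_subset) auto
    show "Poly_Mapping.lookup (t' i k) k = (if i \<in> D (e k) then 0 else 1)"
      unfolding t' using Pq by (auto simp: lookup_add in_keys_iff)
  qed
  also have "\<dots> = finprod (K0 (hecke n)) (\<lambda>b. one_class n (D b)) (e ` {..<N})"
    using e by (subst K.finprod_reindex) (auto simp: one_class_carrier bij_betw_def)
  finally show ?thesis using e by (simp add: bij_betw_def)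
qed

section \<open>Normal forms of words modulo the smaller algebra on the right\<close>

section \<open>Shuffle words\<close>

text \<open>The word \<open>canon 1 [s\<^sub>1, \<dots>, s\<^sub>a]\<close> moves the strands \<open>1, \<dots>, a\<close> to the positions \<open>s\<^sub>1 < \<dots> < s\<^sub>a\<close>.\<close>

fun canon :: "nat \<Rightarrow> nat list \<Rightarrow> nat list" where
  "canon j [] = []"
| "canon j (s # ss) = rev [j..<s] @ canon (j + 1) ss"

lemma hcong_left: "hcong m w w' \<Longrightarrow> u \<in> gen_words m \<Longrightarrow> hcong m (u @ w) (u @ w')"
  using hcong_append[of m w w' u "[]"] by simp

lemma hcong_right: "hcong m w w' \<Longrightarrow> v \<in> gen_words m \<Longrightarrow> hcong m (w @ v) (w' @ v)"
  using hcong_append[of m w w' "[]" v] by simp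

lemma hcong_base: "hrel m l r \<Longrightarrow> hcong m l r"
  using hcong.step[of m l r "[]" "[]"] by simp

lemma hcong_commute:
  assumes "i \<in> {1..<m}" "w \<in> gen_words m" "\<And>x. x \<in> set w \<Longrightarrow> \<bar>int i - int x\<bar> > 1"
  shows "hcong m (i # w) (w @ [i])"
  using assms
proof (induction w)
  case Nil then show ?case by (simp add: hcong.reflI)
next
  case (Cons x w)
  have 1: "hcong m ([i, x] @ w) ([x, i] @ w)"
    by (rule hcong_right[OF hcong_base[OF hrel.comm]]) (use Cons.prems in auto)
  have 2: "hcong m ([x] @ (i # w)) ([x] @ (w @ [i]))"
    by (rule hcong_left[OF Cons.IH]) (use Cons.prems in auto)
  show ?case using hcong.transI[OF 1[simplified] 2[simplified]] by simp
qed

lemma rev_upt_Suc: "j \<le> s \<Longrightarrow> rev [j..<s + 1] = s # rev [j..<s]"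
  by (simp flip: Suc_eq_plus1)

lemma rev_upt_snoc: "j < s \<Longrightarrow> rev [j..<s] = rev [j + 1..<s] @ [j]"
  unfolding Suc_eq_plus1[symmetric] by (subst upt_conv_Cons) simp_all

lemma rev_upt_split: "j \<le> i \<Longrightarrow> i \<le> s \<Longrightarrow> rev [j..<s] = rev [i..<s] @ rev [j..<i]"
  by (metis rev_append upt_add_eq_append le_add_diff_inverse)

lemma hcong_absorb:
  assumes "1 \<le> j" "j \<le> i" "i < m"
  shows "hcong m (i # rev [j..<i + 1]) (rev [j..<i + 1])"
proof -
  have "hcong m ([i, i] @ rev [j..<i]) ([i] @ rev [j..<i])"
    by (rule hcong_right[OF hcong_base[OF hrel.idem]]) (use assms in auto)
  then show ?thesis using assms by (simp add: rev_upt_Suc)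
qed

text \<open>The letter commutes with the part of the run above \<open>i + 1\<close>, takes one braid
  move in the middle and commutes with the part below \<open>i\<close>; the braid move raises the
  index.\<close>

lemma hcong_slide:
  assumes "1 \<le> j" "j \<le> i" "i + 1 < s" "s \<le> m"
  shows "hcong m (i # rev [j..<s]) (rev [j..<s] @ [i + 1])"
proof -
  let ?A = "rev [i + 2..<s]" and ?B = "rev [j..<i]"
  have eq: "rev [j..<s] = ?A @ [i + 1, i] @ ?B"
    using assms rev_upt_split[of j i s] rev_upt_split[of i "i + 2" s] by (simp add: numeral_2_eq_2)
  have 1: "hcong m ((i # ?A) @ ([i + 1, i] @ ?B)) ((?A @ [i]) @ ([i + 1, i] @ ?B))"
    by (rule hcong_right[OF hcong_commute]) (use assms in auto)
  have 2: "hcong m (?A @ ([i, i + 1, i] @ ?B)) (?A @ ([i + 1, i, i + 1] @ ?B))"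
    by (rule hcong_left[OF hcong_right[OF hcong_base[OF hrel.braid]]]) (use assms in auto)
  have 3: "hcong m ((?A @ [i + 1, i]) @ ((i + 1) # ?B)) ((?A @ [i + 1, i]) @ (?B @ [i + 1]))"
    by (rule hcong_left[OF hcong_commute]) (use assms in auto)
  show ?thesis unfolding eq
    using hcong.transI[OF 1[simplified] hcong.transI[OF 2[simplified] 3[simplified]]] by simp
qed

text \<open>\<open>hcong_slide\<close> read backwards, one letter of \<open>w\<close> at a
  time.\<close>

lemma hcong_slide_word:
  assumes "1 \<le> j" "s + 1 \<le> m" "set w \<subseteq> {j + 1..s}"
  shows "hcong m (rev [j..<s + 1] @ w) (map (\<lambda>x. x - 1) w @ rev [j..<s + 1])"
  using assms(3)
proof (induction w)
  case Nil then show ?case by (simp add: hcong.reflI)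
next
  case (Cons x w)
  let ?D = "rev [j..<s + 1]"
  have 1: "hcong m ((?D @ [x]) @ w) (((x - 1) # ?D) @ w)"
    by (rule hcong_right[OF hcong.symI]) (use hcong_slide[of j "x - 1" "s + 1" m] assms Cons.prems in auto)
  have 2: "hcong m ([x - 1] @ (?D @ w)) ([x - 1] @ (map (\<lambda>x. x - 1) w @ ?D))"
    by (rule hcong_left[OF Cons.IH]) (use assms Cons.prems in auto)
  show ?case using hcong.transI[OF 1[simplified] 2[simplified]] by simp
qed

lemma canon_letters:
  assumes "\<forall>x\<in>set ss. x \<le> m"
  shows "set (canon j ss) \<subseteq> {j..<m}"
  using assms
proof (induction ss arbitrary: j)
  case (Cons s ss)
  have "set (canon (j + 1) ss) \<subseteq> {j + 1..<m}" by (rule Cons.IH) (use Cons.prems in simp)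
  also have "\<dots> \<subseteq> {j..<m}" by auto
  finally show ?case using Cons.prems by auto
qed simp

definition admissible :: "nat \<Rightarrow> nat \<Rightarrow> nat list \<Rightarrow> bool"
  where "admissible j m ss \<longleftrightarrow> 1 \<le> j \<and> sorted_wrt (<) ss \<and> (\<forall>x\<in>set ss. j \<le> x \<and> x \<le> m)"

lemma admissible_Cons:
  "admissible j m (s # ss) \<Longrightarrow> admissible (j + 1) m ss \<and> 1 \<le> j \<and> j \<le> s \<and> s \<le> m \<and> (\<forall>x\<in>set ss. s < x)"
  by (fastforce simp: admissible_def)

lemma canon_word: "admissible j m ss \<Longrightarrow> canon j ss \<in> gen_words m"
  using canon_letters[of ss m j] by (auto simp: admissible_def)

text \<open>The run of a strand sent to \<open>s\<close> has letters at most \<open>s - 1\<close>,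
  which commute with \<open>i\<close> when \<open>s < i\<close>. The four lemmas on
  \<open>canon_step\<close> below pass the strands placed left of \<open>i\<close> in this
  way.\<close>

lemma canon_step_past:
  assumes "admissible j m (s # ss)" "i \<in> {1..<m}" "s < i" "hcong m (i # canon (j + 1) ss) w"
  shows "hcong m (i # canon j (s # ss)) (rev [j..<s] @ w)"
proof -
  note a = admissible_Cons[OF assms(1)]
  have 1: "hcong m ((i # rev [j..<s]) @ canon (j + 1) ss) ((rev [j..<s] @ [i]) @ canon (j + 1) ss)"
    by (rule hcong_right[OF hcong_commute]) (use a assms canon_word in auto)
  have 2: "hcong m (rev [j..<s] @ (i # canon (j + 1) ss)) (rev [j..<s] @ w)"
    by (rule hcong_left[OF assms(4)]) (use a in auto)
  show ?thesis using hcong.transI[OF 1[simplified] 2[simplified]] by simp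
qed

text \<open>Two dummies cross at positions \<open>i\<close> and \<open>i + 1\<close>. Every run of a
  strand placed to their right raises the crossing by one, so it comes out shifted by the number of
  these strands.\<close>

lemma canon_step_none:
  assumes "admissible j m ss" "j \<le> i" "i < m" "i \<notin> set ss" "i + 1 \<notin> set ss"
  shows "hcong m (i # canon j ss) (canon j ss @ [i + card {x \<in> set ss. i < x}])"
  using assms
proof (induction ss arbitrary: j i)
  case Nil then show ?case by (simp add: hcong.reflI)
next
  case (Cons s ss)
  note a = admissible_Cons[OF Cons.prems(1)]
  consider "s < i" | "i + 1 < s" using Cons.prems(4,5) by force
  then show ?case
  proof cases
    case 1
    then have "{x \<in> set (s # ss). i < x} = {x \<in> set ss. i < x}" by auto
    then show ?thesis
      using canon_step_past[OF Cons.prems(1) _ 1 Cons.IH[of "j + 1" i]] Cons.prems a 1 by auto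
  next
    case 2
    have "{x \<in> set (s # ss). i < x} = insert s (set ss)" "{x \<in> set ss. i + 1 < x} = set ss"
      "s \<notin> set ss" using a 2 by auto
    then have card: "i + card {x \<in> set (s # ss). i < x} = i + 1 + card {x \<in> set ss. i + 1 < x}" by simp
    have 1: "hcong m ((i # rev [j..<s]) @ canon (j + 1) ss) ((rev [j..<s] @ [i + 1]) @ canon (j + 1) ss)"
      by (rule hcong_right[OF hcong_slide]) (use a Cons.prems 2 canon_word in auto)
    have 2: "hcong m (rev [j..<s] @ ((i + 1) # canon (j + 1) ss))
      (rev [j..<s] @ (canon (j + 1) ss @ [i + 1 + card {x \<in> set ss. i + 1 < x}]))"
      by (rule hcong_left[OF Cons.IH]) (use a 2 Cons.prems in auto)
    show ?thesis unfolding card using hcong.transI[OF 1[simplified] 2[simplified]] by simp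
  qed
qed

text \<open>Two consecutive strands cross; at the source end this is the crossing of the same two
  strands, hence the generator indexed by the number of the left one, counted from
  \<open>j\<close>.\<close>

lemma canon_step_both:
  assumes "admissible j m ss" "i < m" "i \<in> set ss" "i + 1 \<in> set ss"
  shows "hcong m (i # canon j ss) (canon j ss @ [j + card {x \<in> set ss. x < i}])"
  using assms
proof (induction ss arbitrary: j)
  case Nil then show ?case by simp
next
  case (Cons s ss)
  note a = admissible_Cons[OF Cons.prems(1)]
  consider "s < i" | "i = s" using Cons.prems(3) a by force
  then show ?case
  proof cases
    case 1
    then have "{x \<in> set (s # ss). x < i} = insert s {x \<in> set ss. x < i}" "s \<notin> set ss" using a by auto
    then have card: "j + card {x \<in> set (s # ss). x < i} = j + 1 + card {x \<in> set ss. x < i}" by simp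
    have "i \<in> {1..<m}" using 1 a Cons.prems by auto
    from canon_step_past[OF Cons.prems(1) this 1 Cons.IH[of "j + 1"]] show ?thesis
      unfolding card using Cons.prems a 1 by (auto simp del: add_Suc_right)
  next
    case 2
    obtain ss' where ss: "ss = (s + 1) # ss'"
    proof (cases ss)
      case Nil then show ?thesis using Cons.prems 2 by simp
    next
      case (Cons y ys)
      have "y \<le> s + 1" using Cons.prems(1,4) 2 Cons a unfolding admissible_def by (auto dest: less_imp_le)
      moreover have "s < y" using Cons a by simp
      ultimately show ?thesis using Cons that by (metis Suc_eq_plus1 Suc_leI le_antisym)
    qed
    let ?E = "rev [j + 1..<s + 1]" and ?C = "canon (j + 2) ss'"
    have "{x \<in> set (s # ss). x < i} = {}" using 2 a by auto
    then have card: "j + card {x \<in> set (s # ss). x < i} = j" by simp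
    have adm: "admissible (j + 2) m ss'"
      using admissible_Cons[of "j + 1" m "s + 1" ss'] a unfolding ss by (simp add: add.assoc)
    have canon: "canon j (s # ss) = rev [j..<s] @ ?E @ ?C" by (simp add: ss add.assoc)
    have pred: "map (\<lambda>x. x - 1) ?E = rev [j..<s]"
      unfolding Suc_eq_plus1[symmetric] map_Suc_upt[symmetric] rev_map[symmetric] by (simp add: o_def)
    have snoc: "rev [j..<s + 1] = ?E @ [j]" using a by (intro rev_upt_snoc) simp
    have C: "?C \<in> gen_words m" by (rule canon_word[OF adm])
    have sm: "s + 1 \<le> m" using a unfolding ss admissible_def by simp
    \<comment> \<open>The letter \<open>i = s\<close> enlarges the first run, which then slides over
      the second and lowers it by one. What remains is a last letter \<open>j\<close>, and it
      commutes with the later runs since their letters are at least \<open>j + 2\<close>.\<close>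
    have 1: "hcong m ((rev [j..<s + 1] @ ?E) @ ?C) ((map (\<lambda>x. x - 1) ?E @ rev [j..<s + 1]) @ ?C)"
      by (rule hcong_right[OF hcong_slide_word C]) (use a sm in auto)
    have 2: "hcong m ((rev [j..<s] @ ?E) @ (j # ?C)) ((rev [j..<s] @ ?E) @ (?C @ [j]))"
    proof (rule hcong_left[OF hcong_commute])
      show "\<bar>int j - int x\<bar> > 1" if "x \<in> set ?C" for x
        using canon_letters[of ss' m "j + 2"] adm that a by (fastforce simp: admissible_def)
    qed (use a sm C in auto)
    have start: "i # canon j (s # ss) = (rev [j..<s + 1] @ ?E) @ ?C"
      unfolding canon using a \<open>i = s\<close> by (simp only: rev_upt_Suc append_Cons append_assoc)
    have mid: "(map (\<lambda>x. x - 1) ?E @ rev [j..<s + 1]) @ ?C = (rev [j..<s] @ ?E) @ (j # ?C)"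
      unfolding pred snoc by simp
    have stop: "(rev [j..<s] @ ?E) @ (?C @ [j]) = canon j (s # ss) @ [j]"
      by (simp only: canon append_assoc)
    show ?thesis unfolding card using hcong.transI[OF 1[unfolded mid] 2] unfolding start[symmetric] stop .
  qed
qed

text \<open>The crossing prolongs the run of the strand at \<open>i\<close> by one letter.\<close>

lemma canon_step_move:
  assumes "admissible j m ss" "i < m" "i \<in> set ss" "i + 1 \<notin> set ss"
  shows "hcong m (i # canon j ss) (canon j (map (\<lambda>x. if x = i then i + 1 else x) ss))"
  using assms
proof (induction ss arbitrary: j)
  case Nil then show ?case by simp
next
  case (Cons s ss)
  note a = admissible_Cons[OF Cons.prems(1)]
  consider "s < i" | "i = s" using Cons.prems(3) a by force
  then show ?case
  proof cases
    case 1
    have "i \<in> {1..<m}" using 1 a Cons.prems by auto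
    from canon_step_past[OF Cons.prems(1) this 1 Cons.IH[of "j + 1"]] show ?thesis
      using Cons.prems a 1 by auto
  next
    case 2
    have "map (\<lambda>x. if x = i then i + 1 else x) ss = ss" using 2 a by (intro map_idI) auto
    then show ?thesis using 2 a by (simp add: hcong.reflI rev_upt_Suc)
  qed
qed

text \<open>The run of the strand at \<open>i + 1\<close> already begins with the letter
  \<open>i\<close>, so idempotence absorbs the crossing.\<close>

lemma canon_step_stay:
  assumes "admissible j m ss" "j \<le> i" "i < m" "i \<notin> set ss" "i + 1 \<in> set ss"
  shows "hcong m (i # canon j ss) (canon j ss)"
  using assms
proof (induction ss arbitrary: j)
  case Nil then show ?case by simp
next
  case (Cons s ss)
  note a = admissible_Cons[OF Cons.prems(1)]
  consider "s < i" | "i + 1 = s" using Cons.prems(4,5) a by force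
  then show ?case
  proof cases
    case 1
    have "i \<in> {1..<m}" using 1 a Cons.prems by auto
    from canon_step_past[OF Cons.prems(1) this 1 Cons.IH[of "j + 1"]] show ?thesis
      using Cons.prems a 1 by auto
  next
    case 2
    have "hcong m ((i # rev [j..<i + 1]) @ canon (j + 1) ss) (rev [j..<i + 1] @ canon (j + 1) ss)"
      by (rule hcong_right[OF hcong_absorb]) (use a Cons.prems canon_word in auto)
    then show ?thesis using 2 by (simp del: upt_Suc)
  qed
qed

lemma sorted_list_of_set_replace:
  fixes S :: "nat set"
  assumes "finite S" "i \<in> S" "i + 1 \<notin> S"
  shows "sorted_list_of_set (insert (i + 1) (S - {i})) = map (\<lambda>x. if x = i then i + 1 else x) (sorted_list_of_set S)"
proof (rule sorted_list_of_set_unique[THEN iffD1])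
  let ?f = "\<lambda>x. if x = i then i + 1 else x"
  have "?f x < ?f y" if "x \<in> S" "y \<in> S" "x < y" for x y
  proof -
    have "y \<noteq> i + 1" using that assms by auto
    with \<open>x < y\<close> show ?thesis by (simp split: if_splits)
  qed
  then have "sorted_wrt (\<lambda>x y. ?f x < ?f y) (sorted_list_of_set S)"
    by (intro sorted_wrt_mono_rel[OF _ strict_sorted_list_of_set]) (use assms in auto)
  then show "sorted_wrt (<) (map ?f (sorted_list_of_set S)) \<and>
    set (map ?f (sorted_list_of_set S)) = insert (i + 1) (S - {i}) \<and>
    length (map ?f (sorted_list_of_set S)) = card (insert (i + 1) (S - {i}))"
    using assms card_Suc_Diff1[of S i] by (auto simp: sorted_wrt_map)
qed (use assms in simp)

section \<open>An action on subsets of positions that models M(\<alpha>) in one degree\<close>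

section \<open>The shuffle module\<close>

text \<open>\<open>S\<close> is the set of positions of the strands that are not dummies. A strand
  moves over a dummy on its right; two neighbouring strands have the numbers \<open>c\<close> and
  \<open>c + 1\<close> with \<open>c = card (S \<inter> {1..i})\<close>, and their crossing acts
  through \<open>C_\<alpha>\<close>. \<open>None\<close> stands for the zero vector.\<close>

definition set_op :: "nat set \<Rightarrow> nat \<Rightarrow> nat set \<Rightarrow> nat set option"
  where "set_op D i S =
    (if i \<notin> S then Some S
     else if i + 1 \<notin> S then Some (insert (i + 1) (S - {i}))
     else if card (S \<inter> {1..i}) \<in> D then None else Some S)"

abbreviation set_opo :: "nat set \<Rightarrow> nat \<Rightarrow> nat set option \<Rightarrow> nat set option"
  where "set_opo D i x \<equiv> Option.bind x (set_op D i)"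

definition subsets :: "nat \<Rightarrow> nat \<Rightarrow> nat set set"
  where "subsets a m = {S. S \<subseteq> {1..m} \<and> card S = a}"

lemma subsets_finite: "finite (subsets a m)" "S \<in> subsets a m \<Longrightarrow> finite S"
  by (auto simp: subsets_def intro: finite_subset)

lemma set_op_subsets: "i \<in> {1..<m} \<Longrightarrow> S \<in> subsets a m \<Longrightarrow> set_op D i S = Some S' \<Longrightarrow> S' \<in> subsets a m"
  using subsets_finite(2)[of S a m] card_Suc_Diff1[of S i]
  by (auto simp: set_op_def subsets_def card_insert_if split: if_splits)

text \<open>Shifting a strand from \<open>i\<close> to \<open>i + 1\<close> changes the count of
  strands up to \<open>k\<close> only at \<open>k = i\<close>, so the tests against \<open>D\<close>
  made by other generators are unaffected.\<close>

lemma card_move: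
  fixes S :: "nat set"
  assumes "i \<in> S" "i + 1 \<notin> S" "1 \<le> i"
  shows "card (insert (i + 1) (S - {i}) \<inter> {1..k}) = (if k = i then card (S \<inter> {1..k}) - 1 else card (S \<inter> {1..k}))"
proof -
  consider "k < i" | "k = i" | "k > i" by linarith
  then show ?thesis
  proof cases
    case 1
    then have "insert (i + 1) (S - {i}) \<inter> {1..k} = S \<inter> {1..k}" by auto
    then show ?thesis using 1 by simp
  next
    case 2
    then have "insert (i + 1) (S - {i}) \<inter> {1..k} = (S \<inter> {1..k}) - {i}" by auto
    then show ?thesis using 2 assms by simp
  next
    case 3
    then have eq: "insert (i + 1) (S - {i}) \<inter> {1..k} = insert (i + 1) ((S \<inter> {1..k}) - {i})" by auto
    have "card ((S \<inter> {1..k}) - {i}) + 1 = card (S \<inter> {1..k})"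
      using 3 assms card_Suc_Diff1[of "S \<inter> {1..k}" i] by auto
    then show ?thesis using 3 assms unfolding eq by (subst card_insert_disjoint) auto
  qed
qed

lemma card_Int_Suc: "card ((S :: nat set) \<inter> {1..i + 1}) = card (S \<inter> {1..i}) + (if i + 1 \<in> S then 1 else 0)"
proof -
  have "S \<inter> {1..i + 1} = (if i + 1 \<in> S then insert (i + 1) (S \<inter> {1..i}) else S \<inter> {1..i})"
    unfolding Suc_eq_plus1[symmetric] by (auto simp: le_Suc_eq)
  then show ?thesis by simp
qed

lemma set_op_idem: "i \<ge> 1 \<Longrightarrow> set_opo D i (set_op D i S) = set_op D i S"
  by (auto simp: set_op_def)

lemma set_op_comm:
  assumes "1 \<le> i" "1 \<le> j" "\<bar>int i - int j\<bar> > 1"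
  shows "set_opo D i (set_op D j S) = set_opo D j (set_op D i S)"
proof -
  have "i \<noteq> j" "i \<noteq> j + 1" "j \<noteq> i + 1" "i + 1 \<noteq> j + 1" using assms by auto
  then show ?thesis
    using assms(1,2) card_move[of i S j] card_move[of j S i] unfolding set_op_def
    by (auto split: if_splits)
qed

lemma set_op_braid:
  assumes "1 \<le> i"
  shows "set_opo D i (set_opo D (i + 1) (set_op D i S)) = set_opo D (i + 1) (set_opo D i (set_op D (i + 1) S))"
proof -
  have c: "i + 1 + 1 = i + 2" by simp
  let ?S' = "insert (i + 2) (S - {i + 1})"
  have m1: "card (insert (i + 1) (S - {i}) \<inter> {1..i + 1}) = card (S \<inter> {1..i + 1})" if "i \<in> S" "i + 1 \<notin> S"
    using card_move[of i S "i + 1"] that assms by simp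
  have m2: "card (insert (i + 2) (S - {i + 1}) \<inter> {1..i}) = card (S \<inter> {1..i})" if "i + 1 \<in> S" "i + 2 \<notin> S"
    using card_move[of "i + 1" S i] that assms by (simp add: add.assoc)
  \<comment> \<open>The pair of strands at \<open>i\<close>, \<open>i + 1\<close> is carried to
    \<open>i + 1\<close>, \<open>i + 2\<close> without being renumbered, so both sides of the braid
    relation test the same number against \<open>D\<close>.\<close>
  have m3: "card (insert (i + 1) (?S' - {i}) \<inter> {1..i + 1}) = card (S \<inter> {1..i})"
    if "i \<in> S" "i + 1 \<in> S" "i + 2 \<notin> S"
  proof -
    have "card (insert (i + 1) (?S' - {i}) \<inter> {1..i + 1}) = card (?S' \<inter> {1..i + 1})"
      using card_move[of i ?S' "i + 1"] that assms by simp
    also have "\<dots> = card (S \<inter> {1..i + 1}) - 1"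
      using card_move[of "i + 1" S "i + 1"] that assms by (simp add: add.assoc)
    finally show ?thesis using that card_Int_Suc[of S i] by simp
  qed
  have m4: "insert (i + 1) (insert (i + 2) (S - {i + 1}) - {i}) = insert (i + 2) (S - {i})"
    if "i \<in> S" "i + 1 \<in> S" "i + 2 \<notin> S" using that by auto
  show ?thesis
    using assms card_Int_Suc[of S i] m1 m2 m3 m4 unfolding set_op_def c
    by (cases "i \<in> S"; cases "i + 1 \<in> S"; cases "i + 2 \<in> S") (auto simp: insert_commute)
qed

definition osingle :: "'b option \<Rightarrow> 'b \<Rightarrow>\<^sub>0 'a::field"
  where "osingle x = (case x of None \<Rightarrow> 0 | Some b \<Rightarrow> Poly_Mapping.single b 1)"

lemma osingle_simps [simp]: "osingle None = 0" "osingle (Some b) = Poly_Mapping.single b 1"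
  by (simp_all add: osingle_def)

abbreviation set_t :: "nat set \<Rightarrow> nat \<Rightarrow> nat set \<Rightarrow> nat set \<Rightarrow>\<^sub>0 'a::field"
  where "set_t D i S \<equiv> osingle (set_op D i S)"

lemma lin_set_t: "lin (set_t D i) (osingle x) = osingle (set_opo D i x)"
  by (cases x) simp_all

lemma hecke_rep_sets: "hecke_rep m (subsets a m) (set_t D :: nat \<Rightarrow> nat set \<Rightarrow> nat set \<Rightarrow>\<^sub>0 'a::field)"
proof
  show "Poly_Mapping.keys (set_t D i S :: nat set \<Rightarrow>\<^sub>0 'a) \<subseteq> subsets a m" if "i \<in> {1..<m}" "S \<in> subsets a m" for i S
    using set_op_subsets[OF that, of D] by (cases "set_op D i S") auto
  show "lin (set_t D i) (lin (set_t D (i + 1)) (set_t D i b)) =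
      (lin (set_t D (i + 1)) (lin (set_t D i) (set_t D (i + 1) b)) :: nat set \<Rightarrow>\<^sub>0 'a)" if "i \<in> {1..<m}" for i b
    using set_op_braid[of i D b] that unfolding lin_set_t by simp
qed (simp_all add: lin_set_t set_op_idem set_op_comm)

text \<open>An invariant that separates the normal forms: where the strands \<open>1..a\<close> end
  up, or \<open>None\<close> once the character has killed the word.\<close>

definition word_set :: "nat set \<Rightarrow> nat \<Rightarrow> nat list \<Rightarrow> nat set option"
  where "word_set D a w = foldr (set_opo D) w (Some {1..a})"

lemma word_set_hcong:
  assumes "hcong m w w'" "w \<in> gen_words m"
  shows "word_set D a w = word_set D a w'"
  unfolding word_set_def
proof (rule hrel_respects_foldr[OF assms, where C = UNIV])
  fix x
  show "set_opo D i (set_opo D i x) = set_opo D i x" if "i \<in> {1..<m}" for i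
    using that set_op_idem by (cases x) auto
  show "set_opo D i (set_opo D (i + 1) (set_opo D i x)) = set_opo D (i + 1) (set_opo D i (set_opo D (i + 1) x))"
    if "i \<in> {1..<m}" for i
    using that set_op_braid[of i D] by (cases x) auto
  show "set_opo D i (set_opo D j x) = set_opo D j (set_opo D i x)"
    if "i \<in> {1..<m}" "j \<in> {1..<m}" "\<bar>int i - int j\<bar> > 1" for i j
    using that set_op_comm[of i j D] by (cases x) auto
qed auto

lemma word_set_subsets:
  assumes "w \<in> gen_words m" "a \<le> m" "word_set D a w = Some S"
  shows "S \<in> subsets a m"
  using assms
proof (induction w arbitrary: S)
  case Nil then show ?case by (auto simp: word_set_def subsets_def)
next
  case (Cons i w)
  then obtain S' where "word_set D a w = Some S'" "set_op D i S' = Some S"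
    by (auto simp: word_set_def bind_eq_Some_conv)
  then show ?case using Cons by (auto intro: set_op_subsets)
qed

lemma word_set_append_idle: "j > a \<Longrightarrow> word_set D a (w @ [j]) = word_set D a w"
  by (simp add: word_set_def set_op_def)

lemma set_op_interval: "1 \<le> j \<Longrightarrow> j < a \<Longrightarrow> set_op D j {1..a} = (if j \<in> D then None else Some {1..a})"
proof -
  assume "1 \<le> j" "j < a"
  moreover from this have "{1..a} \<inter> {1..j} = {1..j}" by auto
  ultimately show ?thesis by (simp add: set_op_def)
qed

lemma foldr_None: "foldr (set_opo D) w None = None"
  by (induction w) auto

text \<open>On the initial set \<open>{1..a}\<close> a letter \<open>j < a\<close> is tested against
  \<open>D\<close> itself, so words of the smaller algebra act by the character of
  \<open>C_\<alpha>\<close>. This is the balancing relation of the tensor product.\<close>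

lemma word_set_append:
  assumes "w \<in> gen_words a"
  shows "word_set D a (u @ w) = (if set w \<inter> D = {} then word_set D a u else None)"
proof -
  have "foldr (set_opo D) w (Some {1..a}) = (if set w \<inter> D = {} then Some {1..a} else None)"
    using assms by (induction w) (auto simp: set_op_interval)
  then show ?thesis by (simp add: word_set_def foldr_None)
qed

lemma foldr_move:
  assumes "j \<le> s" "j \<in> T" "T \<inter> {j + 1..s} = {}"
  shows "foldr (set_opo D) (rev [j..<s]) (Some T) = Some (insert s (T - {j}))"
  using assms
proof (induction s rule: dec_induct)
  case base then show ?case by auto
next
  case (step s)
  have "T \<inter> {j + 1..s} = {}" using step.prems by fastforce
  with step have "foldr (set_opo D) (rev [j..<s]) (Some T) = Some (insert s (T - {j}))" by blast
  moreover have "set_op D s (insert s (T - {j})) = Some (insert (Suc s) (T - {j}))"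
    using step.prems step.hyps by (auto simp: set_op_def)
  ultimately show ?case using step.hyps by simp
qed

text \<open>The last strand is moved first, so each run passes through free positions only.
  \<open>A\<close> holds the strands below the current index; in the recursion strand
  \<open>j\<close> waits there while the later ones move.\<close>

lemma foldr_canon:
  assumes "admissible j m ss" "A \<subseteq> {1..<j}"
  shows "foldr (set_opo D) (canon j ss) (Some (A \<union> {j..<j + length ss})) = Some (A \<union> set ss)"
  using assms
proof (induction ss arbitrary: j A)
  case Nil then show ?case by simp
next
  case (Cons s ss)
  note a = admissible_Cons[OF Cons.prems(1)]
  have eq: "A \<union> {j..<j + length (s # ss)} = insert j A \<union> {j + 1..<j + 1 + length ss}" by auto
  have "foldr (set_opo D) (canon (j + 1) ss) (Some (A \<union> {j..<j + length (s # ss)})) = Some (insert j A \<union> set ss)"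
    unfolding eq by (rule Cons.IH) (use Cons.prems a in auto)
  moreover have "foldr (set_opo D) (rev [j..<s]) (Some (insert j A \<union> set ss)) = Some (insert s ((insert j A \<union> set ss) - {j}))"
    by (rule foldr_move) (use a Cons.prems in auto)
  moreover have "insert s ((insert j A \<union> set ss) - {j}) = A \<union> set (s # ss)" using a Cons.prems by auto
  ultimately show ?case by simp
qed

abbreviation canon_set :: "nat set \<Rightarrow> nat list"
  where "canon_set S \<equiv> canon 1 (sorted_list_of_set S)"

lemma admissible_set: "S \<in> subsets a m \<Longrightarrow> admissible 1 m (sorted_list_of_set S)"
  using subsets_finite(2)[of S a m] by (auto simp: admissible_def subsets_def)

lemma canon_set_word: "S \<in> subsets a m \<Longrightarrow> canon_set S \<in> gen_words m"
  by (rule canon_word[OF admissible_set])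

lemma word_set_canon: "S \<in> subsets a m \<Longrightarrow> word_set D a (canon_set S) = Some S"
proof -
  assume S: "S \<in> subsets a m"
  have "{1..a} = {1..<1 + a}" by auto
  then show ?thesis
    using foldr_canon[OF admissible_set[OF S], of "{}" D] subsets_finite(2)[OF S] S
    by (simp add: word_set_def subsets_def)
qed

lemma canon_set_interval: "canon_set {1..a} = []"
proof -
  have "canon j [j..<j + k] = []" for j k
  proof (induction k arbitrary: j)
    case (Suc k)
    have "[j..<j + Suc k] = j # [Suc j..<Suc j + k]" using upt_conv_Cons[of j "j + Suc k"] by (simp del: upt_Suc)
    then show ?case using Suc[of "Suc j"] by (simp flip: Suc_eq_plus1 del: upt_Suc)
  qed simp
  moreover have "sorted_list_of_set {1..a} = [1..<1 + a]"
    unfolding Suc_eq_plus1_left[symmetric] by (simp add: atLeastLessThanSuc_atLeastAtMost[symmetric] del: upt_Suc)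
  ultimately show ?thesis by simp
qed

text \<open>Normal forms are closed under left multiplication up to one letter on the right, whose
  effect is known: above \<open>a\<close> it crosses dummies and is trivial in the Hom set, below
  \<open>a\<close> it is a generator of the smaller algebra and acts through
  \<open>C_\<alpha>\<close>.\<close>

lemma canon_set_step:
  assumes S: "S \<in> subsets a m" and i: "i \<in> {1..<m}"
  shows "case set_op D i S of
      None \<Rightarrow> \<exists>j\<in>D \<inter> {1..<a}. hcong m (i # canon_set S) (canon_set S @ [j])
    | Some S' \<Rightarrow> hcong m (i # canon_set S) (canon_set S') \<or>
        (S' = S \<and> (\<exists>j\<in>{a + 1..<m} \<union> ({1..<a} - D). hcong m (i # canon_set S) (canon_set S @ [j])))"
proof -
  let ?ss = "sorted_list_of_set S"
  note adm = admissible_set[OF S]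
  have fin: "finite S" by (rule subsets_finite(2)[OF S])
  have Sm: "S \<subseteq> {1..m}" and card: "card S = a"
    using S by (auto simp: subsets_def)
  have set: "set ?ss = S" using fin by simp
  show ?thesis
  proof (cases "i \<in> S")
    case iS: True
    show ?thesis
    proof (cases "i + 1 \<in> S")
      case True
      have eq: "1 + card {x \<in> S. x < i} = card (S \<inter> {1..i})"
      proof -
        have "S \<inter> {1..i} = insert i {x \<in> S. x < i}" using iS Sm i by auto
        then show ?thesis using fin by simp
      qed
      have hc: "hcong m (i # canon_set S) (canon_set S @ [card (S \<inter> {1..i})])"
        using canon_step_both[OF adm, of i] i iS True unfolding set eq by simp
      have "i + 1 \<notin> S \<inter> {1..i}" by simp
      with True have "S \<inter> {1..i} \<subset> S" by blast
      from psubset_card_mono[OF fin this] have "card (S \<inter> {1..i}) \<in> {1..<a}"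
        using eq by (simp add: card)
      with hc show ?thesis
        by (cases "card (S \<inter> {1..i}) \<in> D") (auto simp: set_op_def iS True simp del: atLeastLessThan_iff)
    next
      case False
      have "hcong m (i # canon_set S) (canon 1 (map (\<lambda>x. if x = i then i + 1 else x) ?ss))"
        by (rule canon_step_move[OF adm]) (use i iS False set in auto)
      then show ?thesis using iS False sorted_list_of_set_replace[OF fin iS False] by (simp add: set_op_def)
    qed
  next
    case iS: False
    show ?thesis
    proof (cases "i + 1 \<in> S")
      case True
      then have "hcong m (i # canon_set S) (canon_set S)"
        using canon_step_stay[OF adm, of i] i iS set by simp
      then show ?thesis using iS by (simp add: set_op_def)
    next
      case False
      let ?j = "i + card {x \<in> S. i < x}"
      have "hcong m (i # canon_set S) (canon_set S @ [?j])"
        using canon_step_none[OF adm, of i] i iS False set by simp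
      \<comment> \<open>At most \<open>i - 1\<close> of the \<open>a\<close> strands lie left of
        \<open>i\<close>, so \<open>i\<close> plus the number of those on its right exceeds
        \<open>a\<close>.\<close>
      moreover have "a < ?j"
      proof -
        have "x < i \<or> i < x" if "x \<in> S" for x using iS that by (metis linorder_neqE_nat)
        then have "S = {x \<in> S. x < i} \<union> {x \<in> S. i < x}" by auto
        then have "card S = card ({x \<in> S. x < i} \<union> {x \<in> S. i < x})" by (rule arg_cong)
        also have "\<dots> = card {x \<in> S. x < i} + card {x \<in> S. i < x}"
        proof (rule card_Un_disjoint)
          show "finite {x \<in> S. x < i}" "finite {x \<in> S. i < x}" using fin by simp_all
          show "{x \<in> S. x < i} \<inter> {x \<in> S. i < x} = {}" by fastforce
        qed
        finally have "card S = card {x \<in> S. x < i} + card {x \<in> S. i < x}" .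
        moreover have "card {x \<in> S. x < i} \<le> card {1..<i}"
          by (rule card_mono) (use Sm in auto)
        moreover have "card {1..<i} + 1 = i" using i by (simp add: le_add_diff_inverse2)
        ultimately show ?thesis using card by linarith
      qed
      \<comment> \<open>The strands right of \<open>i\<close> also avoid \<open>i + 1\<close>, so
        there are at most \<open>m - i - 1\<close> of them.\<close>
      moreover have "?j < m"
      proof -
        have "{x \<in> S. i < x} \<subseteq> {i + 2..m}"
        proof clarify
          fix x assume x: "x \<in> S" "i < x"
          then have "x \<noteq> i + 1" "x \<le> m" using False Sm by auto
          with x show "x \<in> {i + 2..m}" by simp
        qed
        then have "card {x \<in> S. i < x} \<le> m - (i + 1)"
          using card_mono[of "{i + 2..m}" "{x \<in> S. i < x}"] by simp
        then show ?thesis using i by auto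
      qed
      ultimately have "hcong m (i # canon_set S) (canon_set S @ [?j])" "?j \<in> {a + 1..<m}" by auto
      then show ?thesis using iS by (auto simp: set_op_def simp del: atLeastLessThan_iff)
    qed
  qed
qed

section \<open>The first isomorphism theorem, in a form that can be iterated\<close>

section \<open>Quotients as images\<close>

text \<open>A linear surjection onto the space with basis \<open>S\<close>. Dividing by its kernel
  yields a space that is again realized (\<open>realizes_quot\<close>), so the nested quotients in
  \<open>Mk_hmod\<close> are treated by iteration.\<close>

definition realizes :: "('a::field, 'v) module \<Rightarrow> 'b set \<Rightarrow> ('v \<Rightarrow> 'b \<Rightarrow>\<^sub>0 'a) \<Rightarrow> bool"
  where "realizes V S \<Psi> \<longleftrightarrow> module ring_of_type_algebra V \<and>
    \<Psi> ` carrier V = {p. Poly_Mapping.keys p \<subseteq> S} \<and>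
    (\<forall>x\<in>carrier V. \<forall>y\<in>carrier V. \<Psi> (x \<oplus>\<^bsub>V\<^esub> y) = \<Psi> x + \<Psi> y) \<and>
    (\<forall>c. \<forall>x\<in>carrier V. \<Psi> (c \<odot>\<^bsub>V\<^esub> x) = scale c (\<Psi> x))"

definition kernel_of :: "('a::field, 'v) module \<Rightarrow> ('v \<Rightarrow> 'b \<Rightarrow>\<^sub>0 'a) \<Rightarrow> 'v set"
  where "kernel_of V \<Psi> = {x \<in> carrier V. \<Psi> x = 0}"

definition coset_val :: "('v \<Rightarrow> 'w) \<Rightarrow> 'v set \<Rightarrow> 'w"
  where "coset_val \<Psi> C = \<Psi> (SOME x. x \<in> C)"

text \<open>The cosets of the kernel (\<open>coset_fiber\<close>) described as level sets, which
  reduces equality of cosets to equality of values.\<close>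

definition fiber_of :: "('a::field, 'v) module \<Rightarrow> ('v \<Rightarrow> 'w) \<Rightarrow> 'v \<Rightarrow> 'v set"
  where "fiber_of V \<Psi> x = {z \<in> carrier V. \<Psi> z = \<Psi> x}"

context
  fixes V :: "('a::field, 'v) module" and S :: "'b set" and \<Psi> :: "'v \<Rightarrow> 'b \<Rightarrow>\<^sub>0 'a"
  assumes V: "realizes V S \<Psi>"
begin

interpretation V: module ring_of_type_algebra V
  using V by (simp add: realizes_def)

lemma realizes_add: "x \<in> carrier V \<Longrightarrow> y \<in> carrier V \<Longrightarrow> \<Psi> (x \<oplus>\<^bsub>V\<^esub> y) = \<Psi> x + \<Psi> y"
  and realizes_smult: "x \<in> carrier V \<Longrightarrow> \<Psi> (c \<odot>\<^bsub>V\<^esub> x) = scale c (\<Psi> x)"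
  and realizes_image: "\<Psi> ` carrier V = {p. Poly_Mapping.keys p \<subseteq> S}"
  using V by (simp_all add: realizes_def)

lemma realizes_smult_closed: "x \<in> carrier V \<Longrightarrow> c \<odot>\<^bsub>V\<^esub> x \<in> carrier V"
  using V.smult_closed[of c x] by simp

lemma realizes_zero: "\<Psi> \<zero>\<^bsub>V\<^esub> = 0"
  using realizes_add[of "\<zero>\<^bsub>V\<^esub>" "\<zero>\<^bsub>V\<^esub>"] by simp

lemma realizes_minus: "x \<in> carrier V \<Longrightarrow> y \<in> carrier V \<Longrightarrow> \<Psi> (x \<ominus>\<^bsub>V\<^esub> y) = \<Psi> x - \<Psi> y"
proof -
  assume x: "x \<in> carrier V" and y: "y \<in> carrier V"
  have "\<Psi> (\<ominus>\<^bsub>V\<^esub> y) + \<Psi> y = 0"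
    using realizes_add[of "\<ominus>\<^bsub>V\<^esub> y" y] y by (simp add: V.M.l_neg realizes_zero)
  then have "\<Psi> (\<ominus>\<^bsub>V\<^esub> y) = - \<Psi> y" by (simp add: eq_neg_iff_add_eq_0)
  then show ?thesis using x y by (simp add: a_minus_def realizes_add)
qed

lemma minus_add: "x \<in> carrier V \<Longrightarrow> y \<in> carrier V \<Longrightarrow> (x \<ominus>\<^bsub>V\<^esub> y) \<oplus>\<^bsub>V\<^esub> y = x"
  by (simp add: a_minus_def V.M.a_assoc V.M.l_neg)

lemma kernel_submodule: "submodule (kernel_of V \<Psi>) ring_of_type_algebra V"
proof (rule V.submoduleI)
  fix a assume a: "a \<in> kernel_of V \<Psi>"
  then have "\<Psi> (\<zero>\<^bsub>V\<^esub> \<ominus>\<^bsub>V\<^esub> a) = 0" by (simp add: kernel_of_def realizes_minus realizes_zero)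
  then show "\<ominus>\<^bsub>V\<^esub> a \<in> kernel_of V \<Psi>" using a by (simp add: kernel_of_def a_minus_def)
qed (auto simp: kernel_of_def realizes_zero realizes_add realizes_smult)

abbreviation (input) fiber :: "'v \<Rightarrow> 'v set"
  where "fiber \<equiv> fiber_of V \<Psi>"

lemma mem_fiber [simp]: "z \<in> fiber x \<longleftrightarrow> z \<in> carrier V \<and> \<Psi> z = \<Psi> x"
  by (simp add: fiber_of_def)

lemma coset_fiber:
  assumes "x \<in> carrier V"
  shows "kernel_of V \<Psi> +>\<^bsub>V\<^esub> x = fiber x"
proof (intro equalityI subsetI)
  fix z assume z: "z \<in> fiber x"
  then have "z \<ominus>\<^bsub>V\<^esub> x \<in> kernel_of V \<Psi>" using assms by (simp add: kernel_of_def realizes_minus)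
  moreover have "z = (z \<ominus>\<^bsub>V\<^esub> x) \<oplus>\<^bsub>V\<^esub> x" using z assms by (simp add: minus_add)
  ultimately show "z \<in> kernel_of V \<Psi> +>\<^bsub>V\<^esub> x" unfolding a_r_coset_def' by blast
qed (use assms in \<open>auto simp: a_r_coset_def' kernel_of_def realizes_add\<close>)

abbreviation (input) ker_quot :: "('a, 'v set) module"
  where "ker_quot \<equiv> quot_module V (kernel_of V \<Psi>)"

lemma quot_carrier: "carrier ker_quot = fiber ` carrier V"
  unfolding quot_module_def A_RCOSETS_def' using coset_fiber by auto

lemma coset_val_fiber: "x \<in> carrier V \<Longrightarrow> coset_val \<Psi> (fiber x) = \<Psi> x"
  unfolding coset_val_def using someI[of "\<lambda>z. z \<in> fiber x" x] by simp

lemma quot_add: "x \<in> carrier V \<Longrightarrow> y \<in> carrier V \<Longrightarrow> fiber x \<oplus>\<^bsub>ker_quot\<^esub> fiber y = fiber (x \<oplus>\<^bsub>V\<^esub> y)"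
proof -
  assume x: "x \<in> carrier V" and y: "y \<in> carrier V"
  have "fiber x <+>\<^bsub>V\<^esub> fiber y = fiber (x \<oplus>\<^bsub>V\<^esub> y)"
  proof (intro equalityI subsetI)
    fix z assume z: "z \<in> fiber (x \<oplus>\<^bsub>V\<^esub> y)"
    have 1: "z = x \<oplus>\<^bsub>V\<^esub> (z \<ominus>\<^bsub>V\<^esub> x)" using z x by (simp add: minus_add V.M.a_comm[of x])
    have 2: "z \<ominus>\<^bsub>V\<^esub> x \<in> fiber y" using x y z by (simp add: realizes_minus realizes_add)
    have 3: "x \<in> fiber x" using x by simp
    show "z \<in> fiber x <+>\<^bsub>V\<^esub> fiber y"
      unfolding set_add_def' by (rule UN_I[OF 3], rule UN_I[OF 2]) (use 1 in simp)
  qed (use x y in \<open>auto simp: set_add_def' realizes_add\<close>)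
  then show ?thesis by (simp add: quot_module_def)
qed

lemma quot_smult: "x \<in> carrier V \<Longrightarrow> c \<odot>\<^bsub>ker_quot\<^esub> fiber x = fiber (c \<odot>\<^bsub>V\<^esub> x)"
proof -
  assume x: "x \<in> carrier V"
  have "kernel_of V \<Psi> +>\<^bsub>V\<^esub> (c \<odot>\<^bsub>V\<^esub> z) = fiber (c \<odot>\<^bsub>V\<^esub> x)" if "z \<in> fiber x" for z
    using that x by (simp add: coset_fiber realizes_smult_closed realizes_smult fiber_of_def)
  moreover have "x \<in> fiber x" using x by simp
  ultimately have "(\<Union>z\<in>fiber x. kernel_of V \<Psi> +>\<^bsub>V\<^esub> (c \<odot>\<^bsub>V\<^esub> z)) = fiber (c \<odot>\<^bsub>V\<^esub> x)"
    by blast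
  then show ?thesis by (simp add: quot_module_def)
qed

lemma quot_zero: "\<zero>\<^bsub>ker_quot\<^esub> = fiber \<zero>\<^bsub>V\<^esub>"
  by (auto simp: quot_module_def kernel_of_def realizes_zero)

lemma fiber_cong: "\<Psi> x = \<Psi> y \<Longrightarrow> fiber x = fiber y"
  by (simp add: fiber_of_def)

lemma realizes_quot: "realizes ker_quot S (coset_val \<Psi>)"
  unfolding realizes_def
proof (intro conjI)
  show "module ring_of_type_algebra ker_quot"
  proof (rule moduleI)
    show "cring (ring_of_type_algebra :: 'a ring)" by (rule cring_from_type_algebra)
    show "abelian_group ker_quot"
    proof (rule abelian_groupI)
      fix C assume "C \<in> carrier ker_quot"
      then obtain x where x: "x \<in> carrier V" "C = fiber x" by (auto simp: quot_carrier)
      then show "\<exists>y\<in>carrier ker_quot. y \<oplus>\<^bsub>ker_quot\<^esub> C = \<zero>\<^bsub>ker_quot\<^esub>"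
        by (intro bexI[of _ "fiber (\<ominus>\<^bsub>V\<^esub> x)"])
          (use quot_add[of "\<ominus>\<^bsub>V\<^esub> x" x] in \<open>simp_all add: quot_zero V.M.l_neg quot_carrier\<close>)
    next
      show "C \<oplus>\<^bsub>ker_quot\<^esub> D \<in> carrier ker_quot" if "C \<in> carrier ker_quot" "D \<in> carrier ker_quot" for C D
        using that by (auto simp: quot_carrier quot_add)
      show "\<zero>\<^bsub>ker_quot\<^esub> \<in> carrier ker_quot" by (simp add: quot_zero quot_carrier)
      show "C \<oplus>\<^bsub>ker_quot\<^esub> D \<oplus>\<^bsub>ker_quot\<^esub> E = C \<oplus>\<^bsub>ker_quot\<^esub> (D \<oplus>\<^bsub>ker_quot\<^esub> E)" if "C \<in> carrier ker_quot" "D \<in> carrier ker_quot" "E \<in> carrier ker_quot" for C D E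
        using that by (auto simp: quot_carrier quot_add V.M.a_assoc)
      show "C \<oplus>\<^bsub>ker_quot\<^esub> D = D \<oplus>\<^bsub>ker_quot\<^esub> C" if "C \<in> carrier ker_quot" "D \<in> carrier ker_quot" for C D
        using that by (auto simp: quot_carrier quot_add V.M.a_comm)
      show "\<zero>\<^bsub>ker_quot\<^esub> \<oplus>\<^bsub>ker_quot\<^esub> C = C" if "C \<in> carrier ker_quot" for C
        using that by (auto simp: quot_carrier quot_zero quot_add)
    qed
  next
    fix a b :: 'a and C assume "C \<in> carrier ker_quot"
    then obtain x where x: "x \<in> carrier V" and C: "C = fiber x" by (auto simp: quot_carrier)
    show "a \<odot>\<^bsub>ker_quot\<^esub> C \<in> carrier ker_quot"
      using x by (simp add: C quot_carrier quot_smult realizes_smult_closed)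
    show "(a \<oplus>\<^bsub>ring_of_type_algebra\<^esub> b) \<odot>\<^bsub>ker_quot\<^esub> C = a \<odot>\<^bsub>ker_quot\<^esub> C \<oplus>\<^bsub>ker_quot\<^esub> b \<odot>\<^bsub>ker_quot\<^esub> C"
      using x unfolding C by (simp only: quot_smult quot_add realizes_smult_closed)
        (intro fiber_cong, simp add: realizes_smult realizes_add realizes_smult_closed scale_add_left)
    show "(a \<otimes>\<^bsub>ring_of_type_algebra\<^esub> b) \<odot>\<^bsub>ker_quot\<^esub> C = a \<odot>\<^bsub>ker_quot\<^esub> (b \<odot>\<^bsub>ker_quot\<^esub> C)"
      using x unfolding C by (simp only: quot_smult realizes_smult_closed)
        (intro fiber_cong, simp add: realizes_smult realizes_smult_closed scale_scale)
    show "\<one>\<^bsub>ring_of_type_algebra\<^esub> \<odot>\<^bsub>ker_quot\<^esub> C = C"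
      using x unfolding C by (simp only: quot_smult)
        (intro fiber_cong, simp add: realizes_smult)
    fix D assume "D \<in> carrier ker_quot"
    then obtain y where y: "y \<in> carrier V" and D: "D = fiber y" by (auto simp: quot_carrier)
    show "a \<odot>\<^bsub>ker_quot\<^esub> (C \<oplus>\<^bsub>ker_quot\<^esub> D) = a \<odot>\<^bsub>ker_quot\<^esub> C \<oplus>\<^bsub>ker_quot\<^esub> a \<odot>\<^bsub>ker_quot\<^esub> D"
      using x y unfolding C D by (simp only: quot_smult quot_add realizes_smult_closed V.M.a_closed)
        (intro fiber_cong, simp add: realizes_smult realizes_add realizes_smult_closed scale_add)
  qed
  show "coset_val \<Psi> ` carrier ker_quot = {p. Poly_Mapping.keys p \<subseteq> S}"
    using realizes_image coset_val_fiber unfolding quot_carrier by (simp add: image_image cong: image_cong)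
  show "\<forall>C\<in>carrier ker_quot. \<forall>D\<in>carrier ker_quot. coset_val \<Psi> (C \<oplus>\<^bsub>ker_quot\<^esub> D) = coset_val \<Psi> C + coset_val \<Psi> D"
    unfolding quot_carrier by (simp add: quot_add coset_val_fiber realizes_add)
  show "\<forall>c. \<forall>C\<in>carrier ker_quot. coset_val \<Psi> (c \<odot>\<^bsub>ker_quot\<^esub> C) = scale c (coset_val \<Psi> C)"
    unfolding quot_carrier by (simp add: quot_smult coset_val_fiber realizes_smult realizes_smult_closed)
qed

lemma coset_val_inj: "inj_on (coset_val \<Psi>) (carrier ker_quot)"
  by (rule inj_onI) (auto simp: quot_carrier coset_val_fiber)

text \<open>After one quotient the zero submodule is itself a kernel; thus the submodule in
  \<open>Mk_sub\<close> for \<open>k = int (sum_list \<alpha>)\<close> fits the same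
  pattern.\<close>

lemma quot_zero_kernel: "kernel_of ker_quot (coset_val \<Psi>) = {\<zero>\<^bsub>ker_quot\<^esub>}"
proof -
  have "C = \<zero>\<^bsub>ker_quot\<^esub>" if "C \<in> carrier ker_quot" "coset_val \<Psi> C = 0" for C
    using that by (auto simp: quot_carrier quot_zero coset_val_fiber realizes_zero)
  moreover have "\<zero>\<^bsub>ker_quot\<^esub> \<in> carrier ker_quot"
    unfolding quot_zero quot_carrier by (rule imageI) simp
  moreover have "coset_val \<Psi> \<zero>\<^bsub>ker_quot\<^esub> = 0"
    unfolding quot_zero by (simp only: coset_val_fiber V.M.zero_closed realizes_zero)
  ultimately show ?thesis unfolding kernel_of_def by blast
qed

text \<open>An operator intertwined with some \<open>G\<close> on values maps level sets into level
  sets, hence passes to the quotient.\<close>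

lemma quot_map_realizes:
  assumes "\<And>x. x \<in> carrier V \<Longrightarrow> f x \<in> carrier V" "\<And>x. x \<in> carrier V \<Longrightarrow> \<Psi> (f x) = G (\<Psi> x)" "C \<in> carrier ker_quot"
  shows "quot_map V (kernel_of V \<Psi>) f C \<in> carrier ker_quot"
    and "coset_val \<Psi> (quot_map V (kernel_of V \<Psi>) f C) = G (coset_val \<Psi> C)"
proof -
  obtain x where x: "x \<in> carrier V" "C = fiber x" using assms(3) by (auto simp: quot_carrier)
  have "kernel_of V \<Psi> +>\<^bsub>V\<^esub> f z = fiber (f x)" if "z \<in> fiber x" for z
    using that x assms by (simp add: coset_fiber fiber_of_def)
  moreover have "x \<in> fiber x" using x by simp
  ultimately have *: "quot_map V (kernel_of V \<Psi>) f C = fiber (f x)"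
    unfolding quot_map_def x(2) by blast
  show "quot_map V (kernel_of V \<Psi>) f C \<in> carrier ker_quot"
    unfolding * quot_carrier using assms(1) x(1) by blast
  show "coset_val \<Psi> (quot_map V (kernel_of V \<Psi>) f C) = G (coset_val \<Psi> C)"
    unfolding * unfolding x(2)
    by (simp only: coset_val_fiber[OF assms(1)[OF x(1)]] coset_val_fiber[OF x(1)] assms(2)[OF x(1)])
qed

end

section \<open>Hom sets and composition computed on words\<close>

section \<open>Morphisms of the 0-Hecke category as words\<close>

text \<open>Equality in \<open>Hom a m\<close> seen on words (\<open>hom_word_eq_iff\<close>): the
  congruence together with dummy crossings at the source end.\<close>

inductive wrel :: "nat \<Rightarrow> nat \<Rightarrow> nat list \<Rightarrow> nat list \<Rightarrow> bool" for a m where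
  hc: "hcong m u v \<Longrightarrow> u \<in> gen_words m \<Longrightarrow> wrel a m u v"
| idle: "u \<in> gen_words m \<Longrightarrow> j \<in> {a + 1..<m} \<Longrightarrow> wrel a m u (u @ [j])"
| symI: "wrel a m u v \<Longrightarrow> wrel a m v u"
| transI: "wrel a m u v \<Longrightarrow> wrel a m v w \<Longrightarrow> wrel a m u w"

lemma wrel_words: "wrel a m u v \<Longrightarrow> u \<in> gen_words m \<and> v \<in> gen_words m"
  by (induction rule: wrel.induct) (auto simp: hcong_words[THEN iffD1])

lemma wrel_left: "wrel a m u v \<Longrightarrow> w \<in> gen_words m \<Longrightarrow> wrel a m (w @ u) (w @ v)"
proof (induction rule: wrel.induct)
  case (hc u v) then show ?case by (intro wrel.hc hcong_left) auto
next
  case (idle u j) then show ?case using wrel.idle[of "w @ u" m j a] by auto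
qed (auto intro: wrel.symI wrel.transI)

text \<open>The letters of \<open>w\<close> are at most \<open>a - 1\<close> and dummy crossings at
  least \<open>a + 1\<close>, so they commute and a dummy crossing can be kept at the right end.
  Composition with endomorphisms of the source is therefore well defined.\<close>

lemma wrel_right:
  assumes "wrel a m u v" "w \<in> gen_words a" "a \<le> m"
  shows "wrel a m (u @ w) (v @ w)"
  using assms(1)
proof (induction rule: wrel.induct)
  have w: "w \<in> gen_words m" using assms by auto
  {
    case (hc u v) then show ?case using w by (intro wrel.hc hcong_right) auto
  next
    case (idle u j)
    have "hcong m (u @ (w @ [j])) (u @ (j # w))"
      by (rule hcong_left[OF hcong.symI[OF hcong_commute]]) (use idle assms(2) w in auto)
    then have "wrel a m ((u @ w) @ [j]) ((u @ [j]) @ w)"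
      using idle w by (intro wrel.hc) auto
    moreover have "wrel a m (u @ w) ((u @ w) @ [j])" using idle w by (intro wrel.idle) auto
    ultimately show ?case by (rule wrel.transI[rotated])
  }
qed (auto intro: wrel.symI wrel.transI)

definition hom_word :: "nat \<Rightarrow> nat \<Rightarrow> nat list \<Rightarrow> 'a::field morph"
  where "hom_word a m w = hom_class a m (pi_word m w)"

lemma hom_rel_wrel:
  assumes "wrel a m u v"
  shows "(pi_word m u, pi_word m v) \<in> (hom_rel a m :: ('a::field hecke \<times> 'a hecke) set)"
  using assms
proof (induction rule: wrel.induct)
  case (hc u v)
  then have "(pi_word m u :: 'a hecke) = pi_word m v" using pi_word_eq_iff hcong_words by blast
  then show ?case by (simp add: hom_rel_def Let_def)
next
  case (idle u j)
  have "pi_word m (u @ [j]) = (pi_word m u \<otimes>\<^bsub>hecke m\<^esub> pi_word m [j] :: 'a hecke)"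
    using idle by (subst pi_word_mult) auto
  then show ?case using idle unfolding hom_rel_def Let_def hecke_monoid_def
    by (intro r_into_rtrancl) auto
next
  case (symI u v)
  from symI.IH show ?case unfolding hom_rel_def Let_def
    by (rule symD[OF sym_rtrancl[OF sym_Un_converse]])
next
  case (transI u v w)
  from transI.IH show ?case unfolding hom_rel_def Let_def by (rule rtrancl_trans)
qed

text \<open>Each step of the generated relation stays in \<open>hecke_monoid m\<close> and lifts to
  words; a backward step uses that equal monomials come from congruent words.\<close>

lemma hom_rel_words:
  assumes "(pi_word m u, y) \<in> (hom_rel a m :: ('a::field hecke \<times> 'a hecke) set)" "u \<in> gen_words m"
  shows "\<exists>v. wrel a m u v \<and> y = pi_word m v"
  using assms(1) unfolding hom_rel_def Let_def
proof (induction rule: rtrancl_induct)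
  case base
  then show ?case using assms(2) wrel.hc[OF hcong.reflI] by blast
next
  case (step y z)
  obtain v where v: "wrel a m u v" "y = pi_word m v" using step.IH by blast
  have vw: "v \<in> gen_words m" using wrel_words v by blast
  from step.hyps(2) consider (fwd) j where "j \<in> {a + 1..<m}" "z = y \<otimes>\<^bsub>hecke m\<^esub> pi_word m [j]"
    | (bwd) w j where "w \<in> gen_words m" "z = pi_word m w" "j \<in> {a + 1..<m}" "y = z \<otimes>\<^bsub>hecke m\<^esub> pi_word m [j]"
    unfolding hecke_monoid_def by blast
  then show ?case
  proof cases
    case fwd
    then have "z = pi_word m (v @ [j])" using v vw by (subst pi_word_mult[symmetric]) auto
    then show ?thesis using wrel.transI[OF v(1) wrel.idle[OF vw fwd(1)]] by blast
  next
    case bwd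
    have j: "[j] \<in> gen_words m" using bwd by auto
    have "pi_word m v = (pi_word m (w @ [j]) :: 'a hecke)"
      using bwd v pi_word_mult[OF bwd(1) j] by simp
    then have "hcong m (w @ [j]) v"
      using pi_word_eq_iff[where 'a = 'a, of "w @ [j]" m v] bwd(1) j vw by simp
    then have "wrel a m (w @ [j]) v" using bwd(1) j by (intro wrel.hc) auto
    then have "wrel a m w v" using wrel.transI[OF wrel.idle[OF bwd(1,3)]] by blast
    then show ?thesis using bwd(2) wrel.transI[OF v(1) wrel.symI] by blast
  qed
qed

lemma hom_word_eq:
  assumes "u \<in> gen_words m"
  shows "hom_word a m u = pi_word m ` {v. wrel a m u v}"
  unfolding hom_word_def hom_class_def using hom_rel_words[OF _ assms] hom_rel_wrel by auto

lemma hom_word_eq_iff: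
  assumes "u \<in> gen_words m" "v \<in> gen_words m"
  shows "(hom_word a m u :: 'a::field morph) = hom_word a m v \<longleftrightarrow> wrel a m u v"
proof
  assume "(hom_word a m u :: 'a morph) = hom_word a m v"
  moreover have "pi_word m v \<in> (hom_word a m v :: 'a morph)"
    unfolding hom_word_eq[OF assms(2)] using wrel.hc[OF hcong.reflI assms(2)] by blast
  ultimately obtain w where w: "(pi_word m v :: 'a hecke) = pi_word m w" "wrel a m u w"
    unfolding hom_word_eq[OF assms(1)] by blast
  then have "hcong m v w" using pi_word_eq_iff assms wrel_words by blast
  then have "wrel a m v w" using assms by (intro wrel.hc)
  then show "wrel a m u v" using w(2) wrel.symI wrel.transI by blast
next
  assume "wrel a m u v"
  then have "{w. wrel a m u w} = {w. wrel a m v w}" using wrel.symI wrel.transI by blast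
  then show "(hom_word a m u :: 'a morph) = hom_word a m v"
    unfolding hom_word_eq[OF assms(1)] hom_word_eq[OF assms(2)] by simp
qed

lemma Hom_words: "a \<le> m \<Longrightarrow> Hom a m = hom_word a m ` gen_words m"
  unfolding Hom_def quotient_def hecke_monoid_def hom_word_def[abs_def] hom_class_def by auto

lemma hecke_incl_pi_word:
  assumes "w \<in> gen_words a" "a \<le> m"
  shows "hecke_incl m (pi_word a w) = (pi_word m w :: 'a::field hecke)"
proof -
  have "hcoset m x = pi_word m w" if "x \<in> (pi_word a w :: 'a hecke)" for x
    using that hecke_ideal_mono[OF assms(2)] unfolding pi_word_def mem_hcoset hcoset_eq_iff by blast
  moreover have "word_monom w \<in> (pi_word a w :: 'a hecke)"
    by (simp add: pi_word_def mem_hcoset hecke_ideal_closed)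
  ultimately show ?thesis unfolding hecke_incl_def quot_map_def by blast
qed

lemma hom_word_endo:
  assumes "w \<in> gen_words m"
  shows "hom_word m m w = {pi_word m w :: 'a::field hecke}"
proof -
  have "hcong m u v" if "wrel m m u v" for u v
    using that by (induction rule: wrel.induct) (auto intro: hcong.symI hcong.transI)
  then have "pi_word m ` {v. wrel m m w v} = {pi_word m w :: 'a hecke}"
    using pi_word_eq_iff wrel.hc[OF hcong.reflI assms] assms hcong_words by blast
  then show ?thesis by (simp add: hom_word_eq[OF assms])
qed

text \<open>\<open>hcomp\<close> is a union over representatives. The family is constant by
  \<open>wrel_right\<close>, so the union is a single class.\<close>

lemma hcomp_right:
  assumes "u \<in> gen_words m" "w \<in> gen_words a" "a \<le> m"
  shows "hcomp a a m (hom_word a m u) (hom_word a a w) = (hom_word a m (u @ w) :: 'a::field morph)"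
proof -
  have wm: "w \<in> gen_words m" using assms by auto
  have "hcomp a a m (hom_word a m u) (hom_word a a w) =
    (\<Union>v\<in>{v. wrel a m u v}. hom_class a m (pi_word m v \<otimes>\<^bsub>hecke m\<^esub> pi_word m w) :: 'a morph)"
    unfolding hcomp_def hom_word_endo[OF assms(2)] hom_word_eq[OF assms(1)]
    by (simp add: hecke_incl_pi_word[OF assms(2,3)])
  moreover have "hom_class a m (pi_word m v \<otimes>\<^bsub>hecke m\<^esub> pi_word m w) = (hom_word a m (u @ w) :: 'a morph)"
    if v: "wrel a m u v" for v
  proof -
    have vm: "v \<in> gen_words m" using wrel_words[OF v] by blast
    have "hom_word a m (v @ w) = (hom_word a m (u @ w) :: 'a morph)"
      by (subst hom_word_eq_iff) (use wrel_right[OF wrel.symI[OF v] assms(2,3)] vm wm assms in auto)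
    then show ?thesis by (simp add: pi_word_mult[OF vm wm] hom_word_def)
  qed
  moreover have "wrel a m u u" by (rule wrel.hc[OF hcong.reflI assms(1)])
  ultimately show ?thesis by blast
qed

lemma hcomp_left:
  assumes "w \<in> gen_words m" "u \<in> gen_words m"
  shows "hcomp a m m (hom_word m m w) (hom_word a m u) = (hom_word a m (w @ u) :: 'a::field morph)"
proof -
  have "hcomp a m m (hom_word m m w) (hom_word a m u) =
    (\<Union>v\<in>{v. wrel a m u v}. hom_class a m (pi_word m w \<otimes>\<^bsub>hecke m\<^esub> hecke_incl m (pi_word m v)) :: 'a morph)"
    unfolding hcomp_def hom_word_endo[OF assms(1)] hom_word_eq[OF assms(2)] by simp
  moreover have "hom_class a m (pi_word m w \<otimes>\<^bsub>hecke m\<^esub> hecke_incl m (pi_word m v)) = (hom_word a m (w @ u) :: 'a morph)"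
    if v: "wrel a m u v" for v
  proof -
    have vm: "v \<in> gen_words m" using wrel_words[OF v] by blast
    have "hom_word a m (w @ v) = (hom_word a m (w @ u) :: 'a morph)"
      by (subst hom_word_eq_iff) (use wrel_left[OF wrel.symI[OF v] assms(1)] vm assms in auto)
    then show ?thesis by (simp add: hecke_incl_pi_word[OF vm] pi_word_mult[OF assms(1) vm] hom_word_def)
  qed
  moreover have "wrel a m u u" by (rule wrel.hc[OF hcong.reflI assms(2)])
  ultimately show ?thesis by blast
qed

section \<open>The tensor product has a basis of subsets\<close>

section \<open>The modules \<open>M(\<alpha>)\<close>\<close>

lemma wrel_word_set:
  assumes "wrel a m u v"
  shows "word_set D a u = word_set D a v"
  using assms by (induction rule: wrel.induct) (auto simp: word_set_append_idle word_set_hcong)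

definition hom_vec :: "nat set \<Rightarrow> nat \<Rightarrow> nat \<Rightarrow> 'a::field morph \<Rightarrow> nat set \<Rightarrow>\<^sub>0 'a"
  where "hom_vec D a m F = osingle (word_set D a (SOME u. u \<in> gen_words m \<and> F = hom_word a m u))"

lemma hom_vec_word:
  assumes "u \<in> gen_words m"
  shows "hom_vec D a m (hom_word a m u :: 'a::field morph) = osingle (word_set D a u)"
proof -
  let ?v = "SOME v. v \<in> gen_words m \<and> (hom_word a m u :: 'a morph) = hom_word a m v"
  have v: "?v \<in> gen_words m \<and> (hom_word a m u :: 'a morph) = hom_word a m ?v"
    by (rule someI[of _ u]) (use assms in simp)
  then have "wrel a m u ?v" using hom_word_eq_iff assms by blast
  then have "word_set D a u = word_set D a ?v" by (rule wrel_word_set)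
  then show ?thesis unfolding hom_vec_def by (simp only:)
qed

text \<open>The character through which the free algebra acts on \<open>C_\<alpha>\<close>: a word
  counts 1 unless it contains a letter of \<open>D\<close>.\<close>

definition letter_char :: "nat set \<Rightarrow> (nat list \<Rightarrow>\<^sub>0 'a::field) \<Rightarrow> 'a"
  where "letter_char D p = (\<Sum>w\<in>Poly_Mapping.keys p. Poly_Mapping.lookup p w * (if set w \<inter> D = {} then 1 else 0))"

lemma map_const_zero [simp]: "Poly_Mapping.map (\<lambda>_. 0) p = 0"
  by (rule poly_mapping_eqI) (simp add: Poly_Mapping.map.rep_eq)

lemma lin_letter_char: "lin (\<lambda>w. if set w \<inter> D = {} then v else 0) p = scale (letter_char D p) v"
proof -
  have "lin (\<lambda>w. if set w \<inter> D = {} then v else 0) p =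
    (\<Sum>w\<in>Poly_Mapping.keys p. scale (Poly_Mapping.lookup p w * (if set w \<inter> D = {} then 1 else 0)) v)"
    unfolding lin_def by (rule sum.cong) auto
  also have "\<dots> = scale (letter_char D p) v"
    unfolding letter_char_def by (induction rule: finite_induct[OF finite_keys]) (simp_all add: scale_add_left)
  finally show ?thesis .
qed

lemma C_mod_simps:
  fixes x y :: "'a::field"
  shows "carrier (C_mod \<alpha>) = (UNIV :: 'a set)" "x \<oplus>\<^bsub>C_mod \<alpha>\<^esub> y = x + y"
  "h \<odot>\<^bsub>C_mod \<alpha>\<^esub> y = letter_char (descent_set \<alpha>) (hrep h) * y"
proof -
  show "carrier (C_mod \<alpha>) = (UNIV :: 'a set)" "x \<oplus>\<^bsub>C_mod \<alpha>\<^esub> y = x + y"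
    by (simp_all add: C_mod_def hecke_module_def line_def)
  have "abelian_group (line :: ('a, 'a) module)"
  proof (rule abelian_groupI)
    fix x :: 'a assume "x \<in> carrier line"
    show "\<exists>y\<in>carrier line. y \<oplus>\<^bsub>line\<^esub> x = \<zero>\<^bsub>line\<^esub>"
      by (intro bexI[of _ "- x"]) (simp_all add: line_def)
  qed (simp_all add: line_def add_ac)
  then have ab: "abelian_monoid (line :: ('a, 'a) module)" by (rule abelian_group.axioms(1))
  have f: "foldr (\<lambda>i v. if i \<in> D then 0 else v) w y = (if set w \<inter> D = {} then y else 0)" for D w
    by (induction w) auto
  have "h \<odot>\<^bsub>C_mod \<alpha>\<^esub> y = (\<Oplus>\<^bsub>line\<^esub>w\<in>Poly_Mapping.keys (hrep h).
      Poly_Mapping.lookup (hrep h) w * (if set w \<inter> descent_set \<alpha> = {} then y else 0))"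
    by (simp add: C_mod_def hecke_module_def hrep_def Let_def f) (simp add: line_def)
  also have "\<dots> = (\<Sum>w\<in>Poly_Mapping.keys (hrep h).
      Poly_Mapping.lookup (hrep h) w * (if set w \<inter> descent_set \<alpha> = {} then y else 0))"
    by (rule finsum_eq_sum[OF ab]) (simp_all add: line_def)
  also have "\<dots> = letter_char (descent_set \<alpha>) (hrep h) * y"
    unfolding letter_char_def sum_distrib_right by (rule sum.cong) auto
  finally show "h \<odot>\<^bsub>C_mod \<alpha>\<^esub> y = letter_char (descent_set \<alpha>) (hrep h) * y" .
qed

text \<open>The coefficient \<open>c\<close> allows the empty word to stand for a scalar of the
  algebra, as used in \<open>tens_scalar\<close>.\<close>

lemma letter_char_hcoset:
  assumes "w \<in> gen_words a"
  shows "letter_char D (hrep (hcoset a (Poly_Mapping.single w c))) = (if set w \<inter> D = {} then c else 0 :: 'a::field)"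
proof -
  define F :: "nat list \<Rightarrow> nat \<Rightarrow>\<^sub>0 'a" where "F w = (if set w \<inter> D = {} then Poly_Mapping.single 0 1 else 0)" for w
  have "F w = F w'" if "hcong a w w'" for w w'
    by (rule hcong_respects[OF that]) (auto simp: F_def elim!: hrel.cases)
  then have "lin F (hrep (hcoset a (Poly_Mapping.single w c))) = lin F (Poly_Mapping.single w c)"
    by (intro lin_hrep) (use assms in simp)
  then have "scale (letter_char D (hrep (hcoset a (Poly_Mapping.single w c)))) (Poly_Mapping.single 0 1) = scale c (F w)"
    unfolding F_def lin_letter_char[symmetric] by simp
  then have "Poly_Mapping.lookup (scale (letter_char D (hrep (hcoset a (Poly_Mapping.single w c)))) (Poly_Mapping.single 0 1)) (0::nat)
      = Poly_Mapping.lookup (scale c (F w)) 0" by (simp only:)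
  then show ?thesis by (simp add: F_def split: if_splits)
qed

lemma hom_ract_lin:
  "hom_ract a m x h = lin (\<lambda>g. lin (\<lambda>w. Poly_Mapping.single (hcomp a a m g (hom_word a a w)) 1) (hrep h)) x"
  by (simp add: hom_ract_def Let_def hrep_def lin_def scale_sum hom_word_def)

lemma hom_lact_lin: "hom_lact a m l f x = lin (\<lambda>g. Poly_Mapping.single (hcomp a m l f g) 1) x"
  by (simp add: hom_lact_def lin_def)

context
  fixes \<alpha> :: "nat list" and m :: nat
  assumes le: "sum_list \<alpha> \<le> m"
begin

abbreviation (input) sz :: nat where "sz \<equiv> sum_list \<alpha>"
abbreviation (input) ds :: "nat set" where "ds \<equiv> descent_set \<alpha>"

lemma Hom_cases:
  assumes "F \<in> Hom sz m"
  obtains u where "u \<in> gen_words m" "F = (hom_word sz m u :: 'a::field morph)"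
  using assms Hom_words[OF le] by blast

lemma hom_word_Hom: "u \<in> gen_words m \<Longrightarrow> hom_word sz m u \<in> Hom sz m"
  using Hom_words[OF le] by blast

lemma keys_hom_vec: "F \<in> Hom sz m \<Longrightarrow> Poly_Mapping.keys (hom_vec ds sz m F) \<subseteq> subsets sz m"
proof -
  assume "F \<in> Hom sz m"
  then obtain u where u: "u \<in> gen_words m" "F = hom_word sz m u" by (rule Hom_cases)
  show ?thesis
    using word_set_subsets[OF u(1) le, of ds] u by (cases "word_set ds sz u") (simp_all add: hom_vec_word)
qed

lemma hom_vec_right:
  "F \<in> Hom sz m \<Longrightarrow> w \<in> gen_words sz \<Longrightarrow>
    hom_vec ds sz m (hcomp sz sz m F (hom_word sz sz w)) = (if set w \<inter> ds = {} then hom_vec ds sz m F else 0)"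
proof -
  assume "F \<in> Hom sz m" and w: "w \<in> gen_words sz"
  then obtain u where u: "u \<in> gen_words m" "F = hom_word sz m u" by (elim Hom_cases)
  have "u @ w \<in> gen_words m" using u w le by auto
  then show ?thesis using u w le by (simp add: hcomp_right hom_vec_word word_set_append)
qed

lemma hom_vec_left:
  "F \<in> Hom sz m \<Longrightarrow> i \<in> {1..<m} \<Longrightarrow>
    hom_vec ds sz m (hcomp sz m m (hom_word m m [i]) F) = lin (set_t ds i) (hom_vec ds sz m F)"
proof -
  assume "F \<in> Hom sz m" and i: "i \<in> {1..<m}"
  then obtain u where u: "u \<in> gen_words m" "F = hom_word sz m u" by (elim Hom_cases)
  have "i # u \<in> gen_words m" using u i by auto
  then show ?thesis using u i by (simp add: hcomp_left hom_vec_word lin_set_t word_set_def)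
qed

lemma keys_hom_ract:
  fixes x :: "'a::field morph \<Rightarrow>\<^sub>0 'a"
  assumes "Poly_Mapping.keys x \<subseteq> Hom sz m" "h \<in> carrier (hecke sz)"
  shows "Poly_Mapping.keys (hom_ract sz m x h) \<subseteq> Hom sz m"
  unfolding hom_ract_lin
proof (intro keys_lin_subset[OF assms(1)] keys_lin_subset[OF hrep_keys[OF assms(2)]])
  fix F :: "'a morph" and w assume F: "F \<in> Hom sz m" and w: "w \<in> gen_words sz"
  obtain u where u: "u \<in> gen_words m" "F = hom_word sz m u" using F by (rule Hom_cases)
  have "u @ w \<in> gen_words m" using u w le by auto
  then show "Poly_Mapping.keys (Poly_Mapping.single (hcomp sz sz m F (hom_word sz sz w)) (1::'a)) \<subseteq> Hom sz m"
    using u w le by (simp add: hcomp_right hom_word_Hom)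
qed

lemma hom_vec_ract:
  fixes x :: "'a::field morph \<Rightarrow>\<^sub>0 'a"
  assumes "Poly_Mapping.keys x \<subseteq> Hom sz m" "h \<in> carrier (hecke sz)"
  shows "lin (hom_vec ds sz m) (hom_ract sz m x h) = scale (letter_char ds (hrep h)) (lin (hom_vec ds sz m) x)"
proof -
  have "lin (hom_vec ds sz m) (hom_ract sz m x h) =
      lin (\<lambda>g. lin (\<lambda>w. hom_vec ds sz m (hcomp sz sz m g (hom_word sz sz w))) (hrep h)) x"
    by (simp add: hom_ract_lin lin_lin)
  also have "\<dots> = lin (\<lambda>g. lin (\<lambda>w. if set w \<inter> ds = {} then hom_vec ds sz m g else 0) (hrep h)) x"
  proof (intro lin_cong)
    fix g w assume "g \<in> Poly_Mapping.keys x" "w \<in> Poly_Mapping.keys (hrep h)"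
    then show "hom_vec ds sz m (hcomp sz sz m g (hom_word sz sz w)) = (if set w \<inter> ds = {} then hom_vec ds sz m g else 0)"
      using hom_vec_right assms(1) hrep_keys[OF assms(2)] by blast
  qed
  also have "\<dots> = scale (letter_char ds (hrep h)) (lin (hom_vec ds sz m) x)"
    by (simp add: lin_letter_char lin_fun_scale)
  finally show ?thesis .
qed

text \<open>Coordinates in the basis of subsets, defined on formal tensors before any relation is
  divided out; by \<open>M_rel_kernel\<close> its kernel is exactly the span of the tensor
  relations.\<close>

definition M_val :: "(('a::field morph \<Rightarrow>\<^sub>0 'a) \<times> 'a \<Rightarrow>\<^sub>0 'a) \<Rightarrow> nat set \<Rightarrow>\<^sub>0 'a"
  where "M_val = lin (\<lambda>(x, b). scale b (lin (hom_vec ds sz m) x))"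

lemma M_space_simps:
  "carrier (M_space \<alpha> m) = {q :: ('a::field morph \<Rightarrow>\<^sub>0 'a) \<times> 'a \<Rightarrow>\<^sub>0 'a.
    Poly_Mapping.keys q \<subseteq> {x. Poly_Mapping.keys x \<subseteq> Hom sz m} \<times> UNIV}"
  by (simp add: M_space_def C_mod_simps)

text \<open>Canonical words give a section of \<open>M_val\<close>, hence its surjectivity.\<close>

lemma M_val_canon:
  assumes "Poly_Mapping.keys v \<subseteq> subsets sz m"
  shows "M_val (lin (\<lambda>S. Poly_Mapping.single (Poly_Mapping.single (hom_word sz m (canon_set S)) 1, 1) 1) v)
    = (v :: nat set \<Rightarrow>\<^sub>0 'a::field)"
proof -
  have "M_val (lin (\<lambda>S. Poly_Mapping.single (Poly_Mapping.single (hom_word sz m (canon_set S)) 1, 1) 1) v) =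
    lin (\<lambda>S. Poly_Mapping.single S 1) v"
    unfolding M_val_def lin_lin
  proof (rule lin_cong)
    fix S assume "S \<in> Poly_Mapping.keys v"
    then have "S \<in> subsets sz m" using assms by blast
    then show "lin (\<lambda>(x, b). scale b (lin (hom_vec ds sz m) x))
        (Poly_Mapping.single (Poly_Mapping.single (hom_word sz m (canon_set S)) 1, 1) 1 :: ('a morph \<Rightarrow>\<^sub>0 'a) \<times> 'a \<Rightarrow>\<^sub>0 'a) =
      Poly_Mapping.single S 1"
      by (simp add: hom_vec_word canon_set_word word_set_canon)
  qed
  then show ?thesis by simp
qed

lemma realizes_M_space: "realizes (M_space \<alpha> m :: ('a::field, _) module) (subsets sz m) M_val"
  unfolding realizes_def
proof (intro conjI)
  show "module ring_of_type_algebra (M_space \<alpha> m :: ('a, _) module)"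
    unfolding M_space_def by (rule free_space_module)
  show "M_val ` carrier (M_space \<alpha> m) = {p :: nat set \<Rightarrow>\<^sub>0 'a. Poly_Mapping.keys p \<subseteq> subsets sz m}"
  proof (intro equalityI subsetI)
    fix p :: "nat set \<Rightarrow>\<^sub>0 'a" assume "p \<in> M_val ` carrier (M_space \<alpha> m)"
    then obtain q where q: "p = M_val q" "q \<in> carrier (M_space \<alpha> m)" by blast
    have "Poly_Mapping.keys (M_val q) \<subseteq> subsets sz m"
      unfolding M_val_def
    proof (rule keys_lin_subset[OF q(2)[unfolded M_space_simps mem_Collect_eq]], clarify)
      fix x :: "'a morph \<Rightarrow>\<^sub>0 'a" and b S assume x: "Poly_Mapping.keys x \<subseteq> Hom sz m"
        and S: "S \<in> Poly_Mapping.keys (scale b (lin (hom_vec ds sz m) x))"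
      have "Poly_Mapping.keys (lin (hom_vec ds sz m) x) \<subseteq> subsets sz m"
        by (rule keys_lin_subset[OF x keys_hom_vec])
      from order_trans[OF keys_scale this] S show "S \<in> subsets sz m" by (rule subsetD)
    qed
    then show "p \<in> {p. Poly_Mapping.keys p \<subseteq> subsets sz m}" by (simp add: q(1))
  next
    fix p :: "nat set \<Rightarrow>\<^sub>0 'a" assume "p \<in> {p. Poly_Mapping.keys p \<subseteq> subsets sz m}"
    then have p: "Poly_Mapping.keys p \<subseteq> subsets sz m" by simp
    show "p \<in> M_val ` carrier (M_space \<alpha> m)"
    proof (rule image_eqI)
      show "p = M_val (lin (\<lambda>S. Poly_Mapping.single (Poly_Mapping.single (hom_word sz m (canon_set S)) 1, 1) 1) p)"
        by (rule M_val_canon[OF p, symmetric])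
      show "lin (\<lambda>S. Poly_Mapping.single (Poly_Mapping.single (hom_word sz m (canon_set S)) 1, 1) 1) p \<in> carrier (M_space \<alpha> m)"
        unfolding M_space_simps mem_Collect_eq
        by (rule keys_lin_subset[OF p]) (simp add: hom_word_Hom canon_set_word)
    qed
  qed
qed (simp_all add: M_val_def lin_add lin_scale M_space_def)

abbreviation (input) tens :: "('a::field morph \<Rightarrow>\<^sub>0 'a) \<Rightarrow> 'a \<Rightarrow> (('a morph \<Rightarrow>\<^sub>0 'a) \<times> 'a \<Rightarrow>\<^sub>0 'a)"
  where "tens x y \<equiv> Poly_Mapping.single (x, y) 1"

text \<open>\<open>U\<close> is an arbitrary subspace containing the tensor relations listed here.
  The span is defined as a hull, so a statement valid for every such \<open>U\<close> can be
  intersected at the end.\<close>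

context
  fixes U :: "(('a::field morph \<Rightarrow>\<^sub>0 'a) \<times> 'a \<Rightarrow>\<^sub>0 'a) set"
  assumes U: "submodule U ring_of_type_algebra (M_space \<alpha> m)"
    and rel_add: "\<And>x x' y. Poly_Mapping.keys x \<subseteq> Hom sz m \<Longrightarrow> Poly_Mapping.keys x' \<subseteq> Hom sz m \<Longrightarrow>
        tens (x + x') y - tens x y - tens x' y \<in> U"
    and rel_scale: "\<And>c x y. Poly_Mapping.keys x \<subseteq> Hom sz m \<Longrightarrow> tens (scale c x) y - scale c (tens x y) \<in> U"
    and rel_bal: "\<And>x h y. Poly_Mapping.keys x \<subseteq> Hom sz m \<Longrightarrow> h \<in> carrier (hecke sz) \<Longrightarrow>
        tens (hom_ract sz m x h) y - tens x (letter_char ds (hrep h) * y) \<in> U"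
begin

lemma U_closed: "0 \<in> U" "p \<in> U \<Longrightarrow> q \<in> U \<Longrightarrow> p + q \<in> U" "p \<in> U \<Longrightarrow> scale c p \<in> U"
  "p \<in> U \<Longrightarrow> q \<in> U \<Longrightarrow> p - q \<in> U"
proof -
  interpret submodule U ring_of_type_algebra "M_space \<alpha> m" by (rule U)
  show "0 \<in> U" using one_closed by (simp add: M_space_def)
  show add: "p \<in> U \<Longrightarrow> q \<in> U \<Longrightarrow> p + q \<in> U" for p q using m_closed[of p q] by (simp add: M_space_def)
  show sc: "p \<in> U \<Longrightarrow> scale c p \<in> U" for p c using smult_closed[of c p] by (simp add: M_space_def)
  have "p - q = p + scale (-1) q" for p q :: "('a morph \<Rightarrow>\<^sub>0 'a) \<times> 'a \<Rightarrow>\<^sub>0 'a"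
    by (rule poly_mapping_eqI) (simp add: lookup_add lookup_minus)
  then show "p \<in> U \<Longrightarrow> q \<in> U \<Longrightarrow> p - q \<in> U" using add sc by metis
qed

definition eqU :: "(('a morph \<Rightarrow>\<^sub>0 'a) \<times> 'a \<Rightarrow>\<^sub>0 'a) \<Rightarrow> (('a morph \<Rightarrow>\<^sub>0 'a) \<times> 'a \<Rightarrow>\<^sub>0 'a) \<Rightarrow> bool"
  where "eqU p q \<longleftrightarrow> p - q \<in> U"

lemma eqU_refl: "eqU p p" by (simp add: eqU_def U_closed)
lemma eqU_sym: "eqU p q \<Longrightarrow> eqU q p"
  using U_closed(4)[OF U_closed(1), of "p - q"] by (simp add: eqU_def)
lemma eqU_trans: "eqU p q \<Longrightarrow> eqU q r \<Longrightarrow> eqU p r"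
  using U_closed(2)[of "p - q" "q - r"] by (simp add: eqU_def)
lemma eqU_add: "eqU p q \<Longrightarrow> eqU p' q' \<Longrightarrow> eqU (p + p') (q + q')"
  using U_closed(2)[of "p - q" "p' - q'"] by (simp add: eqU_def algebra_simps)
lemma eqU_scale: "eqU p q \<Longrightarrow> eqU (scale c p) (scale c q)"
  using U_closed(3)[of "p - q" c] by (simp add: eqU_def scale_diff)

lemma tens_add: "Poly_Mapping.keys x \<subseteq> Hom sz m \<Longrightarrow> Poly_Mapping.keys x' \<subseteq> Hom sz m \<Longrightarrow>
    eqU (tens (x + x') y) (tens x y + tens x' y)"
  using rel_add[of x x' y] by (simp add: eqU_def diff_diff_eq)

lemma tens_scale: "Poly_Mapping.keys x \<subseteq> Hom sz m \<Longrightarrow> eqU (tens (scale c x) y) (scale c (tens x y))"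
  using rel_scale[of x c y] by (simp only: eqU_def)

lemma hom_ract_word:
  assumes "u \<in> gen_words m" "w \<in> gen_words sz"
  shows "hom_ract sz m (Poly_Mapping.single (hom_word sz m u) 1) (hcoset sz (Poly_Mapping.single w c)) =
    (Poly_Mapping.single (hom_word sz m (u @ w)) c :: 'a morph \<Rightarrow>\<^sub>0 'a)"
proof -
  have "hom_ract sz m (Poly_Mapping.single (hom_word sz m u) 1) (hcoset sz (Poly_Mapping.single w c)) =
    lin (\<lambda>w. Poly_Mapping.single (hcomp sz sz m (hom_word sz m u) (hom_word sz sz w)) (1::'a)) (hrep (hcoset sz (Poly_Mapping.single w c)))"
    by (simp add: hom_ract_lin)
  also have "\<dots> = lin (\<lambda>w. Poly_Mapping.single (hom_word sz m (u @ w)) (1::'a)) (hrep (hcoset sz (Poly_Mapping.single w c)))"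
  proof (rule lin_cong)
    fix v assume "v \<in> Poly_Mapping.keys (hrep (hcoset sz (Poly_Mapping.single w c) :: 'a hecke))"
    moreover have "Poly_Mapping.keys (hrep (hcoset sz (Poly_Mapping.single w c) :: 'a hecke)) \<subseteq> gen_words sz"
      by (rule hrep_hcoset(2)) (use assms in simp)
    ultimately have "v \<in> gen_words sz" by blast
    then show "Poly_Mapping.single (hcomp sz sz m (hom_word sz m u) (hom_word sz sz v)) (1::'a) = Poly_Mapping.single (hom_word sz m (u @ v)) 1"
      using assms(1) le by (simp add: hcomp_right)
  qed
  also have "\<dots> = lin (\<lambda>w. Poly_Mapping.single (hom_word sz m (u @ w)) (1::'a)) (Poly_Mapping.single w c)"
  proof (rule lin_hrep)
    fix w w' assume w: "hcong sz w w'" "w \<in> gen_words sz"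
    \<comment> \<open>A congruence for the smaller size remains one for size \<open>m\<close> behind
      the prefix \<open>u\<close>; comparing whole congruence classes lets
      \<open>hcong_respects\<close> do the induction.\<close>
    have "hcong m (u @ w) (u @ w')"
    proof (rule hcong_respects[OF w(1), where F = "\<lambda>w. {v. hcong m (u @ w) v}", THEN eqset_imp_iff, THEN iffD2, unfolded mem_Collect_eq])
      fix l r x y assume lr: "hrel sz l r" "x \<in> gen_words sz" "y \<in> gen_words sz"
      have "hrel m l r" using lr(1) le by cases (auto intro: hrel.intros)
      moreover have "u @ x \<in> gen_words m" "y \<in> gen_words m" using lr assms(1) le by auto
      ultimately have "hcong m ((u @ x) @ l @ y) ((u @ x) @ r @ y)" by (rule hcong.step)
      then have h: "hcong m (u @ x @ l @ y) (u @ x @ r @ y)" by simp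
      have "hcong m (u @ x @ l @ y) v \<longleftrightarrow> hcong m (u @ x @ r @ y) v" for v
        using hcong.transI[OF h] hcong.transI[OF hcong.symI[OF h]] by blast
      then show "{v. hcong m (u @ x @ l @ y) v} = {v. hcong m (u @ x @ r @ y) v}" by simp
    qed (rule hcong.reflI)
    moreover have "u @ w \<in> gen_words m" using w assms(1) le by auto
    ultimately have "wrel sz m (u @ w) (u @ w')" by (rule wrel.hc)
    then have "(hom_word sz m (u @ w) :: 'a morph) = hom_word sz m (u @ w')"
      using hom_word_eq_iff wrel_words by blast
    then show "Poly_Mapping.single (hom_word sz m (u @ w) :: 'a morph) (1::'a) = Poly_Mapping.single (hom_word sz m (u @ w')) 1" by simp
  qed (use assms in simp)
  finally show ?thesis by simp
qed

abbreviation (input) word_tens :: "nat list \<Rightarrow> (('a morph \<Rightarrow>\<^sub>0 'a) \<times> 'a \<Rightarrow>\<^sub>0 'a)"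
  where "word_tens u \<equiv> tens (Poly_Mapping.single (hom_word sz m u) 1) 1"

lemma hom_single_keys: "u \<in> gen_words m \<Longrightarrow> Poly_Mapping.keys (Poly_Mapping.single (hom_word sz m u :: 'a morph) (c::'a)) \<subseteq> Hom sz m"
  by (simp add: hom_word_Hom)

lemma word_tens_right:
  assumes "u \<in> gen_words m" "w \<in> gen_words sz"
  shows "eqU (tens (Poly_Mapping.single (hom_word sz m (u @ w)) c) 1)
    (tens (Poly_Mapping.single (hom_word sz m u) 1) (if set w \<inter> ds = {} then c else 0))"
proof -
  have "hcoset sz (Poly_Mapping.single w c) \<in> carrier (hecke sz)"
    using assms(2) unfolding hecke_simps(1)
    by (intro CollectI exI[of _ "Poly_Mapping.single w c"] conjI refl) simp
  from rel_bal[OF hom_single_keys[OF assms(1)] this, of 1 1] show ?thesis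
    by (simp add: hom_ract_word[OF assms] letter_char_hcoset[OF assms(2)] eqU_def)
qed

text \<open>Scalars cross the tensor sign by balancing with a multiple of the identity, the empty
  word.\<close>

lemma tens_scalar:
  assumes "u \<in> gen_words m"
  shows "eqU (tens (Poly_Mapping.single (hom_word sz m u) 1) b) (scale b (word_tens u))"
proof -
  have "eqU (tens (Poly_Mapping.single (hom_word sz m u) b) 1) (tens (Poly_Mapping.single (hom_word sz m u) 1) b)"
    using word_tens_right[OF assms, of "[]" b] by simp
  moreover have "eqU (tens (Poly_Mapping.single (hom_word sz m u) b) 1) (scale b (word_tens u))"
    using tens_scale[OF hom_single_keys[OF assms, of 1], of b 1] by simp
  ultimately show ?thesis using eqU_sym eqU_trans by blast
qed

lemma word_tens_letter:
  assumes "u \<in> gen_words m" "j \<in> {1..<sz}"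
  shows "eqU (word_tens (u @ [j])) (if j \<in> ds then 0 else word_tens u)"
proof -
  have "eqU (word_tens (u @ [j])) (tens (Poly_Mapping.single (hom_word sz m u) 1) (if j \<in> ds then 0 else 1))"
    using word_tens_right[OF assms(1), of "[j]" 1] assms(2) by (simp split: if_splits)
  then show ?thesis
    using eqU_trans[OF _ tens_scalar[OF assms(1), of 0]] by (simp split: if_splits)
qed

lemma word_tens_wrel: "wrel sz m u v \<Longrightarrow> word_tens u = word_tens v"
  using hom_word_eq_iff wrel_words by metis

definition opt_tens :: "nat list \<Rightarrow> nat set option \<Rightarrow> (('a morph \<Rightarrow>\<^sub>0 'a) \<times> 'a \<Rightarrow>\<^sub>0 'a)"
  where "opt_tens t x = (case x of None \<Rightarrow> 0 | Some S \<Rightarrow> word_tens (t @ canon_set S))"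

text \<open>The prefix \<open>t\<close> carries the induction: the leading letter of
  \<open>w\<close> is parked at the end of \<open>t\<close>, the rest is brought to normal form, and
  \<open>canon_set_step\<close> then absorbs the parked letter.\<close>

lemma word_tens_reduce:
  assumes "t \<in> gen_words m" "w \<in> gen_words m"
  shows "eqU (word_tens (t @ w)) (opt_tens t (word_set ds sz w))"
  using assms
proof (induction w arbitrary: t)
  case Nil
  then show ?case by (simp add: word_set_def opt_tens_def canon_set_interval eqU_refl)
next
  case (Cons i w)
  have i: "i \<in> {1..<m}" and w: "w \<in> gen_words m" using Cons.prems by auto
  have ti: "t @ [i] \<in> gen_words m" using Cons.prems by auto
  have IH: "eqU (word_tens (t @ i # w)) (opt_tens (t @ [i]) (word_set ds sz w))"
    using Cons.IH[OF ti w] by simp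
  have ws: "word_set ds sz (i # w) = set_opo ds i (word_set ds sz w)" by (simp add: word_set_def)
  show ?case
  proof (cases "word_set ds sz w")
    case None
    then show ?thesis using IH by (simp add: ws opt_tens_def)
  next
    case (Some S)
    have S: "S \<in> subsets sz m" by (rule word_set_subsets[OF w le Some])
    have cS: "canon_set S \<in> gen_words m" by (rule canon_set_word[OF S])
    have tS: "t @ canon_set S \<in> gen_words m" using cS Cons.prems(1) by simp
    have start: "eqU (word_tens (t @ i # w)) (word_tens (t @ i # canon_set S))"
      using IH by (simp add: Some opt_tens_def)
    have cong: "word_tens (t @ i # canon_set S) = word_tens (t @ v)" if "hcong m (i # canon_set S) v" for v
    proof (rule word_tens_wrel[OF wrel.hc])
      show "hcong m (t @ i # canon_set S) (t @ v)" by (rule hcong_left[OF that Cons.prems(1)])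
      show "t @ i # canon_set S \<in> gen_words m" using Cons.prems(1) cS i by simp
    qed
    note step = canon_set_step[OF S i, of ds]
    show ?thesis
    proof (cases "set_op ds i S")
      case None
      with step obtain j where j: "j \<in> ds" "j \<in> {1..<sz}" "hcong m (i # canon_set S) (canon_set S @ [j])" by auto
      have "eqU (word_tens ((t @ canon_set S) @ [j])) 0"
        using word_tens_letter[OF tS j(2)] j(1) by simp
      then show ?thesis using start cong[OF j(3)] None
        by (simp add: ws Some opt_tens_def eqU_trans)
    next
      case S': (Some S')
      have "hcong m (i # canon_set S) (canon_set S') \<or>
        (S' = S \<and> (\<exists>j\<in>{sz + 1..<m} \<union> ({1..<sz} - ds). hcong m (i # canon_set S) (canon_set S @ [j])))"
        using step by (simp add: S')
      then consider (move) "hcong m (i # canon_set S) (canon_set S')"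
        | (idle) j where "S' = S" "j \<in> {sz + 1..<m} \<union> ({1..<sz} - ds)" "hcong m (i # canon_set S) (canon_set S @ [j])"
        by blast
      then have "eqU (word_tens (t @ i # canon_set S)) (word_tens (t @ canon_set S'))"
      proof cases
        case move
        then show ?thesis using cong[OF move] eqU_refl by simp
      next
        case idle
        have "eqU (word_tens ((t @ canon_set S) @ [j])) (word_tens (t @ canon_set S))"
        proof (cases "j \<in> {1..<sz}")
          case True
          then show ?thesis using word_tens_letter[OF tS True] idle(2) by auto
        next
          case False
          then have "j \<in> {sz + 1..<m}" using idle(2) by blast
          from word_tens_wrel[OF wrel.symI[OF wrel.idle[OF tS this]]] show ?thesis by (simp add: eqU_refl)
        qed
        then show ?thesis using cong[OF idle(3)] idle(1) by simp
      qed
      then show ?thesis using start eqU_trans by (simp add: ws Some S' opt_tens_def)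
    qed
  qed
qed

text \<open>The upper bound: canonical words span the tensor product, with \<open>M_val\<close>
  giving the coefficients.\<close>

lemma tens_reduce:
  assumes "Poly_Mapping.keys q \<subseteq> {x. Poly_Mapping.keys x \<subseteq> Hom sz m} \<times> UNIV"
  shows "eqU q (lin (\<lambda>S. word_tens (canon_set S)) (M_val q))"
  using assms
proof (induction q rule: poly_mapping_span_induct)
  case zero then show ?case by (simp add: M_val_def eqU_refl)
next
  case (add p q) then show ?case by (simp add: M_val_def lin_add eqU_add)
next
  case (single k c)
  obtain x b where k: "k = (x, b)" and x: "Poly_Mapping.keys x \<subseteq> Hom sz m" using single by auto
  let ?L = "lin (\<lambda>S. word_tens (canon_set S))"
  have "eqU (tens x b) (scale b (?L (lin (hom_vec ds sz m) x)))"
    using x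
  proof (induction x rule: poly_mapping_span_induct)
    case zero
    then show ?case using tens_scale[of 0 0 b] by simp
  next
    case (add x x')
    from eqU_trans[OF tens_add[OF add(1,2)] eqU_add[OF add(3,4)]] show ?case by (simp add: lin_add scale_add)
  next
    case (single F d)
    from single obtain u where u: "u \<in> gen_words m" "F = hom_word sz m u" by (rule Hom_cases)
    have "eqU (tens (Poly_Mapping.single F d) b) (scale d (tens (Poly_Mapping.single F 1) b))"
      using tens_scale[OF hom_single_keys[OF u(1), of 1], of d b] u(2) by simp
    moreover have "eqU (scale d (tens (Poly_Mapping.single F 1) b)) (scale d (scale b (word_tens u)))"
      using eqU_scale[OF tens_scalar[OF u(1)]] u(2) by simp
    moreover have "eqU (word_tens u) (?L (hom_vec ds sz m F))"
    proof -
      have "eqU (word_tens ([] @ u)) (opt_tens [] (word_set ds sz u))"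
        by (rule word_tens_reduce) (use u in auto)
      moreover have "opt_tens [] (word_set ds sz u) = ?L (hom_vec ds sz m F)"
        using u by (cases "word_set ds sz u") (simp_all add: hom_vec_word opt_tens_def)
      ultimately show ?thesis by simp
    qed
    then have "eqU (scale d (scale b (word_tens u))) (scale d (scale b (?L (hom_vec ds sz m F))))"
      by (intro eqU_scale)
    ultimately have "eqU (tens (Poly_Mapping.single F d) b) (scale d (scale b (?L (hom_vec ds sz m F))))"
      using eqU_trans by blast
    then show ?case by (simp add: lin_scale scale_scale mult.commute[of b d])
  qed
  from eqU_scale[OF this, of c] show ?case by (simp add: k M_val_def lin_scale)
qed

lemma kernel_subset: "kernel_of (M_space \<alpha> m) M_val \<subseteq> U"
proof
  fix q :: "('a morph \<Rightarrow>\<^sub>0 'a) \<times> 'a \<Rightarrow>\<^sub>0 'a" assume q: "q \<in> kernel_of (M_space \<alpha> m) M_val"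
  then have "eqU q (lin (\<lambda>S. word_tens (canon_set S)) (M_val q))"
    by (intro tens_reduce) (auto simp: kernel_of_def M_space_simps)
  then show "q \<in> U" using q by (simp add: kernel_of_def eqU_def)
qed

end

end

text \<open>The relations have value zero, so their span lies in the kernel; conversely the kernel
  lies in every subspace containing the relations. Hence the tensor product is isomorphic to the
  space on the subsets.\<close>

lemma M_rel_kernel:
  assumes le: "sum_list \<alpha> \<le> m"
  shows "M_rel \<alpha> m = kernel_of (M_space \<alpha> m :: ('a::field, _) module) (M_val \<alpha> m)"
proof -
  let ?a = "sum_list \<alpha>"
  let ?V = "M_space \<alpha> m :: ('a, _) module"
  let ?K = "kernel_of ?V (M_val \<alpha> m)"
  let ?e = "\<lambda>x y. Poly_Mapping.single (x, y) (1::'a)"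
  define G where "G = {?e (x + x') y - ?e x y - ?e x' y | x x' y.
      Poly_Mapping.keys x \<subseteq> Hom ?a m \<and> Poly_Mapping.keys x' \<subseteq> Hom ?a m} \<union>
    {?e x (y + y') - ?e x y - ?e x y' | x y y'. Poly_Mapping.keys x \<subseteq> Hom ?a m} \<union>
    {?e (scale c x) y - scale c (?e x y) | c x y. Poly_Mapping.keys x \<subseteq> Hom ?a m} \<union>
    {?e (hom_ract ?a m x h) y - ?e x (letter_char (descent_set \<alpha>) (hrep h) * y) | x h y.
      Poly_Mapping.keys x \<subseteq> Hom ?a m \<and> h \<in> carrier (hecke ?a)}"
  have rel: "M_rel \<alpha> m = (\<lambda>U. submodule U ring_of_type_algebra ?V) hull G"
    by (simp add: M_rel_def tensor_rel_def subspace_span_def G_def Let_def C_mod_simps M_space_def)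
  have real: "realizes ?V (subsets ?a m) (M_val \<alpha> m)" by (rule realizes_M_space[OF le])
  have e_car: "?e x y \<in> carrier ?V" if "Poly_Mapping.keys x \<subseteq> Hom ?a m" for x y
    using that by (simp add: M_space_simps[OF le])
  have diff: "p - q \<in> carrier ?V" if "p \<in> carrier ?V" "q \<in> carrier ?V" for p q
    using that keys_diff_subset unfolding M_space_simps[OF le] by blast
  have sc: "scale c p \<in> carrier ?V" if "p \<in> carrier ?V" for c p
    using that order_trans[OF keys_scale] unfolding M_space_simps[OF le] by blast
  have val_e: "M_val \<alpha> m (?e x y) = scale y (lin (hom_vec (descent_set \<alpha>) ?a m) x)" for x y
    by (simp add: M_val_def[OF le])
  have val_diff: "M_val \<alpha> m (p - q) = M_val \<alpha> m p - M_val \<alpha> m q" for p q :: "('a morph \<Rightarrow>\<^sub>0 'a) \<times> 'a \<Rightarrow>\<^sub>0 'a"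
    by (simp add: M_val_def[OF le] lin_diff)
  have val_scale: "M_val \<alpha> m (scale c p) = scale c (M_val \<alpha> m p)" for c and p :: "('a morph \<Rightarrow>\<^sub>0 'a) \<times> 'a \<Rightarrow>\<^sub>0 'a"
    by (simp add: M_val_def[OF le] lin_scale)
  have "G \<subseteq> ?K"
  proof -
    have "?e (x + x') y - ?e x y - ?e x' y \<in> ?K"
      if "Poly_Mapping.keys x \<subseteq> Hom ?a m" "Poly_Mapping.keys x' \<subseteq> Hom ?a m" for x x' y
      unfolding kernel_of_def using that e_car diff keys_add_subset[OF that]
      by (simp add: val_diff val_e lin_add scale_add)
    moreover have "?e x (y + y') - ?e x y - ?e x y' \<in> ?K" if "Poly_Mapping.keys x \<subseteq> Hom ?a m" for x y y'
      unfolding kernel_of_def using that e_car diff by (simp add: val_diff val_e scale_add_left)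
    moreover have "?e (scale c x) y - scale c (?e x y) \<in> ?K" if "Poly_Mapping.keys x \<subseteq> Hom ?a m" for c x y
      unfolding kernel_of_def using e_car[OF that] e_car[OF order_trans[OF keys_scale that]] diff sc
      by (simp del: scale_single map_single add: val_diff val_e val_scale lin_scale scale_scale mult.commute[of c y])
    moreover have "?e (hom_ract ?a m x h) y - ?e x (letter_char (descent_set \<alpha>) (hrep h) * y) \<in> ?K"
      if "Poly_Mapping.keys x \<subseteq> Hom ?a m" "h \<in> carrier (hecke ?a)" for x h y
      unfolding kernel_of_def using e_car[OF that(1)] e_car[OF keys_hom_ract[OF le that]] diff
      by (simp add: val_diff val_e hom_vec_ract[OF le that] scale_scale mult.commute[of y])
    ultimately show ?thesis unfolding G_def by blast
  qed
  then have "M_rel \<alpha> m \<subseteq> ?K"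
    unfolding rel by (rule hull_minimal) (rule kernel_submodule[OF real])
  moreover have "?K \<subseteq> M_rel \<alpha> m"
    unfolding rel hull_def
  proof (rule Inter_greatest, clarify)
    fix U x assume U: "submodule U ring_of_type_algebra ?V" and GU: "G \<subseteq> U" and x: "x \<in> ?K"
    have "?K \<subseteq> U"
    proof (rule kernel_subset[OF le U])
      show "?e (x + x') y - ?e x y - ?e x' y \<in> U"
        if "Poly_Mapping.keys x \<subseteq> Hom ?a m" "Poly_Mapping.keys x' \<subseteq> Hom ?a m" for x x' y
        by (rule subsetD[OF GU]) (use that in \<open>unfold G_def, blast\<close>)
      show "?e (scale c x) y - scale c (?e x y) \<in> U" if "Poly_Mapping.keys x \<subseteq> Hom ?a m" for c x y
        by (rule subsetD[OF GU]) (use that in \<open>unfold G_def, blast\<close>)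
      show "?e (hom_ract ?a m x h) y - ?e x (letter_char (descent_set \<alpha>) (hrep h) * y) \<in> U"
        if "Poly_Mapping.keys x \<subseteq> Hom ?a m" "h \<in> carrier (hecke ?a)" for x h y
        by (rule subsetD[OF GU]) (use that in \<open>unfold G_def, blast\<close>)
    qed
    then show "x \<in> U" using x by blast
  qed
  ultimately show ?thesis by (rule subset_antisym)
qed

text \<open>The indices whose generator has diagonal entry 0 at \<open>S\<close>: it either moves
  \<open>S\<close> to another set or kills it. As descents of a shuffle this places dummies below
  all other letters (\<open>word_descents_dummy\<close>).\<close>

definition shuffle_descents :: "nat set \<Rightarrow> nat \<Rightarrow> nat set \<Rightarrow> nat set"
  where "shuffle_descents D m S = {i \<in> {1..<m}. i \<in> S \<and> (i + 1 \<notin> S \<or> card (S \<inter> {1..i}) \<in> D)}"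

text \<open>Strands only move to the right, so the sum of their distances to \<open>m\<close> drops
  whenever the set changes.\<close>

lemma set_t_triangular:
  assumes "i \<in> {1..<m}" "S \<in> subsets a m"
  shows "\<exists>q. set_t D i S = q + (if i \<in> shuffle_descents D m S then 0 else Poly_Mapping.single S (1::'a::field)) \<and>
    (\<forall>S'\<in>Poly_Mapping.keys q. (\<Sum>s\<in>S'. m - s) < (\<Sum>s\<in>S. m - s))"
proof (cases "i \<in> S \<and> i + 1 \<notin> S")
  case True
  have fin: "finite S" by (rule subsets_finite(2)[OF assms(2)])
  let ?S' = "insert (i + 1) (S - {i})"
  have "(\<Sum>s\<in>?S'. m - s) = (m - (i + 1)) + (\<Sum>s\<in>S - {i}. m - s)"
    using True fin by (subst sum.insert) auto
  moreover have "(\<Sum>s\<in>S. m - s) = (m - i) + (\<Sum>s\<in>S - {i}. m - s)"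
    using True fin by (subst sum.remove[of S i]) auto
  moreover have "m - (i + 1) < m - i" using assms(1) by (intro diff_less_mono2) auto
  ultimately have "(\<Sum>s\<in>?S'. m - s) < (\<Sum>s\<in>S. m - s)" by linarith
  then show ?thesis using True assms(1)
    by (intro exI[of _ "Poly_Mapping.single ?S' 1"]) (auto simp: set_op_def shuffle_descents_def)
next
  case False
  then show ?thesis using assms(1)
    by (intro exI[of _ 0]) (auto simp: set_op_def shuffle_descents_def)
qed

text \<open>For this value of \<open>k\<close> the module is a quotient by zero of the quotient by
  the tensor relations. Both submodules are kernels of maps onto the space on the subsets, so the
  action is transported through two layers.\<close>

lemma K0_class_M:
  assumes le: "sum_list \<alpha> \<le> m"
  shows "K0_class (hecke m) (degree_part (Mk_hmod \<alpha> (int (sum_list \<alpha>)) :: ('a::field, 'a tensor set) hmodule) m) =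
    finprod (K0 (hecke m)) (\<lambda>S. one_class m (shuffle_descents (descent_set \<alpha>) m S)) (subsets (sum_list \<alpha>) m)"
proof -
  let ?a = "sum_list \<alpha>" and ?D = "descent_set \<alpha>"
  \<comment> \<open>\<open>?V0\<close> consists of formal tensors, \<open>?V1\<close> is the tensor
    product and \<open>?V2\<close> its quotient by zero.\<close>
  let ?V0 = "M_space \<alpha> m :: ('a, _) module"
  let ?V1 = "space (M_hmod \<alpha>) m :: ('a, 'a tensor) module"
  let ?V2 = "space (Mk_hmod \<alpha> (int ?a)) m :: ('a, 'a tensor set) module"
  let ?f0 = "M_val \<alpha> m" and ?f1 = "coset_val (M_val \<alpha> m)" and ?f2 = "coset_val (coset_val (M_val \<alpha> m))"
  let ?S = "subsets ?a m"
  note R0 = realizes_M_space[OF le, where 'a = 'a]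
  have V1: "?V1 = quot_module ?V0 (kernel_of ?V0 ?f0)" by (simp add: M_hmod_def M_rel_kernel[OF le])
  have R1: "realizes ?V1 ?S ?f1" unfolding V1 by (rule realizes_quot[OF R0])
  have K1: "kernel_of ?V1 ?f1 = {\<zero>\<^bsub>?V1\<^esub>}" unfolding V1 by (rule quot_zero_kernel[OF R0])
  have V2: "?V2 = quot_module ?V1 (kernel_of ?V1 ?f1)"
    by (simp add: Mk_hmod_def hquot_def Mk_sub_def Let_def K1)
  have R2: "realizes ?V2 ?S ?f2" unfolding V2 by (rule realizes_quot[OF R1])
  have inj: "inj_on ?f2 (carrier ?V2)" unfolding V2 by (rule coset_val_inj[OF R1])
  define T where "T i = act (Mk_hmod \<alpha> (int ?a) :: ('a, 'a tensor set) hmodule) m m (hom_class m m (pi_word m [i]))" for i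
  define L where "L i = lin (\<lambda>(x, b :: 'a). Poly_Mapping.single (hom_lact ?a m m (hom_word m m [i] :: 'a morph) x, b) (1::'a))" for i
  have act1: "act (M_hmod \<alpha>) m m (hom_word m m [i]) = quot_map ?V0 (kernel_of ?V0 ?f0) (L i)" for i
  proof -
    have "(\<lambda>q :: ('a morph \<Rightarrow>\<^sub>0 'a) \<times> 'a \<Rightarrow>\<^sub>0 'a. \<Sum>(x, b)\<in>Poly_Mapping.keys q. Poly_Mapping.single (hom_lact ?a m m (hom_word m m [i]) x, b) (Poly_Mapping.lookup q (x, b))) = L i"
      by (rule ext) (simp add: L_def lin_def case_prod_unfold)
    then show ?thesis by (simp add: M_hmod_def M_rel_kernel[OF le])
  qed
  have T: "T i = quot_map ?V1 (kernel_of ?V1 ?f1) (quot_map ?V0 (kernel_of ?V0 ?f0) (L i))" for i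
    unfolding T_def hom_word_def[symmetric] K1
    by (simp add: Mk_hmod_def hquot_def Mk_sub_def Let_def act1)
  have lact_keys: "Poly_Mapping.keys (hom_lact ?a m m (hom_word m m [i]) x) \<subseteq> Hom ?a m"
    if i: "i \<in> {1..<m}" and x: "Poly_Mapping.keys x \<subseteq> Hom ?a m" for i and x :: "'a morph \<Rightarrow>\<^sub>0 'a"
    unfolding hom_lact_lin
  proof (rule keys_lin_subset[OF x])
    fix F :: "'a morph" assume "F \<in> Hom ?a m"
    then obtain u where u: "u \<in> gen_words m" "F = hom_word ?a m u" by (rule Hom_cases[OF le])
    have "i # u \<in> gen_words m" using u i by simp
    then show "Poly_Mapping.keys (Poly_Mapping.single (hcomp ?a m m (hom_word m m [i]) F) (1::'a)) \<subseteq> Hom ?a m"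
      using u i by (simp add: hcomp_left hom_word_Hom[OF le])
  qed
  have L_closed: "L i q \<in> carrier ?V0" if i: "i \<in> {1..<m}" and q: "q \<in> carrier ?V0" for i q
    unfolding L_def M_space_simps[OF le] mem_Collect_eq
  proof (rule keys_lin_subset[OF q[unfolded M_space_simps[OF le] mem_Collect_eq]])
    fix k :: "('a morph \<Rightarrow>\<^sub>0 'a) \<times> 'a" assume "k \<in> {x. Poly_Mapping.keys x \<subseteq> Hom ?a m} \<times> UNIV"
    then have "Poly_Mapping.keys (hom_lact ?a m m (hom_word m m [i]) (fst k)) \<subseteq> Hom ?a m"
      by (intro lact_keys[OF i]) auto
    then show "Poly_Mapping.keys ((\<lambda>(x, b). Poly_Mapping.single (hom_lact ?a m m (hom_word m m [i]) x, b) (1::'a)) k) \<subseteq>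
        {x. Poly_Mapping.keys x \<subseteq> Hom ?a m} \<times> UNIV"
      by (simp add: case_prod_unfold)
  qed
  have L_val: "?f0 (L i q) = lin (set_t ?D i) (?f0 q)" if i: "i \<in> {1..<m}" and q: "q \<in> carrier ?V0" for i q
  proof -
    have "?f0 (L i q) = lin (\<lambda>(x, b). scale b (lin (hom_vec ?D ?a m) (hom_lact ?a m m (hom_word m m [i]) x))) q"
      unfolding M_val_def[OF le] L_def lin_lin by (rule lin_cong) (simp split: prod.split)
    also have "\<dots> = lin (\<lambda>(x, b). scale b (lin (set_t ?D i) (lin (hom_vec ?D ?a m) x))) q"
    proof (rule lin_cong, clarify)
      fix x :: "'a morph \<Rightarrow>\<^sub>0 'a" and b assume "(x, b) \<in> Poly_Mapping.keys q"
      then have x: "Poly_Mapping.keys x \<subseteq> Hom ?a m" using q unfolding M_space_simps[OF le] by blast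
      have "lin (hom_vec ?D ?a m) (hom_lact ?a m m (hom_word m m [i]) x) =
          lin (\<lambda>F. hom_vec ?D ?a m (hcomp ?a m m (hom_word m m [i]) F)) x"
        by (simp add: hom_lact_lin lin_lin)
      also have "\<dots> = lin (set_t ?D i) (lin (hom_vec ?D ?a m) x)"
        unfolding lin_lin by (rule lin_cong) (use x hom_vec_left[OF le _ i] in blast)
      finally show "scale b (lin (hom_vec ?D ?a m) (hom_lact ?a m m (hom_word m m [i]) x)) =
        scale b (lin (set_t ?D i) (lin (hom_vec ?D ?a m) x))" by simp
    qed
    also have "\<dots> = lin (set_t ?D i) (?f0 q)"
      unfolding M_val_def[OF le] lin_lin[of "set_t ?D i" "\<lambda>(x, b). scale b (lin (hom_vec ?D ?a m) x)"]
      by (rule lin_cong) (simp add: lin_scale split: prod.split)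
    finally show ?thesis .
  qed
  have T1: "quot_map ?V0 (kernel_of ?V0 ?f0) (L i) C \<in> carrier ?V1"
    "?f1 (quot_map ?V0 (kernel_of ?V0 ?f0) (L i) C) = lin (set_t ?D i) (?f1 C)"
    if "i \<in> {1..<m}" "C \<in> carrier ?V1" for i C
    using quot_map_realizes[OF R0, of "L i" "lin (set_t ?D i)" C] L_closed[OF that(1)] L_val[OF that(1)] that(2)
    unfolding V1 by blast+
  have T2: "T i C \<in> carrier ?V2" "?f2 (T i C) = lin (set_t ?D i) (?f2 C)"
    if "i \<in> {1..<m}" "C \<in> carrier ?V2" for i C
    using quot_map_realizes[OF R1, of "quot_map ?V0 (kernel_of ?V0 ?f0) (L i)" "lin (set_t ?D i)" C]
      T1[OF that(1)] that(2)
    unfolding V2 T by blast+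
  interpret V2: module ring_of_type_algebra ?V2 using R2 by (simp add: realizes_def)
  have deg: "degree_part (Mk_hmod \<alpha> (int ?a) :: ('a, 'a tensor set) hmodule) m = hecke_module m ?V2 T"
    by (simp add: degree_part_def T_def[abs_def])
  have bij: "bij_betw ?f2 (carrier ?V2) {p. Poly_Mapping.keys p \<subseteq> ?S}"
    using inj realizes_image[OF R2] by (simp add: bij_betw_def)
  note iso = lmod_iso_op_module[OF hecke_rep_sets[of m ?a ?D] V2.M.abelian_group_axioms realizes_smult_closed[OF R2] bij
    realizes_add[OF R2] realizes_smult[OF R2] T2]
  show ?thesis
    unfolding deg
  proof (rule K0_class_triangular[OF hecke_rep_sets[of m ?a ?D] subsets_finite(1) set_t_triangular])
    show "lmod_iso (hecke m) (hecke_module m ?V2 T) (op_module m ?S (set_t ?D))" by (rule iso(1))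
    show "x \<oplus>\<^bsub>hecke_module m ?V2 T\<^esub> y \<in> carrier (hecke_module m ?V2 T)"
      if "x \<in> carrier (hecke_module m ?V2 T)" "y \<in> carrier (hecke_module m ?V2 T)" for x y
      using that by (simp add: hecke_module_def)
    show "h \<odot>\<^bsub>hecke_module m ?V2 T\<^esub> x \<in> carrier (hecke_module m ?V2 T)"
      if "x \<in> carrier (hecke_module m ?V2 T)" "h \<in> carrier (hecke m)" for x h
      using iso(2)[of x h] that by (simp add: hecke_module_def[of m ?V2 T])
  qed
qed

section \<open>The 0-Hecke action that swaps ascents of words\<close>

section \<open>Sorting operators on words\<close>

text \<open>Stated for an abstract letter function \<open>pf\<close> and abstract swaps
  \<open>sw\<close> of neighbouring positions, so that the defining relations are checked by
  comparing letters.\<close>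

definition sort_t :: "(nat \<Rightarrow> 'b \<Rightarrow> 'b) \<Rightarrow> ('b \<Rightarrow> nat \<Rightarrow> nat) \<Rightarrow> nat \<Rightarrow> 'b \<Rightarrow> 'b \<Rightarrow>\<^sub>0 'a::field"
  where "sort_t sw pf i M =
    (if pf M i > pf M (i + 1) then 0
     else if pf M i = pf M (i + 1) then Poly_Mapping.single M 1
     else Poly_Mapping.single (sw i M) 1 + Poly_Mapping.single M 1)"

locale letter_swaps =
  fixes n :: nat and S :: "'b set" and sw :: "nat \<Rightarrow> 'b \<Rightarrow> 'b" and pf :: "'b \<Rightarrow> nat \<Rightarrow> nat"
  assumes sw_closed: "i \<in> {1..<n} \<Longrightarrow> M \<in> S \<Longrightarrow> sw i M \<in> S"
    and pf_sw: "i \<in> {1..<n} \<Longrightarrow> M \<in> S \<Longrightarrow> j \<in> {1..n} \<Longrightarrow> pf (sw i M) j = pf M (transpose i (i + 1) j)"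
    and sw_sw: "i \<in> {1..<n} \<Longrightarrow> M \<in> S \<Longrightarrow> sw i (sw i M) = M"
    and sw_braid: "i \<in> {1..<n} \<Longrightarrow> i + 1 \<in> {1..<n} \<Longrightarrow> M \<in> S \<Longrightarrow>
      sw i (sw (i + 1) (sw i M)) = sw (i + 1) (sw i (sw (i + 1) M))"
    and sw_comm: "i \<in> {1..<n} \<Longrightarrow> j \<in> {1..<n} \<Longrightarrow> \<bar>int i - int j\<bar> > 1 \<Longrightarrow> M \<in> S \<Longrightarrow>
      sw i (sw j M) = sw j (sw i M)"
begin

lemma pf_sw_simps:
  assumes "i \<in> {1..<n}" "M \<in> S"
  shows "pf (sw i M) i = pf M (i + 1)" "pf (sw i M) (i + 1) = pf M i"
    "j \<in> {1..n} \<Longrightarrow> j \<noteq> i \<Longrightarrow> j \<noteq> i + 1 \<Longrightarrow> pf (sw i M) j = pf M j"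
  using assms by (simp_all add: pf_sw)

lemma sort_braid:
  fixes T :: "nat \<Rightarrow> ('b \<Rightarrow>\<^sub>0 'a::field) \<Rightarrow> ('b \<Rightarrow>\<^sub>0 'a)"
  assumes i: "i \<in> {1..<n}" "i + 1 \<in> {1..<n}" and M: "M \<in> S"
  defines "T \<equiv> \<lambda>i. lin (sort_t sw pf i)"
  shows "T i (T (i + 1) (T i (Poly_Mapping.single M 1))) = T (i + 1) (T i (T (i + 1) (Poly_Mapping.single M 1)))"
proof -
  obtain j k where jk: "j = i + 1" "k = i + 2" by simp
  let ?e = "\<lambda>M. Poly_Mapping.single M (1::'a)"
  let ?a = "sw i" and ?b = "sw j"
  have add: "T l (p + q) = T l p + T l q" "T l 0 = 0" for l p q by (simp_all add: T_def lin_add)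
  have cl: "N \<in> S \<Longrightarrow> ?a N \<in> S" "N \<in> S \<Longrightarrow> ?b N \<in> S" for N using sw_closed i unfolding jk by auto
  have pa: "pf (?a N) i = pf N j" "pf (?a N) j = pf N i" "pf (?a N) k = pf N k" if "N \<in> S" for N
    using pf_sw_simps[OF i(1) that] i unfolding jk by auto
  have pb: "pf (?b N) i = pf N i" "pf (?b N) j = pf N k" "pf (?b N) k = pf N j" if "N \<in> S" for N
    using pf_sw_simps[OF i(2) that] i unfolding jk by (auto simp: add.assoc)
  have br: "?a (?b (?a M)) = ?b (?a (?b M))" unfolding jk by (rule sw_braid[OF i M])
  have sq: "N \<in> S \<Longrightarrow> ?a (?a N) = N" "N \<in> S \<Longrightarrow> ?b (?b N) = N" for N
    using sw_sw i unfolding jk by auto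
  have Ti: "T i (?e N) = (if pf N i > pf N j then 0 else if pf N i = pf N j then ?e N else ?e (?a N) + ?e N)" for N
    by (simp add: T_def sort_t_def jk)
  have Tj: "T j (?e N) = (if pf N j > pf N k then 0 else if pf N j = pf N k then ?e N else ?e (?b N) + ?e N)" for N
    by (simp add: T_def sort_t_def jk add.assoc)
  \<comment> \<open>The outcome depends only on the relative order of the three letters at
    \<open>i\<close>, \<open>j\<close>, \<open>k\<close>. In every case both sides expand to the
    same sum, and \<open>br\<close> identifies the terms with three swaps.\<close>
  show ?thesis
    unfolding jk(1)[symmetric]
    by (cases "pf M i" "pf M j" rule: linorder_cases; cases "pf M j" "pf M k" rule: linorder_cases;
        cases "pf M i" "pf M k" rule: linorder_cases)
       (simp_all add: add Ti Tj pa pb cl M br sq add_ac)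
qed

lemma sort_comm:
  assumes ij: "i \<in> {1..<n}" "j \<in> {1..<n}" "\<bar>int i - int j\<bar> > 1" and M: "M \<in> S"
  shows "lin (sort_t sw pf i) (lin (sort_t sw pf j) (Poly_Mapping.single M 1)) =
    (lin (sort_t sw pf j) (lin (sort_t sw pf i) (Poly_Mapping.single M 1)) :: 'b \<Rightarrow>\<^sub>0 'a::field)"
proof -
  have ne: "i \<noteq> j" "i \<noteq> j + 1" "j \<noteq> i + 1" "i + 1 \<noteq> j + 1" using ij by auto
  have cl: "sw i M \<in> S" "sw j M \<in> S" using sw_closed ij M by auto
  have p: "pf (sw i M) j = pf M j" "pf (sw i M) (j + 1) = pf M (j + 1)"
    "pf (sw j M) i = pf M i" "pf (sw j M) (i + 1) = pf M (i + 1)"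
    using pf_sw_simps(3)[OF ij(1) M] pf_sw_simps(3)[OF ij(2) M] ij ne by auto
  obtain i' j' where ij': "i' = i + 1" "j' = j + 1" by simp
  show ?thesis
    unfolding sort_t_def using p sw_comm[OF ij M] unfolding ij'[symmetric]
    by (auto simp: lin_add add_ac)
qed

lemma hecke_rep_sort: "hecke_rep n S (sort_t sw pf :: nat \<Rightarrow> 'b \<Rightarrow> 'b \<Rightarrow>\<^sub>0 'a::field)"
proof
  fix i M assume i: "i \<in> {1..<n}" and M: "M \<in> S"
  show "Poly_Mapping.keys (sort_t sw pf i M :: 'b \<Rightarrow>\<^sub>0 'a) \<subseteq> S"
    unfolding sort_t_def using sw_closed[OF i M] M by (simp add: keys_add_subset)
  show "lin (sort_t sw pf i) (sort_t sw pf i M) = (sort_t sw pf i M :: 'b \<Rightarrow>\<^sub>0 'a)"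
    unfolding sort_t_def[of _ _ i M] using pf_sw_simps(1,2)[OF i M]
    by (auto simp: lin_add sort_t_def)
next
  fix i M assume "i \<in> {1..<n}" "i + 1 \<in> {1..<n}" "M \<in> S"
  from sort_braid[OF this, where 'a = 'a]
  show "lin (sort_t sw pf i) (lin (sort_t sw pf (i + 1)) (sort_t sw pf i M)) =
    (lin (sort_t sw pf (i + 1)) (lin (sort_t sw pf i) (sort_t sw pf (i + 1) M)) :: 'b \<Rightarrow>\<^sub>0 'a)" by simp
next
  fix i j M assume "i \<in> {1..<n}" "j \<in> {1..<n}" "\<bar>int i - int j\<bar> > 1" "M \<in> S"
  from sort_comm[OF this, where 'a = 'a]
  show "lin (sort_t sw pf i) (sort_t sw pf j M) = (lin (sort_t sw pf j) (sort_t sw pf i M) :: 'b \<Rightarrow>\<^sub>0 'a)" by simp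
qed

definition letter_descents :: "'b \<Rightarrow> nat set"
  where "letter_descents M = {i \<in> {1..<n}. pf M i > pf M (i + 1)}"

text \<open>Swapping an ascent brings the larger letter forward, which lowers the weighted sum by
  the difference of the two letters.\<close>

lemma sort_t_triangular:
  assumes i: "i \<in> {1..<n}" and M: "M \<in> S"
  shows "\<exists>q. sort_t sw pf i M = q + (if i \<in> letter_descents M then 0 else Poly_Mapping.single M (1::'a::field)) \<and>
    (\<forall>N\<in>Poly_Mapping.keys q. (\<Sum>j\<in>{1..n}. j * pf N j) < (\<Sum>j\<in>{1..n}. j * pf M j))"
proof (cases "pf M i < pf M (i + 1)")
  case True
  let ?R = "{1..n} - {i} - {i + 1}"
  have split: "(\<Sum>j\<in>{1..n}. j * pf N j) = i * pf N i + ((i + 1) * pf N (i + 1) + (\<Sum>j\<in>?R. j * pf N j))" for N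
    using i by (subst sum.remove[of _ i], simp_all, subst sum.remove[of _ "i + 1"]) auto
  have "(\<Sum>j\<in>?R. j * pf (sw i M) j) = (\<Sum>j\<in>?R. j * pf M j)"
    by (rule sum.cong) (use pf_sw_simps(3)[OF i M] in auto)
  moreover obtain d where "0 < d" "pf M i + d = pf M (i + 1)" using less_imp_add_positive[OF True] by blast
  ultimately have "(\<Sum>j\<in>{1..n}. j * pf (sw i M) j) < (\<Sum>j\<in>{1..n}. j * pf M j)"
    unfolding split pf_sw_simps(1,2)[OF i M] by (simp flip: \<open>pf M i + d = pf M (i + 1)\<close> add: algebra_simps)
  then show ?thesis using True i
    by (intro exI[of _ "Poly_Mapping.single (sw i M) 1"]) (auto simp: sort_t_def letter_descents_def)
next
  case False
  then show ?thesis using i by (intro exI[of _ 0]) (auto simp: sort_t_def letter_descents_def)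
qed

end


section \<open>Chain monomials as a basis, and the operators on them\<close>

section \<open>The Stanley-Reisner ring\<close>

lemma poly_algebra_simps [simp]:
  "carrier (poly_algebra n) = {p. \<forall>e\<in>Poly_Mapping.keys p. Poly_Mapping.keys e \<subseteq> Pow {1..n}}"
  "p \<oplus>\<^bsub>poly_algebra n\<^esub> q = p + q" "p \<otimes>\<^bsub>poly_algebra n\<^esub> q = p * q"
  "\<zero>\<^bsub>poly_algebra n\<^esub> = 0" "\<one>\<^bsub>poly_algebra n\<^esub> = 1" "c \<odot>\<^bsub>poly_algebra n\<^esub> p = scale c p"
  by (simp_all add: poly_algebra_def)

abbreviation exponents :: "nat \<Rightarrow> (nat set \<Rightarrow>\<^sub>0 nat) set"
  where "exponents n \<equiv> {e. Poly_Mapping.keys e \<subseteq> Pow {1..n}}"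

lemma poly_carrier: "p \<in> carrier (poly_algebra n) \<longleftrightarrow> Poly_Mapping.keys p \<subseteq> exponents n"
  by auto

lemma keys_add_nat: "Poly_Mapping.keys (e + f) = Poly_Mapping.keys e \<union> Poly_Mapping.keys (f :: 'b \<Rightarrow>\<^sub>0 nat)"
  by (auto simp: in_keys_iff lookup_add)

lemma keys_mult_exponents:
  assumes "Poly_Mapping.keys p \<subseteq> exponents n" "Poly_Mapping.keys q \<subseteq> exponents n"
  shows "Poly_Mapping.keys (p * q) \<subseteq> exponents n"
proof
  fix e assume "e \<in> Poly_Mapping.keys (p * q)"
  then obtain a b where "e = a + b" "a \<in> Poly_Mapping.keys p" "b \<in> Poly_Mapping.keys q"
    using keys_mult[of p q] by blast
  then show "e \<in> exponents n" using assms by (fastforce simp: keys_add_nat)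
qed

lemma poly_algebra_ring: "ring (poly_algebra n :: ('a::field, 'a mpoly) module)"
proof (rule ringI)
  show "abelian_group (poly_algebra n :: ('a, 'a mpoly) module)"
  proof (rule abelian_groupI)
    fix x :: "'a mpoly" assume "x \<in> carrier (poly_algebra n)"
    then show "\<exists>y\<in>carrier (poly_algebra n). y \<oplus>\<^bsub>poly_algebra n\<^esub> x = \<zero>\<^bsub>poly_algebra n\<^esub>"
      unfolding poly_carrier by (intro bexI[of _ "- x"]) (simp_all only: poly_carrier keys_uminus_subset, simp)
  next
    show "x \<oplus>\<^bsub>poly_algebra n\<^esub> y \<in> carrier (poly_algebra n)"
      if "x \<in> carrier (poly_algebra n)" "y \<in> carrier (poly_algebra n)" for x y :: "'a mpoly"
      using that keys_add_subset unfolding poly_carrier poly_algebra_simps(2) by blast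
  qed (simp_all add: add_ac)
  show "monoid (poly_algebra n :: ('a, 'a mpoly) module)"
  proof (rule monoidI)
    show "x \<otimes>\<^bsub>poly_algebra n\<^esub> y \<in> carrier (poly_algebra n)"
      if "x \<in> carrier (poly_algebra n)" "y \<in> carrier (poly_algebra n)" for x y :: "'a mpoly"
      using that keys_mult_exponents unfolding poly_carrier poly_algebra_simps(3) by blast
  qed (simp_all add: mult.assoc)
qed (simp_all add: algebra_simps)

definition chain_exp :: "(nat set \<Rightarrow>\<^sub>0 nat) \<Rightarrow> bool"
  where "chain_exp e \<longleftrightarrow> (\<forall>A\<in>Poly_Mapping.keys e. \<forall>B\<in>Poly_Mapping.keys e. A \<subseteq> B \<or> B \<subseteq> A)"

definition boolean_rels :: "nat \<Rightarrow> 'a::field mpoly set"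
  where "boolean_rels n = {yvar A * yvar B | A B. A \<subseteq> {1..n} \<and> B \<subseteq> {1..n} \<and> \<not> A \<subseteq> B \<and> \<not> B \<subseteq> A}"

lemma yvar_mult: "yvar A * yvar B = Poly_Mapping.single (Poly_Mapping.single A 1 + Poly_Mapping.single B 1) (1::'a::field)"
  by (simp add: yvar_def mult_single)

lemma boolean_rels_carrier: "(boolean_rels n :: 'a::field mpoly set) \<subseteq> carrier (poly_algebra n)"
  unfolding boolean_rels_def by clarify (simp add: yvar_mult keys_add_nat)

lemma boolean_ideal_ideal: "ideal (boolean_ideal n) (poly_algebra n :: ('a::field, 'a mpoly) module)"
  using ring.genideal_ideal[OF poly_algebra_ring boolean_rels_carrier]
  unfolding boolean_ideal_def boolean_rels_def .

text \<open>The ideal is generated by monomials whose support is not a chain, and every multiple of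
  such a monomial has the same property. This yields the linear independence of the
  \<open>y_M\<close>.\<close>

lemma boolean_ideal_nonchain:
  assumes "p \<in> (boolean_ideal n :: 'a::field mpoly set)" "e \<in> Poly_Mapping.keys p"
  shows "\<not> chain_exp e"
proof -
  let ?A = "poly_algebra n :: ('a, 'a mpoly) module"
  let ?E = "exponents n \<inter> {e. \<not> chain_exp e}"
  define J where "J = {p :: 'a mpoly. Poly_Mapping.keys p \<subseteq> ?E}"
  interpret A: ring ?A by (rule poly_algebra_ring)
  have mult: "x * a \<in> J" if a: "a \<in> J" and x: "Poly_Mapping.keys x \<subseteq> exponents n" for a x
    unfolding J_def
  proof (intro CollectI subsetI)
    fix e assume "e \<in> Poly_Mapping.keys (x * a)"
    then obtain f h where e: "e = f + h" "f \<in> Poly_Mapping.keys x" "h \<in> Poly_Mapping.keys a"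
      using keys_mult[of x a] by blast
    then have "h \<in> ?E" "f \<in> exponents n" using a x by (auto simp: J_def)
    then show "e \<in> ?E" unfolding e(1) chain_exp_def Int_iff mem_Collect_eq keys_add_nat by blast
  qed
  have "ideal J ?A"
  proof (rule idealI[OF poly_algebra_ring])
    show "subgroup J (add_monoid ?A)"
    proof (rule group.subgroupI)
      show "group (add_monoid ?A)" by (rule A.a_group)
      show "J \<subseteq> carrier (add_monoid ?A)" by (auto simp: J_def)
      have "0 \<in> J" by (simp add: J_def)
      then show "J \<noteq> {}" by blast
    next
      fix a assume a: "a \<in> J"
      then have aA: "a \<in> carrier ?A" "- a \<in> carrier ?A" "- a \<in> J"
        using keys_uminus_subset[of a] unfolding poly_carrier J_def by blast+
      then have "\<ominus>\<^bsub>?A\<^esub> a = - a" by (intro A.minus_equality) simp_all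
      then show "inv\<^bsub>add_monoid ?A\<^esub> a \<in> J" using aA(3) by (simp add: a_inv_def)
    qed (simp add: J_def keys_add_subset)
  next
    fix a x assume a: "a \<in> J" and x: "x \<in> carrier ?A"
    then have "x * a \<in> J" using mult unfolding poly_carrier by blast
    then show "x \<otimes>\<^bsub>?A\<^esub> a \<in> J" "a \<otimes>\<^bsub>?A\<^esub> x \<in> J" by (simp_all add: mult.commute)
  qed
  moreover have "boolean_rels n \<subseteq> J"
  proof
    fix p :: "'a mpoly" assume "p \<in> boolean_rels n"
    then obtain A B where p: "p = yvar A * yvar B" and AB: "A \<subseteq> {1..n}" "B \<subseteq> {1..n}" "\<not> A \<subseteq> B" "\<not> B \<subseteq> A"
      unfolding boolean_rels_def by blast
    have "\<not> chain_exp (Poly_Mapping.single A 1 + Poly_Mapping.single B 1)"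
      using AB(3,4) unfolding chain_exp_def keys_add_nat by simp
    then show "p \<in> J" unfolding p J_def yvar_mult using AB(1,2) by (simp add: keys_add_nat)
  qed
  ultimately have "boolean_ideal n \<subseteq> J"
    using ring.genideal_minimal[OF poly_algebra_ring, of J] unfolding boolean_ideal_def boolean_rels_def by blast
  then show ?thesis using assms by (auto simp: J_def)
qed

abbreviation bcoset :: "nat \<Rightarrow> 'a::field mpoly \<Rightarrow> 'a mpoly set"
  where "bcoset n p \<equiv> boolean_ideal n +>\<^bsub>poly_algebra n\<^esub> p"

lemma boolean_ideal_closed:
  "(0 :: 'a::field mpoly) \<in> boolean_ideal n"
  "p \<in> boolean_ideal n \<Longrightarrow> scale c (p :: 'a mpoly) \<in> boolean_ideal n"
  "p \<in> boolean_ideal n \<Longrightarrow> q \<in> boolean_ideal n \<Longrightarrow> p + q \<in> (boolean_ideal n :: 'a mpoly set)"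
proof -
  interpret ideal "boolean_ideal n" "poly_algebra n :: ('a, 'a mpoly) module"
    by (rule boolean_ideal_ideal)
  show "(0 :: 'a mpoly) \<in> boolean_ideal n"
    using additive_subgroup.zero_closed[OF is_additive_subgroup] by simp
  show "p + q \<in> boolean_ideal n" if "p \<in> boolean_ideal n" "q \<in> boolean_ideal n" for p q :: "'a mpoly"
    using additive_subgroup.a_closed[OF is_additive_subgroup that] by simp
  show "scale c p \<in> boolean_ideal n" if "p \<in> boolean_ideal n" for p :: "'a mpoly" and c
    using I_l_closed[OF that, of "Poly_Mapping.single 0 c"] by (simp add: mult_map_scale_conv_mult)
qed

lemma mem_bcoset: "q \<in> bcoset n p \<longleftrightarrow> q - p \<in> boolean_ideal n"
  by (rule mem_coset_plus) (simp add: poly_algebra_def)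

lemma bcoset_eqI:
  assumes "p - q \<in> (boolean_ideal n :: 'a::field mpoly set)"
  shows "bcoset n p = bcoset n q"
proof -
  have "q - p = scale (-1) (p - q)" by (rule poly_mapping_eqI) (simp add: lookup_minus)
  then have *: "q - p \<in> boolean_ideal n" using boolean_ideal_closed(2)[OF assms, of "-1"] by simp
  have "x - p \<in> boolean_ideal n \<longleftrightarrow> x - q \<in> boolean_ideal n" for x :: "'a mpoly"
    using boolean_ideal_closed(3)[OF _ assms, of "x - p"] boolean_ideal_closed(3)[OF _ *, of "x - q"] by auto
  then show ?thesis by (auto simp: mem_bcoset)
qed

definition expo :: "nat set list \<Rightarrow> (nat set \<Rightarrow>\<^sub>0 nat)"
  where "expo M = sum_list (map (\<lambda>A. Poly_Mapping.single A 1) M)"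

lemma prod_list_yvar: "prod_list (map yvar M) = (Poly_Mapping.single (expo M) 1 :: 'a::field mpoly)"
  by (induction M) (simp_all add: expo_def yvar_def mult_single single_one)

lemma lookup_expo: "Poly_Mapping.lookup (expo M) A = count (mset M) A"
  by (induction M) (simp_all add: expo_def lookup_add lookup_single when_def)

lemma keys_expo: "Poly_Mapping.keys (expo M) = set M"
  by (auto simp: in_keys_iff lookup_expo)

text \<open>Each head occurs in the other list, so the two heads contain each other and
  agree.\<close>

lemma chain_list_unique:
  assumes "sorted_wrt (\<subseteq>) M" "sorted_wrt (\<subseteq>) N" "mset M = mset N"
  shows "M = (N :: 'b set list)"
  using assms
proof (induction M arbitrary: N)
  case Nil then show ?case by simp
next
  case (Cons A M)
  then obtain B N' where N: "N = B # N'" by (cases N) auto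
  have "set (A # M) = set N" using Cons.prems(3) by (metis set_mset_mset)
  then have "A \<in> set (B # N')" "B \<in> set (A # M)" using N by auto
  then have "B \<subseteq> A" "A \<subseteq> B" using Cons.prems(1,2) N by auto
  then have "A = B" by simp
  then show ?case using Cons.IH[of N'] Cons.prems N by simp
qed

definition multichains :: "nat \<Rightarrow> nat set list set"
  where "multichains n = {M. multichain n M}"

definition graded_multichains :: "nat \<Rightarrow> nat list \<Rightarrow> nat set list set"
  where "graded_multichains n g = {M. multichain n M \<and> map card M = g}"

lemma expo_inj: "M \<in> multichains n \<Longrightarrow> N \<in> multichains n \<Longrightarrow> expo M = expo N \<Longrightarrow> M = N"
proof -
  assume *: "M \<in> multichains n" "N \<in> multichains n" "expo M = expo N"
  then have "mset M = mset N" by (metis lookup_expo multiset_eqI)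
  then show ?thesis using * chain_list_unique by (auto simp: multichains_def multichain_def)
qed

text \<open>Reads a monomial as a multichain; monomials with a support that is not a chain go to
  zero, so the linear extension vanishes on the ideal.\<close>

definition decode :: "nat \<Rightarrow> (nat set \<Rightarrow>\<^sub>0 nat) \<Rightarrow> nat set list \<Rightarrow>\<^sub>0 'a::field"
  where "decode n e = (if \<exists>M\<in>multichains n. expo M = e
    then Poly_Mapping.single (THE M. M \<in> multichains n \<and> expo M = e) 1 else 0)"

lemma decode_expo: "M \<in> multichains n \<Longrightarrow> decode n (expo M) = Poly_Mapping.single M 1"
proof -
  assume M: "M \<in> multichains n"
  then have "(THE N. N \<in> multichains n \<and> expo N = expo M) = M" using expo_inj by blast
  then show ?thesis using M by (auto simp: decode_def)
qed

lemma decode_other: "(\<And>M. M \<in> multichains n \<Longrightarrow> expo M \<noteq> e) \<Longrightarrow> decode n e = 0"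
  by (auto simp: decode_def)

lemma keys_decode: "Poly_Mapping.keys (decode n e :: _ \<Rightarrow>\<^sub>0 'a::field) \<subseteq> multichains n"
proof (cases "\<exists>M\<in>multichains n. expo M = e")
  case True
  then obtain M where "M \<in> multichains n" "e = expo M" by blast
  then show ?thesis by (simp add: decode_expo)
qed (auto simp: decode_def)

lemma expo_chain: "M \<in> multichains n \<Longrightarrow> chain_exp (expo M)"
proof -
  assume "M \<in> multichains n"
  then have s: "sorted_wrt (\<subseteq>) M" by (simp add: multichains_def multichain_def)
  show ?thesis
    unfolding chain_exp_def keys_expo
  proof (intro ballI)
    fix A B assume "A \<in> set M" "B \<in> set M"
    then obtain i j where "i < length M" "A = M ! i" "j < length M" "B = M ! j" by (metis in_set_conv_nth)
    then show "A \<subseteq> B \<or> B \<subseteq> A"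
      using sorted_wrt_nth_less[OF s, of i j] sorted_wrt_nth_less[OF s, of j i] by (cases i j rule: linorder_cases) auto
  qed
qed

lemma decode_ideal:
  assumes "p \<in> boolean_ideal n"
  shows "lin (decode n) p = (0 :: nat set list \<Rightarrow>\<^sub>0 'a::field)"
proof -
  have "lin (decode n) p = lin (\<lambda>_. 0 :: nat set list \<Rightarrow>\<^sub>0 'a) p"
  proof (rule lin_cong)
    fix e assume "e \<in> Poly_Mapping.keys p"
    then have "\<not> chain_exp e" by (rule boolean_ideal_nonchain[OF assms])
    then show "decode n e = (0 :: nat set list \<Rightarrow>\<^sub>0 'a)" by (intro decode_other) (use expo_chain in blast)
  qed
  then show ?thesis by simp
qed

text \<open>Coordinates of a coset in the monomials \<open>y_M\<close>; \<open>decode_ideal\<close>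
  makes the chosen representative harmless.\<close>

definition bval :: "nat \<Rightarrow> 'a::field mpoly set \<Rightarrow> nat set list \<Rightarrow>\<^sub>0 'a"
  where "bval n C = lin (decode n) (SOME p. p \<in> C)"

lemma bval_bcoset: "bval n (bcoset n p) = lin (decode n) p"
proof -
  have "p \<in> bcoset n p" by (simp add: mem_bcoset boolean_ideal_closed)
  then have "(SOME x. x \<in> bcoset n p) \<in> bcoset n p" by (rule someI)
  then have "(SOME x. x \<in> bcoset n p) - p \<in> boolean_ideal n" by (simp add: mem_bcoset)
  from decode_ideal[OF this] show ?thesis by (simp add: bval_def lin_diff)
qed

lemma keys_bval: "Poly_Mapping.keys (bval n C) \<subseteq> multichains n"
  unfolding bval_def by (rule keys_lin_subset[OF order_refl keys_decode])

lemma boolean_ring_simps: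
  fixes p q :: "'a::field mpoly"
  shows "carrier (boolean_ring n) = {bcoset n p | p :: 'a mpoly. Poly_Mapping.keys p \<subseteq> exponents n}"
    "Poly_Mapping.keys p \<subseteq> exponents n \<Longrightarrow> Poly_Mapping.keys q \<subseteq> exponents n \<Longrightarrow>
      bcoset n p \<oplus>\<^bsub>boolean_ring n\<^esub> bcoset n q = bcoset n (p + q)"
    "\<zero>\<^bsub>boolean_ring n\<^esub> = (bcoset n 0 :: 'a mpoly set)"
    "c \<odot>\<^bsub>boolean_ring n\<^esub> bcoset n p = bcoset n (scale c p)"
proof -
  interpret ideal "boolean_ideal n" "poly_algebra n :: ('a, 'a mpoly) module"
    by (rule boolean_ideal_ideal)
  show "carrier (boolean_ring n) = {bcoset n p | p :: 'a mpoly. Poly_Mapping.keys p \<subseteq> exponents n}"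
  proof -
    have pc: "carrier (poly_algebra n) = {p :: 'a mpoly. Poly_Mapping.keys p \<subseteq> exponents n}"
      using poly_carrier by blast
    show ?thesis unfolding boolean_ring_def quot_module_def A_RCOSETS_def' pc by auto
  qed
  show "bcoset n p \<oplus>\<^bsub>boolean_ring n\<^esub> bcoset n q = bcoset n (p + q)"
    if "Poly_Mapping.keys p \<subseteq> exponents n" "Poly_Mapping.keys q \<subseteq> exponents n"
    using a_rcos_sum[of p q] that unfolding poly_carrier[symmetric] by (simp add: boolean_ring_def quot_module_def)
  show "\<zero>\<^bsub>boolean_ring n\<^esub> = (bcoset n 0 :: 'a mpoly set)"
    by (auto simp: boolean_ring_def quot_module_def mem_bcoset)
  have "bcoset n (scale c x) = bcoset n (scale c p)" if "x \<in> bcoset n p" for x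
    using that boolean_ideal_closed(2)[of "x - p" n c] by (intro bcoset_eqI) (simp add: mem_bcoset scale_diff)
  moreover have "p \<in> bcoset n p" by (simp add: mem_bcoset boolean_ideal_closed)
  moreover have "c \<odot>\<^bsub>boolean_ring n\<^esub> bcoset n p = (\<Union>x\<in>bcoset n p. bcoset n (scale c x))"
    by (simp add: boolean_ring_def quot_module_def)
  ultimately show "c \<odot>\<^bsub>boolean_ring n\<^esub> bcoset n p = bcoset n (scale c p)" by blast
qed

lemma boolean_ring_module: "module ring_of_type_algebra (boolean_ring n :: ('a::field, 'a mpoly set) module)"
proof (rule moduleI)
  show "cring (ring_of_type_algebra :: 'a ring)" by (rule cring_from_type_algebra)
  have "ring (poly_algebra n Quot (boolean_ideal n) :: 'a mpoly set ring)"
    by (rule ideal.quotient_is_ring[OF boolean_ideal_ideal])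
  then have "ring (boolean_ring n :: ('a, 'a mpoly set) module)"
    by (rule ring_cong) (simp_all add: boolean_ring_def quot_module_def FactRing_def)
  then show "abelian_group (boolean_ring n :: ('a, 'a mpoly set) module)" by (simp add: ring_def)
next
  fix a b :: 'a and C D :: "'a mpoly set" assume "C \<in> carrier (boolean_ring n)"
  then obtain p where p: "C = bcoset n p" "Poly_Mapping.keys p \<subseteq> exponents n"
    unfolding boolean_ring_simps(1) by blast
  have sc: "Poly_Mapping.keys (scale c p) \<subseteq> exponents n" for c by (rule order_trans[OF keys_scale p(2)])
  show "a \<odot>\<^bsub>boolean_ring n\<^esub> C \<in> carrier (boolean_ring n)"
    unfolding p(1) boolean_ring_simps(4) unfolding boolean_ring_simps(1) using sc by blast
  show "(a \<oplus>\<^bsub>ring_of_type_algebra\<^esub> b) \<odot>\<^bsub>boolean_ring n\<^esub> C = a \<odot>\<^bsub>boolean_ring n\<^esub> C \<oplus>\<^bsub>boolean_ring n\<^esub> b \<odot>\<^bsub>boolean_ring n\<^esub> C"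
    unfolding p(1) boolean_ring_simps(4) boolean_ring_simps(2)[OF sc sc] by (simp add: scale_add_left)
  show "(a \<otimes>\<^bsub>ring_of_type_algebra\<^esub> b) \<odot>\<^bsub>boolean_ring n\<^esub> C = a \<odot>\<^bsub>boolean_ring n\<^esub> (b \<odot>\<^bsub>boolean_ring n\<^esub> C)"
    unfolding p(1) boolean_ring_simps(4) by (simp add: scale_scale)
  show "\<one>\<^bsub>ring_of_type_algebra\<^esub> \<odot>\<^bsub>boolean_ring n\<^esub> C = C"
    unfolding p(1) boolean_ring_simps(4) by simp
  assume "D \<in> carrier (boolean_ring n)"
  then obtain q where q: "D = bcoset n q" "Poly_Mapping.keys q \<subseteq> exponents n"
    unfolding boolean_ring_simps(1) by blast
  have scq: "Poly_Mapping.keys (scale c q) \<subseteq> exponents n" for c by (rule order_trans[OF keys_scale q(2)])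
  show "a \<odot>\<^bsub>boolean_ring n\<^esub> (C \<oplus>\<^bsub>boolean_ring n\<^esub> D) = a \<odot>\<^bsub>boolean_ring n\<^esub> C \<oplus>\<^bsub>boolean_ring n\<^esub> a \<odot>\<^bsub>boolean_ring n\<^esub> D"
    unfolding p(1) q(1) boolean_ring_simps(2)[OF p(2) q(2)] boolean_ring_simps(4) boolean_ring_simps(2)[OF sc scq]
    by (simp only: scale_add)
qed

text \<open>A section of \<open>bval\<close> (\<open>bval_encode\<close>); restricted to one
  multigrading its image is the graded piece (\<open>graded_span\<close>).\<close>

definition encode :: "nat \<Rightarrow> (nat set list \<Rightarrow>\<^sub>0 'a::field) \<Rightarrow> 'a mpoly set"
  where "encode n q = bcoset n (lin (\<lambda>M. Poly_Mapping.single (expo M) 1) q)"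

lemma encode_single: "encode n (Poly_Mapping.single M 1) = y_mono n M"
  by (simp add: encode_def y_mono_def prod_list_yvar)

lemma expo_exponents: "M \<in> multichains n \<Longrightarrow> expo M \<in> exponents n"
  by (auto simp: keys_expo multichains_def multichain_def)

lemma encode_keys:
  "Poly_Mapping.keys q \<subseteq> multichains n \<Longrightarrow>
    Poly_Mapping.keys (lin (\<lambda>M. Poly_Mapping.single (expo M) (1::'a::field)) q) \<subseteq> exponents n"
  by (erule keys_lin_subset) (use expo_exponents in auto)

lemma encode_carrier: "Poly_Mapping.keys q \<subseteq> multichains n \<Longrightarrow> encode n q \<in> carrier (boolean_ring n)"
  unfolding encode_def boolean_ring_simps(1) using encode_keys by blast

lemma encode_add: "Poly_Mapping.keys p \<subseteq> multichains n \<Longrightarrow> Poly_Mapping.keys q \<subseteq> multichains n \<Longrightarrow>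
    encode n (p + q) = encode n p \<oplus>\<^bsub>boolean_ring n\<^esub> encode n q"
  by (simp add: encode_def lin_add boolean_ring_simps(2)[OF encode_keys encode_keys])

lemma encode_scale: "encode n (scale c q) = c \<odot>\<^bsub>boolean_ring n\<^esub> encode n q"
  by (simp add: encode_def lin_scale boolean_ring_simps(4))

lemma encode_zero: "encode n 0 = \<zero>\<^bsub>boolean_ring n\<^esub>"
  by (simp add: encode_def boolean_ring_simps(3))

lemma bval_encode:
  assumes "Poly_Mapping.keys q \<subseteq> multichains n"
  shows "bval n (encode n q) = q"
proof -
  have "bval n (encode n q) = lin (\<lambda>M. Poly_Mapping.single M 1) q"
    unfolding encode_def bval_bcoset lin_lin by (rule lin_cong) (use assms in \<open>auto simp: decode_expo\<close>)
  then show ?thesis by simp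
qed

lemma bval_add: "C \<in> carrier (boolean_ring n) \<Longrightarrow> D \<in> carrier (boolean_ring n) \<Longrightarrow>
    bval n (C \<oplus>\<^bsub>boolean_ring n\<^esub> D) = bval n C + bval n D"
  unfolding boolean_ring_simps(1) by clarify (simp only: boolean_ring_simps(2) bval_bcoset lin_add)

lemma bval_smult: "C \<in> carrier (boolean_ring n) \<Longrightarrow> bval n (c \<odot>\<^bsub>boolean_ring n\<^esub> C) = scale c (bval n C)"
  unfolding boolean_ring_simps(1) by clarify (simp only: boolean_ring_simps(4) bval_bcoset lin_scale)

lemma graded_subset: "graded_multichains n g \<subseteq> multichains n"
  by (auto simp: graded_multichains_def multichains_def)

lemma graded_span:
  "subspace_span (boolean_ring n) {y_mono n M | M. multichain n M \<and> map card M = g} =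
    encode n ` {q :: nat set list \<Rightarrow>\<^sub>0 'a::field. Poly_Mapping.keys q \<subseteq> graded_multichains n g}" (is "?W = ?E")
  and graded_submodule: "submodule (encode n ` {q :: nat set list \<Rightarrow>\<^sub>0 'a. Poly_Mapping.keys q \<subseteq> graded_multichains n g})
    ring_of_type_algebra (boolean_ring n)"
proof -
  let ?G = "graded_multichains n g"
  interpret B: module ring_of_type_algebra "boolean_ring n :: ('a, _) module" by (rule boolean_ring_module)
  have GM: "Poly_Mapping.keys q \<subseteq> ?G \<Longrightarrow> Poly_Mapping.keys q \<subseteq> multichains n" for q :: "nat set list \<Rightarrow>\<^sub>0 'a"
    using graded_subset by blast
  show sub: "submodule ?E ring_of_type_algebra (boolean_ring n)"
  proof (rule B.submoduleI)
    show "?E \<subseteq> carrier (boolean_ring n)" using encode_carrier GM by blast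
    show "\<zero>\<^bsub>boolean_ring n\<^esub> \<in> ?E" by (rule image_eqI[of _ _ 0]) (simp_all add: encode_zero)
    show "C \<oplus>\<^bsub>boolean_ring n\<^esub> D \<in> ?E" if C: "C \<in> ?E" and D: "D \<in> ?E" for C D
    proof -
      obtain p q where "C = encode n p" "Poly_Mapping.keys p \<subseteq> ?G" "D = encode n q" "Poly_Mapping.keys q \<subseteq> ?G"
        using C D by blast
      then show ?thesis by (intro image_eqI[of _ _ "p + q"]) (simp_all add: encode_add GM keys_add_subset)
    qed
    show sm: "a \<odot>\<^bsub>boolean_ring n\<^esub> C \<in> ?E" if C: "C \<in> ?E" for C a
    proof -
      obtain p where "C = encode n p" "Poly_Mapping.keys p \<subseteq> ?G" using C by blast
      then show ?thesis by (intro image_eqI[of _ _ "scale a p"]) (simp_all add: encode_scale order_trans[OF keys_scale])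
    qed
    show "\<ominus>\<^bsub>boolean_ring n\<^esub> C \<in> ?E" if C: "C \<in> ?E" for C
    proof -
      have Cc: "C \<in> carrier (boolean_ring n)" using C encode_carrier GM by blast
      have "\<ominus>\<^bsub>boolean_ring n\<^esub> C = (\<ominus>\<^bsub>ring_of_type_algebra\<^esub> \<one>\<^bsub>ring_of_type_algebra\<^esub>) \<odot>\<^bsub>boolean_ring n\<^esub> C"
        using B.smult_l_minus[of "\<one>\<^bsub>ring_of_type_algebra\<^esub>" C] B.smult_one[OF Cc] Cc by simp
      then show ?thesis using sm[OF C] by simp
    qed
  qed
  show "?W = ?E"
  proof
    show "?W \<subseteq> ?E"
      unfolding subspace_span_def
    proof (rule hull_minimal, clarify)
      show "submodule ?E ring_of_type_algebra (boolean_ring n)" by (rule sub)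
      fix M assume "multichain n M" "g = map card M"
      then show "y_mono n M \<in> encode n ` {q :: nat set list \<Rightarrow>\<^sub>0 'a. Poly_Mapping.keys q \<subseteq> graded_multichains n (map card M)}"
        by (intro image_eqI[of _ _ "Poly_Mapping.single M 1"]) (simp_all add: encode_single graded_multichains_def)
    qed
    show "?E \<subseteq> ?W"
      unfolding subspace_span_def hull_def
    proof (rule Inter_greatest, clarify)
      fix U :: "'a mpoly set set" and q :: "nat set list \<Rightarrow>\<^sub>0 'a"
      assume U: "submodule U ring_of_type_algebra (boolean_ring n)"
        and gen: "{y_mono n M | M. multichain n M \<and> map card M = g} \<subseteq> U" and q: "Poly_Mapping.keys q \<subseteq> ?G"
      interpret U: submodule U ring_of_type_algebra "boolean_ring n :: ('a, _) module" by (rule U)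
      from q show "encode n q \<in> U"
      proof (induction q rule: poly_mapping_span_induct)
        case zero then show ?case using U.one_closed by (simp add: encode_zero)
      next
        case (add p q)
        then show ?case using U.m_closed[of "encode n p" "encode n q"] by (simp add: encode_add GM)
      next
        case (single M c)
        then have "encode n (Poly_Mapping.single M 1) \<in> U"
          using gen unfolding encode_single graded_multichains_def by blast
        then show ?case
          using U.smult_closed[of c "encode n (Poly_Mapping.single M 1)"] encode_scale[of n c "Poly_Mapping.single M 1"] by simp
      qed
    qed
  qed
qed

lemma transpose_image_interval: "(i :: nat) \<in> {1..<n} \<Longrightarrow> transpose i (i + 1) ` {1..n} = {1..n}"
  by (rule transpose_image_eq) auto

lemma swap_chain_multichain:
  assumes i: "i \<in> {1..<n}" and M: "M \<in> multichains n"
  shows "swap_chain i M \<in> multichains n"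
proof -
  have "transpose i (i + 1) ` A \<subseteq> {1..n}" if "A \<subseteq> {1..n}" for A
    using image_mono[OF that, of "transpose i (i + 1)"] transpose_image_interval[OF i] by simp
  moreover have "sorted_wrt (\<lambda>A B. transpose i (i + 1) ` A \<subseteq> transpose i (i + 1) ` B) M"
    using M by (auto simp: multichains_def multichain_def intro: sorted_wrt_mono_rel[rotated])
  ultimately show ?thesis
    using M by (auto simp: multichains_def multichain_def swap_chain_def sorted_wrt_map)
qed

lemma swap_chain_card: "map card (swap_chain i M) = map card M"
  by (simp add: swap_chain_def card_image)

lemma p_index_swap:
  assumes i: "i \<in> {1..<n}"
  shows "p_index n (swap_chain i M) j = p_index n M (transpose i (i + 1) j)"
proof -
  let ?t = "transpose i (i + 1)"
  \<comment> \<open>The transposition fixes the full interval, so the final set appended in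
    \<open>p_index\<close> is compatible with the swap.\<close>
  have map: "swap_chain i M @ [{1..n}] = map ((`) ?t) (M @ [{1..n}])"
    by (simp add: swap_chain_def transpose_image_interval[OF i])
  have mem: "j \<in> ?t ` A \<longleftrightarrow> ?t j \<in> A" for A :: "nat set"
    by (rule in_transpose_image_iff)
  have "(1 \<le> k \<and> k \<le> length M + 1 \<and> j \<in> (swap_chain i M @ [{1..n}]) ! (k - 1)) \<longleftrightarrow>
    (1 \<le> k \<and> k \<le> length M + 1 \<and> ?t j \<in> (M @ [{1..n}]) ! (k - 1))" for k
  proof (cases "1 \<le> k \<and> k \<le> length M + 1")
    case True
    then have "k - 1 < length (M @ [{1..n}])" by auto
    then show ?thesis unfolding map by (subst nth_map) (simp_all add: mem)
  qed auto
  then show ?thesis unfolding p_index_def by (simp add: swap_chain_def)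
qed

lemma letter_swaps_multichains:
  assumes "S \<subseteq> multichains n" "\<And>i M. i \<in> {1..<n} \<Longrightarrow> M \<in> S \<Longrightarrow> swap_chain i M \<in> S"
  shows "letter_swaps n S swap_chain (p_index n)"
proof
  fix i j M
  show "p_index n (swap_chain i M) j = p_index n M (transpose i (i + 1) j)" if "i \<in> {1..<n}"
    by (rule p_index_swap[OF that])
  show "swap_chain i (swap_chain i M) = M"
    by (simp add: swap_chain_def image_image o_def)
  show "swap_chain i (swap_chain (i + 1) (swap_chain i M)) = swap_chain (i + 1) (swap_chain i (swap_chain (i + 1) M))"
  proof -
    have "transpose i (i + 1) (transpose (i + 1) (i + 1 + 1) (transpose i (i + 1) x)) =
      transpose (i + 1) (i + 1 + 1) (transpose i (i + 1) (transpose (i + 1) (i + 1 + 1) x))" for x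
      by (auto simp: transpose_def)
    then show ?thesis unfolding swap_chain_def by (simp add: image_image)
  qed
  show "swap_chain i (swap_chain j M) = swap_chain j (swap_chain i M)" if "\<bar>int i - int j\<bar> > 1"
  proof -
    have "transpose i (i + 1) (transpose j (j + 1) x) = transpose j (j + 1) (transpose i (i + 1) x)" for x
      using that by (auto simp: transpose_def)
    then show ?thesis unfolding swap_chain_def by (simp add: image_image)
  qed
qed (use assms in auto)

lemma letter_swaps_all: "letter_swaps n (multichains n) swap_chain (p_index n)"
  by (rule letter_swaps_multichains) (auto intro: swap_chain_multichain)

lemma letter_swaps_graded: "letter_swaps n (graded_multichains n g) swap_chain (p_index n)"
proof (rule letter_swaps_multichains[OF graded_subset])
  fix i M assume "i \<in> {1..<n}" "M \<in> graded_multichains n g"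
  then show "swap_chain i M \<in> graded_multichains n g"
    using swap_chain_multichain[of i n M] swap_chain_card[of i M]
    by (simp add: graded_multichains_def multichains_def)
qed

abbreviation chain_t :: "nat \<Rightarrow> nat \<Rightarrow> nat set list \<Rightarrow> nat set list \<Rightarrow>\<^sub>0 'a::field"
  where "chain_t n \<equiv> sort_t swap_chain (p_index n)"

text \<open>The operator is picked by \<open>SOME\<close>, so one with the prescribed values has to
  exist. Independence of the \<open>y_M\<close> provides it: pass to coordinates by
  \<open>bval\<close>, apply the operator on multichains, return by \<open>encode\<close>.\<close>

lemma boolean_op_spec:
  assumes i: "i \<in> {1..<n}"
  shows "boolean_op n i \<in> lmod_hom (ring_of_type_algebra :: 'a::field ring) (boolean_ring n) (boolean_ring n)"
    and "M \<in> multichains n \<Longrightarrow> boolean_op n i (y_mono n M :: 'a mpoly set) = encode n (chain_t n i M)"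
proof -
  interpret L: letter_swaps n "multichains n" swap_chain "p_index n" by (rule letter_swaps_all)
  interpret H: hecke_rep n "multichains n" "chain_t n :: nat \<Rightarrow> nat set list \<Rightarrow> nat set list \<Rightarrow>\<^sub>0 'a" by (rule L.hecke_rep_sort)
  let ?B = "boolean_ring n :: ('a, _) module"
  define P where "P = (\<lambda>T :: 'a mpoly set \<Rightarrow> 'a mpoly set. T \<in> lmod_hom (ring_of_type_algebra :: 'a ring) ?B ?B \<and>
      (\<forall>M. multichain n M \<longrightarrow> T (y_mono n M) =
        (if p_index n M i > p_index n M (i + 1) then \<zero>\<^bsub>boolean_ring n\<^esub>
         else if p_index n M i = p_index n M (i + 1) then y_mono n M
         else y_mono n (swap_chain i M) \<oplus>\<^bsub>boolean_ring n\<^esub> y_mono n M)))"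
  have enc: "encode n (chain_t n i M :: _ \<Rightarrow>\<^sub>0 'a) =
        (if p_index n M i > p_index n M (i + 1) then \<zero>\<^bsub>boolean_ring n\<^esub>
         else if p_index n M i = p_index n M (i + 1) then y_mono n M
         else y_mono n (swap_chain i M) \<oplus>\<^bsub>boolean_ring n\<^esub> y_mono n M)" if "M \<in> multichains n" for M
    using that L.sw_closed[OF i that] by (simp add: sort_t_def encode_zero encode_single encode_add)
  define T where "T C = encode n (lin (chain_t n i) (bval n C))" for C :: "'a mpoly set"
  have k: "Poly_Mapping.keys (lin (chain_t n i) (bval n C :: _ \<Rightarrow>\<^sub>0 'a)) \<subseteq> multichains n" for C
    by (rule H.keys_op[OF i keys_bval])
  have "P T"
    unfolding P_def
  proof (intro conjI allI impI)
    show "T \<in> lmod_hom ring_of_type_algebra ?B ?B"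
      unfolding lmod_hom_def T_def using encode_carrier[OF k]
      by (auto simp: bval_add bval_smult lin_add lin_scale encode_add[OF k k] encode_scale)
    fix M assume "multichain n M"
    then have M: "M \<in> multichains n" by (simp add: multichains_def)
    have "bval n (y_mono n M) = (Poly_Mapping.single M 1 :: _ \<Rightarrow>\<^sub>0 'a)"
      using bval_encode[of "Poly_Mapping.single M 1" n] M by (simp add: encode_single)
    then show "T (y_mono n M) =
        (if p_index n M i > p_index n M (i + 1) then \<zero>\<^bsub>boolean_ring n\<^esub>
         else if p_index n M i = p_index n M (i + 1) then y_mono n M
         else y_mono n (swap_chain i M) \<oplus>\<^bsub>boolean_ring n\<^esub> y_mono n M)"
      unfolding T_def enc[OF M, symmetric] by simp
  qed
  then have "P (SOME T. P T)" by (rule someI[of P T])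
  moreover have "boolean_op n i = (SOME T. P T)" by (simp only: boolean_op_def P_def)
  ultimately have "P (boolean_op n i)" by simp
  then show "boolean_op n i \<in> lmod_hom (ring_of_type_algebra :: 'a ring) ?B ?B"
    and "M \<in> multichains n \<Longrightarrow> boolean_op n i (y_mono n M :: 'a mpoly set) = encode n (chain_t n i M)"
    unfolding P_def using enc by (auto simp: multichains_def)
qed

lemma boolean_op_encode:
  fixes q :: "nat set list \<Rightarrow>\<^sub>0 'a::field"
  assumes i: "i \<in> {1..<n}" and q: "Poly_Mapping.keys q \<subseteq> multichains n"
  shows "boolean_op n i (encode n q) = encode n (lin (chain_t n i) q)"
proof -
  interpret L: letter_swaps n "multichains n" swap_chain "p_index n" by (rule letter_swaps_all)
  interpret H: hecke_rep n "multichains n" "chain_t n :: nat \<Rightarrow> nat set list \<Rightarrow> nat set list \<Rightarrow>\<^sub>0 'a" by (rule L.hecke_rep_sort)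
  note hom = boolean_op_spec(1)[OF i, where 'a = 'a, unfolded lmod_hom_def mem_Collect_eq]
  have sc: "boolean_op n i (c \<odot>\<^bsub>boolean_ring n\<^esub> C) = c \<odot>\<^bsub>boolean_ring n\<^esub> boolean_op n i C"
    if "C \<in> carrier (boolean_ring n)" for c :: 'a and C using hom that by simp
  show ?thesis
    using q
  proof (induction q rule: poly_mapping_span_induct)
    case zero
    \<comment> \<open>\<open>lmod_hom\<close> speaks of sums and multiples only; the value at zero
      comes from the multiple by the scalar 0.\<close>
    have "boolean_op n i (encode n (scale 0 0)) = (0::'a) \<odot>\<^bsub>boolean_ring n\<^esub> boolean_op n i (encode n 0)"
      unfolding encode_scale by (rule sc) (simp add: encode_carrier)
    moreover have "boolean_op n i (encode n (0 :: _ \<Rightarrow>\<^sub>0 'a)) \<in> carrier (boolean_ring n)"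
      using hom encode_carrier[of 0 n] by auto
    ultimately show ?case
      unfolding boolean_ring_simps(1) by (auto simp: boolean_ring_simps(4) encode_zero boolean_ring_simps(3))
  next
    case (add p q)
    then show ?case
      using hom encode_carrier[OF add(1)] encode_carrier[OF add(2)]
      by (simp add: encode_add lin_add H.keys_op[OF i])
  next
    case (single M c)
    have "boolean_op n i (encode n (scale c (Poly_Mapping.single M 1))) = c \<odot>\<^bsub>boolean_ring n\<^esub> boolean_op n i (encode n (Poly_Mapping.single M 1))"
      unfolding encode_scale by (rule sc) (simp add: encode_carrier single)
    then show ?case
      using boolean_op_spec(2)[OF i single, where 'a = 'a] by (simp add: encode_single encode_scale)
  qed
qed

lemma graded_finite: "finite (graded_multichains n g)"
proof (rule finite_subset)
  show "graded_multichains n g \<subseteq> {M. set M \<subseteq> Pow {1..n} \<and> length M = length g}"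
    by (auto simp: graded_multichains_def multichain_def)
  show "finite {M. set M \<subseteq> Pow {1..n} \<and> length M = length g}" by (rule finite_lists_length_eq) simp
qed

lemma K0_class_boolean:
  "K0_class (hecke n) (boolean_piece n g :: ('a::field hecke, 'a mpoly set) module) =
    finprod (K0 (hecke n)) (\<lambda>M. one_class n {i \<in> {1..<n}. p_index n M i > p_index n M (i + 1)}) (graded_multichains n g)"
proof -
  let ?G = "graded_multichains n g"
  let ?W = "encode n ` {q :: nat set list \<Rightarrow>\<^sub>0 'a. Poly_Mapping.keys q \<subseteq> ?G}"
  let ?V = "(boolean_ring n)\<lparr>carrier := ?W\<rparr> :: ('a, 'a mpoly set) module"
  interpret L: letter_swaps n ?G swap_chain "p_index n" by (rule letter_swaps_graded)
  interpret H: hecke_rep n ?G "chain_t n :: nat \<Rightarrow> nat set list \<Rightarrow> nat set list \<Rightarrow>\<^sub>0 'a" by (rule L.hecke_rep_sort)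
  have GM: "Poly_Mapping.keys q \<subseteq> multichains n" if "Poly_Mapping.keys q \<subseteq> ?G" for q :: "nat set list \<Rightarrow>\<^sub>0 'a"
    using that graded_subset by blast
  have piece: "boolean_piece n g = hecke_module n ?V (boolean_op n)"
    by (simp add: boolean_piece_def graded_span)
  interpret W: submodule ?W ring_of_type_algebra "boolean_ring n :: ('a, _) module" by (rule graded_submodule)
  interpret V: module ring_of_type_algebra ?V
    by (rule W.submodule_is_module[OF boolean_ring_module])
  have Wc: "C \<in> carrier (boolean_ring n)" if "C \<in> ?W" for C using that encode_carrier GM by blast
  have bij: "bij_betw (bval n) (carrier ?V) {q. Poly_Mapping.keys q \<subseteq> ?G}"
    by (rule bij_betwI[where g = "encode n"]) (auto simp: bval_encode GM)
  have op: "boolean_op n i C \<in> carrier ?V" "bval n (boolean_op n i C) = lin (chain_t n i) (bval n C)"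
    if i: "i \<in> {1..<n}" and C: "C \<in> carrier ?V" for i C
  proof -
    obtain q where q: "C = encode n q" "Poly_Mapping.keys q \<subseteq> ?G" using C by auto
    have k: "Poly_Mapping.keys (lin (chain_t n i) q) \<subseteq> ?G" by (rule H.keys_op[OF i q(2)])
    show "boolean_op n i C \<in> carrier ?V" using k by (simp add: q(1) boolean_op_encode[OF i GM[OF q(2)]])
    show "bval n (boolean_op n i C) = lin (chain_t n i) (bval n C)"
      by (simp add: q(1) boolean_op_encode[OF i GM[OF q(2)]] bval_encode[OF GM[OF k]] bval_encode[OF GM[OF q(2)]])
  qed
  have badd: "bval n (x \<oplus>\<^bsub>?V\<^esub> y) = bval n x + bval n y" if "x \<in> carrier ?V" "y \<in> carrier ?V" for x y
    using bval_add[OF Wc Wc, of x y] that by simp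
  have bsm: "bval n (c \<odot>\<^bsub>?V\<^esub> x) = scale c (bval n x)" if "x \<in> carrier ?V" for c x
    using bval_smult[OF Wc, of x c] that by simp
  have sm: "c \<odot>\<^bsub>?V\<^esub> x \<in> carrier ?V" if "x \<in> carrier ?V" for c x
    using V.smult_closed[of c x] that by simp
  note iso = lmod_iso_op_module[OF H.hecke_rep_axioms V.M.abelian_group_axioms sm bij badd bsm op]
  show ?thesis
    unfolding piece L.letter_descents_def[symmetric]
  proof (rule K0_class_triangular[OF H.hecke_rep_axioms graded_finite L.sort_t_triangular])
    show "lmod_iso (hecke n) (hecke_module n ?V (boolean_op n)) (op_module n ?G (chain_t n))" by (rule iso(1))
    show "x \<oplus>\<^bsub>hecke_module n ?V (boolean_op n)\<^esub> y \<in> carrier (hecke_module n ?V (boolean_op n))"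
      if "x \<in> carrier (hecke_module n ?V (boolean_op n))" "y \<in> carrier (hecke_module n ?V (boolean_op n))" for x y
      using V.M.a_closed[of x y] that by (simp add: hecke_module_def)
    show "h \<odot>\<^bsub>hecke_module n ?V (boolean_op n)\<^esub> x \<in> carrier (hecke_module n ?V (boolean_op n))"
      if "x \<in> carrier (hecke_module n ?V (boolean_op n))" "h \<in> carrier (hecke n)" for x h
      using iso(2)[of x h] that by (simp add: hecke_module_def[of n ?V "boolean_op n"])
  qed
qed

declare One_nat_def [simp]

section \<open>Descent sets are equidistributed under relabelling of the letters\<close>

section \<open>Descent sets of words\<close>

definition word_descents :: "nat list \<Rightarrow> nat set"
  where "word_descents p = {i \<in> {1..<length p}. p ! (i - 1) > p ! i}"

text \<open>The number of the block of each position when a word is cut after every element of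
  \<open>D\<close>. Sorting pairs of block number and letter lexicographically sorts the letters
  inside each block.\<close>

definition descent_blocks :: "nat set \<Rightarrow> nat \<Rightarrow> nat list"
  where "descent_blocks D n = map (\<lambda>i. card (D \<inter> {1..i})) [0..<n]"

lemma length_descent_blocks [simp]: "length (descent_blocks D n) = n"
  by (simp add: descent_blocks_def)

lemma sorted_descent_blocks: "sorted (descent_blocks D n)"
  unfolding descent_blocks_def sorted_map
  by (rule sorted_wrt_mono_rel[OF _ sorted_upt]) (auto intro!: card_mono)

text \<open>At a cut the block number rises and the letters are free; between cuts the block number
  stays and the letters decide.\<close>

lemma sorted_zip_blocks:
  assumes "length p = n"
  shows "sorted (zip (descent_blocks D n) p) \<longleftrightarrow> word_descents p \<subseteq> D"
proof -
  have step: "(descent_blocks D n ! i, p ! i) \<le> (descent_blocks D n ! Suc i, p ! Suc i) \<longleftrightarrow>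
      (Suc i \<in> D \<or> p ! i \<le> p ! Suc i)" if "Suc i < n" for i
  proof -
    have "D \<inter> {1..Suc i} = (if Suc i \<in> D then insert (Suc i) (D \<inter> {1..i}) else D \<inter> {1..i})"
      by (auto simp: le_Suc_eq)
    then show ?thesis using that by (auto simp: descent_blocks_def less_eq_prod_def)
  qed
  have "sorted (zip (descent_blocks D n) p) \<longleftrightarrow> (\<forall>i. Suc i < n \<longrightarrow> Suc i \<in> D \<or> p ! i \<le> p ! Suc i)"
    unfolding sorted_iff_nth_Suc using assms step by auto
  also have "\<dots> \<longleftrightarrow> word_descents p \<subseteq> D"
  proof
    assume *: "\<forall>i. Suc i < n \<longrightarrow> Suc i \<in> D \<or> p ! i \<le> p ! Suc i"
    show "word_descents p \<subseteq> D"
    proof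
      fix i assume i: "i \<in> word_descents p"
      then obtain j where "i = Suc j" by (cases i) (auto simp: word_descents_def)
      then show "i \<in> D" using * i assms by (auto simp: word_descents_def not_le[symmetric])
    qed
  next
    assume *: "word_descents p \<subseteq> D"
    show "\<forall>i. Suc i < n \<longrightarrow> Suc i \<in> D \<or> p ! i \<le> p ! Suc i"
    proof (intro allI impI)
      fix i assume "Suc i < n"
      moreover have "Suc i \<in> word_descents p" if "\<not> p ! i \<le> p ! Suc i"
        using that \<open>Suc i < n\<close> assms by (simp add: word_descents_def)
      ultimately show "Suc i \<in> D \<or> p ! i \<le> p ! Suc i" using * by blast
    qed
  qed
  finally show ?thesis .
qed

text \<open>Relabels the letters and restores weak increase inside the blocks; no letter leaves its
  block.\<close>

definition relabel_sort :: "nat list \<Rightarrow> (nat \<Rightarrow> nat) \<Rightarrow> nat list \<Rightarrow> nat list"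
  where "relabel_sort bs \<sigma> p = map snd (sort (zip bs (map \<sigma> p)))"

lemma relabel_sort:
  assumes "sorted bs" "length p = length bs"
  shows "zip bs (relabel_sort bs \<sigma> p) = sort (zip bs (map \<sigma> p))"
    and "mset (relabel_sort bs \<sigma> p) = mset (map \<sigma> p)"
proof -
  let ?s = "sort (zip bs (map \<sigma> p))"
  have "sorted (map fst ?s)"
    unfolding sorted_map by (rule sorted_wrt_mono_rel[OF _ sorted_sort]) (auto simp: less_eq_prod_def)
  moreover have "mset (map fst ?s) = mset (map fst (zip bs (map \<sigma> p)))" by (simp only: mset_map mset_sort)
  then have "mset (map fst ?s) = mset bs" using assms(2) by simp
  ultimately have "map fst ?s = bs" using properties_for_sort[of "map fst ?s" bs] assms(1) by (simp add: sorted_sort_id)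
  then show "zip bs (relabel_sort bs \<sigma> p) = ?s" unfolding relabel_sort_def by (metis zip_map_fst_snd)
  show "mset (relabel_sort bs \<sigma> p) = mset (map \<sigma> p)"
  proof -
    have "mset (map snd ?s) = mset (map snd (zip bs (map \<sigma> p)))" by (simp only: mset_map mset_sort)
    then show ?thesis unfolding relabel_sort_def using assms(2) by simp
  qed
qed

text \<open>Relabelling back restores the multiset of pairs of block number and letter, and a sorted
  list is determined by its multiset.\<close>

lemma relabel_sort_inverse:
  assumes "sorted bs" "length p = length bs" "sorted (zip bs p)" "\<And>x. x \<in> set p \<Longrightarrow> \<tau> (\<sigma> x) = x"
  shows "relabel_sort bs \<tau> (relabel_sort bs \<sigma> p) = p"
proof -
  let ?q = "relabel_sort bs \<sigma> p"
  have z: "zip bs (map f xs) = map (\<lambda>(b, x). (b, f x)) (zip bs xs)" for f :: "nat \<Rightarrow> nat" and xs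
    by (rule zip_map2)
  have "mset (zip bs (map \<tau> ?q)) = mset (map (\<lambda>(b, x). (b, \<tau> x)) (zip bs ?q))" by (simp only: z)
  also have "\<dots> = mset (map (\<lambda>(b, x). (b, \<tau> x)) (zip bs (map \<sigma> p)))"
    unfolding relabel_sort(1)[OF assms(1,2)] by simp
  also have "\<dots> = mset (zip bs (map (\<tau> \<circ> \<sigma>) p))" by (simp only: z[symmetric] map_map)
  also have "map (\<tau> \<circ> \<sigma>) p = p" using assms(4) by (intro map_idI) auto
  finally have "sort (zip bs (map \<tau> ?q)) = zip bs p"
    using properties_for_sort[of "zip bs p" "zip bs (map \<tau> ?q)"] assms(3) by simp
  then show ?thesis using assms(2) by (simp add: relabel_sort_def[of bs \<tau>])
qed

text \<open>Words with descent set inside \<open>D\<close> are weakly increasing on the blocks cut out by \<open>D\<close>, so they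
  can be sorted again blockwise after any relabelling of the letters.\<close>

lemma card_descents_subset:
  assumes A: "\<And>p. p \<in> A \<Longrightarrow> length p = n" and B: "\<And>q. q \<in> B \<Longrightarrow> length q = n"
    and closed: "\<And>p p'. p \<in> A \<Longrightarrow> mset p = mset p' \<Longrightarrow> p' \<in> A" "\<And>q q'. q \<in> B \<Longrightarrow> mset q = mset q' \<Longrightarrow> q' \<in> B"
    and maps: "\<And>p. p \<in> A \<Longrightarrow> map \<sigma> p \<in> B" "\<And>q. q \<in> B \<Longrightarrow> map \<tau> q \<in> A"
    and inv: "\<And>p x. p \<in> A \<Longrightarrow> x \<in> set p \<Longrightarrow> \<tau> (\<sigma> x) = x" "\<And>q x. q \<in> B \<Longrightarrow> x \<in> set q \<Longrightarrow> \<sigma> (\<tau> x) = x"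
  shows "card {p \<in> A. word_descents p \<subseteq> D} = card {q \<in> B. word_descents q \<subseteq> D}"
proof -
  let ?bs = "descent_blocks D n"
  have "bij_betw (relabel_sort ?bs \<sigma>) {p \<in> A. word_descents p \<subseteq> D} {q \<in> B. word_descents q \<subseteq> D}"
  proof (rule bij_betwI[where g = "relabel_sort ?bs \<tau>"])
    show "relabel_sort ?bs \<sigma> \<in> {p \<in> A. word_descents p \<subseteq> D} \<rightarrow> {q \<in> B. word_descents q \<subseteq> D}"
    proof
      fix p assume p: "p \<in> {p \<in> A. word_descents p \<subseteq> D}"
      note r = relabel_sort[OF sorted_descent_blocks[of D n], of p \<sigma>]
      have "relabel_sort ?bs \<sigma> p \<in> B" 
      proof (rule closed(2)[OF maps(1)[of p]])
        show "mset (map \<sigma> p) = mset (relabel_sort ?bs \<sigma> p)" using r(2) p A by simp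
      qed (use p in simp)
      moreover have "sorted (zip ?bs (relabel_sort ?bs \<sigma> p))" using r(1) p A by simp
      ultimately show "relabel_sort ?bs \<sigma> p \<in> {q \<in> B. word_descents q \<subseteq> D}"
        using sorted_zip_blocks B by blast
    qed
    show "relabel_sort ?bs \<tau> \<in> {q \<in> B. word_descents q \<subseteq> D} \<rightarrow> {p \<in> A. word_descents p \<subseteq> D}"
    proof
      fix q assume q: "q \<in> {q \<in> B. word_descents q \<subseteq> D}"
      note r = relabel_sort[OF sorted_descent_blocks[of D n], of q \<tau>]
      have "relabel_sort ?bs \<tau> q \<in> A" 
      proof (rule closed(1)[OF maps(2)[of q]])
        show "mset (map \<tau> q) = mset (relabel_sort ?bs \<tau> q)" using r(2) q B by simp
      qed (use q in simp)
      moreover have "sorted (zip ?bs (relabel_sort ?bs \<tau> q))" using r(1) q B by simp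
      ultimately show "relabel_sort ?bs \<tau> q \<in> {p \<in> A. word_descents p \<subseteq> D}"
        using sorted_zip_blocks A by blast
    qed
    show "relabel_sort ?bs \<tau> (relabel_sort ?bs \<sigma> p) = p" if "p \<in> {p \<in> A. word_descents p \<subseteq> D}" for p
      using that by (intro relabel_sort_inverse sorted_descent_blocks) (auto simp: A inv sorted_zip_blocks)
    show "relabel_sort ?bs \<sigma> (relabel_sort ?bs \<tau> q) = q" if "q \<in> {q \<in> B. word_descents q \<subseteq> D}" for q
      using that by (intro relabel_sort_inverse sorted_descent_blocks) (auto simp: B inv sorted_zip_blocks)
  qed
  then show ?thesis by (rule bij_betw_same_card)
qed

text \<open>Inversion over the lattice of subsets: the fibers over proper subsets agree by induction
  and are subtracted from the counts of lower sets.\<close>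

lemma card_fibers_from_lower_sets:
  fixes D :: "'d set"
  assumes "finite A" "finite B" "finite D"
    and "\<And>E. E \<subseteq> D \<Longrightarrow> card {x \<in> A. f x \<subseteq> E} = card {y \<in> B. h y \<subseteq> E}"
  shows "card {x \<in> A. f x = D} = card {y \<in> B. h y = D}"
  using assms(3,4)
proof (induction D rule: finite_psubset_induct)
  case (psubset D)
  have split: "card {x \<in> A. f x \<subseteq> D} = card {x \<in> A. f x = D} + (\<Sum>E\<in>{E. E \<subset> D}. card {x \<in> A. f x = E})"
    if "finite A" for A and f :: "'c \<Rightarrow> 'd set"
  proof -
    have "{x \<in> A. f x \<subseteq> D} = {x \<in> A. f x = D} \<union> (\<Union>E\<in>{E. E \<subset> D}. {x \<in> A. f x = E})" by auto
    also have "card \<dots> = card {x \<in> A. f x = D} + card (\<Union>E\<in>{E. E \<subset> D}. {x \<in> A. f x = E})"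
      by (rule card_Un_disjoint) (auto intro: finite_subset[OF _ that])
    also have "card (\<Union>E\<in>{E. E \<subset> D}. {x \<in> A. f x = E}) = (\<Sum>E\<in>{E. E \<subset> D}. card {x \<in> A. f x = E})"
      by (rule card_UN_disjoint) (use that psubset.hyps in \<open>auto intro: finite_subset[of _ "Pow D"]\<close>)
    finally show ?thesis .
  qed
  have "(\<Sum>E\<in>{E. E \<subset> D}. card {x \<in> A. f x = E}) = (\<Sum>E\<in>{E. E \<subset> D}. card {y \<in> B. h y = E})"
    by (rule sum.cong[OF refl]) (rule psubset.IH, use psubset.prems in auto)
  moreover have "card {x \<in> A. f x \<subseteq> D} = card {y \<in> B. h y \<subseteq> D}" using psubset.prems by blast
  ultimately show ?case using split[OF assms(1), of f] split[OF assms(2), of h] by linarith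
qed


section \<open>Bijections from multichains and from shuffles to words\<close>

section \<open>Multichains and shuffles as words\<close>

text \<open>A letter at most \<open>j + 1\<close> marks an element of the set with list index
  \<open>j\<close>, so \<open>g\<close> prescribes cumulative counts. The letter
  \<open>length g + 1\<close> marks the elements outside every set of the multichain.\<close>

definition chain_words :: "nat list \<Rightarrow> nat \<Rightarrow> nat list set"
  where "chain_words g n = {p. length p = n \<and> set p \<subseteq> {1..length g + 1} \<and>
    (\<forall>j<length g. length (filter (\<lambda>x. x \<le> j + 1) p) = g ! j)}"

definition dummy_words :: "nat list \<Rightarrow> nat \<Rightarrow> nat list set"
  where "dummy_words g n = {q. length q = n \<and> set q \<subseteq> {0..length g} \<and>
    (\<forall>j<length g. length (filter (\<lambda>x. 1 \<le> x \<and> x \<le> j + 1) q) = g ! j)}"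

lemma length_filter_mset: "length (filter P xs) = size (filter_mset P (mset xs))"
  by (metis mset_filter size_mset)

lemma card_chain_dummy_descents:
  assumes "finite D"
  shows "card {p \<in> chain_words g n. word_descents p = D} = card {q \<in> dummy_words g n. word_descents q = D}"
proof (rule card_fibers_from_lower_sets[OF _ _ assms])
  let ?k = "length g"
  show "finite (chain_words g n)"
    by (rule finite_subset[OF _ finite_lists_length_eq[of "{1..?k + 1}" n]]) (auto simp: chain_words_def)
  show "finite (dummy_words g n)"
    by (rule finite_subset[OF _ finite_lists_length_eq[of "{0..?k}" n]]) (auto simp: dummy_words_def)
  fix E :: "nat set"
  \<comment> \<open>Only the letter of the leftover positions is renamed, from the largest to the
    smallest one; the counts prescribed by \<open>g\<close> are untouched.\<close>
  let ?\<sigma> = "\<lambda>x. if x = ?k + 1 then 0 else x" and ?\<tau> = "\<lambda>x. if x = 0 then ?k + 1 else x"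
  show "card {p \<in> chain_words g n. word_descents p \<subseteq> E} = card {q \<in> dummy_words g n. word_descents q \<subseteq> E}"
  proof (rule card_descents_subset[where n = n and \<sigma> = ?\<sigma> and \<tau> = ?\<tau>])
    show "p' \<in> chain_words g n" if "p \<in> chain_words g n" "mset p = mset p'" for p p'
      using that mset_eq_length[OF that(2)] mset_eq_setD[OF that(2)]
      by (simp add: chain_words_def length_filter_mset)
    show "p' \<in> dummy_words g n" if "p \<in> dummy_words g n" "mset p = mset p'" for p p'
      using that mset_eq_length[OF that(2)] mset_eq_setD[OF that(2)]
      by (simp add: dummy_words_def length_filter_mset)
    show "map ?\<sigma> p \<in> dummy_words g n" if p: "p \<in> chain_words g n" for p
    proof -
      have "filter (\<lambda>x. 1 \<le> ?\<sigma> x \<and> ?\<sigma> x \<le> j + 1) p = filter (\<lambda>x. x \<le> j + 1) p" if "j < ?k" for j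
        by (rule filter_cong) (use p that in \<open>auto simp: chain_words_def\<close>)
      then show ?thesis using p by (fastforce simp: dummy_words_def chain_words_def filter_map o_def)
    qed
    show "map ?\<tau> q \<in> chain_words g n" if q: "q \<in> dummy_words g n" for q
    proof -
      have "filter (\<lambda>x. ?\<tau> x \<le> j + 1) q = filter (\<lambda>x. 1 \<le> x \<and> x \<le> j + 1) q" if "j < ?k" for j
        by (rule filter_cong) (use q that in \<open>auto simp: dummy_words_def\<close>)
      then show ?thesis using q by (fastforce simp: dummy_words_def chain_words_def filter_map o_def)
    qed
  qed (auto simp: chain_words_def dummy_words_def)
qed

definition chain_word :: "nat \<Rightarrow> nat set list \<Rightarrow> nat list"
  where "chain_word n M = map (p_index n M) [1..<n + 1]"

lemma chain_word_nth: "i \<in> {1..n} \<Longrightarrow> chain_word n M ! (i - 1) = p_index n M i"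
  by (auto simp: chain_word_def nth_upt simp del: upt_Suc)

lemma word_descents_chain_word:
  "word_descents (chain_word n M) = {i \<in> {1..<n}. p_index n M i > p_index n M (i + 1)}"
proof -
  have "chain_word n M ! i = p_index n M (i + 1)" if "i < n" for i
    using chain_word_nth[of "i + 1" n M] that by simp
  moreover have "length (chain_word n M) = n" by (simp add: chain_word_def)
  ultimately show ?thesis using chain_word_nth[of _ n M] by (auto simp: word_descents_def)
qed

lemma p_index_props:
  assumes "i \<in> {1..n}"
  shows "p_index n M i \<in> {1..length M + 1}" "i \<in> (M @ [{1..n}]) ! (p_index n M i - 1)"
    "1 \<le> j \<Longrightarrow> j \<le> length M + 1 \<Longrightarrow> i \<in> (M @ [{1..n}]) ! (j - 1) \<Longrightarrow> p_index n M i \<le> j"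
proof -
  let ?P = "\<lambda>j. 1 \<le> j \<and> j \<le> length M + 1 \<and> i \<in> (M @ [{1..n}]) ! (j - 1)"
  have "?P (length M + 1)" using assms by simp
  then have "?P (p_index n M i)" unfolding p_index_def by (rule LeastI)
  then show "p_index n M i \<in> {1..length M + 1}" "i \<in> (M @ [{1..n}]) ! (p_index n M i - 1)" by auto
  show "p_index n M i \<le> j" if "1 \<le> j" "j \<le> length M + 1" "i \<in> (M @ [{1..n}]) ! (j - 1)"
    unfolding p_index_def by (rule Least_le) (use that in blast)
qed

text \<open>By nestedness an element that has appeared in the chain stays in all later sets.\<close>

lemma p_index_le_iff:
  assumes M: "multichain n M" and i: "i \<in> {1..n}" and j: "j < length M"
  shows "p_index n M i \<le> j + 1 \<longleftrightarrow> i \<in> M ! j"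
proof
  assume "i \<in> M ! j"
  then show "p_index n M i \<le> j + 1" using p_index_props(3)[OF i, of "j + 1" M] j by (simp add: nth_append)
next
  assume le: "p_index n M i \<le> j + 1"
  let ?l = "p_index n M i - 1"
  have l: "?l \<le> j" using le by simp
  have "i \<in> M ! ?l" using p_index_props(2)[OF i, of M] l j by (simp add: nth_append)
  moreover have "M ! ?l \<subseteq> M ! j"
    using M l j sorted_wrt_nth_less[of "(\<subseteq>)" M ?l j] unfolding multichain_def by (cases "?l = j") auto
  ultimately show "i \<in> M ! j" by blast
qed

lemma card_shift: "card {i \<in> {1..n :: nat}. P (i - 1)} = card {j. j < n \<and> P j}"
proof -
  have "{i \<in> {1..n}. P (i - 1)} = Suc ` {j. j < n \<and> P j}"
  proof (intro equalityI subsetI)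
    fix i assume "i \<in> {i \<in> {1..n}. P (i - 1)}"
    then show "i \<in> Suc ` {j. j < n \<and> P j}" by (cases i) auto
  qed auto
  then show ?thesis by (simp add: card_image)
qed

lemma length_filter_chain_word: "length (filter P (chain_word n M)) = card {i \<in> {1..n}. P (p_index n M i)}"
proof -
  have "length (filter P (chain_word n M)) = length (filter (P \<circ> p_index n M) [1..<n + 1])"
    by (simp add: chain_word_def filter_map del: upt_Suc)
  also have "\<dots> = card (set (filter (P \<circ> p_index n M) [1..<n + 1]))"
    by (rule distinct_card[symmetric]) (simp del: upt_Suc)
  also have "set (filter (P \<circ> p_index n M) [1..<n + 1]) = {i \<in> {1..n}. P (p_index n M i)}"
    by (auto simp del: upt_Suc)
  finally show ?thesis .
qed

lemma bij_chain_word: "bij_betw (chain_word n) (graded_multichains n g) (chain_words g n)"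
proof (rule bij_betwI[where g = "\<lambda>p. map (\<lambda>j. {i \<in> {1..n}. p ! (i - 1) \<le> j + 1}) [0..<length g]"])
  let ?h = "\<lambda>p. map (\<lambda>j. {i \<in> {1..n}. p ! (i - 1) \<le> j + 1}) [0..<length g]"
  show "chain_word n \<in> graded_multichains n g \<rightarrow> chain_words g n"
  proof
    fix M assume "M \<in> graded_multichains n g"
    then have M: "multichain n M" and g: "g = map card M" by (auto simp: graded_multichains_def)
    have "length (filter (\<lambda>x. x \<le> j + 1) (chain_word n M)) = g ! j" if j: "j < length M" for j
    proof -
      have "{i \<in> {1..n}. p_index n M i \<le> j + 1} = {i \<in> {1..n}. i \<in> M ! j}"
        using p_index_le_iff[OF M _ j] by blast
      also have "\<dots> = M ! j"
      proof -
        have "M ! j \<subseteq> {1..n}" using M j by (simp add: multichain_def)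
        then show ?thesis by blast
      qed
      finally show ?thesis using j by (simp add: length_filter_chain_word g)
    qed
    moreover have "set (chain_word n M) \<subseteq> {1..length M + 1}"
      using p_index_props(1)[of _ n M] by (auto simp: chain_word_def simp del: upt_Suc)
    ultimately show "chain_word n M \<in> chain_words g n" by (simp add: chain_words_def g) (simp add: chain_word_def)
  qed
  have mc: "multichain n (?h p)" for p
    by (auto simp: multichain_def sorted_wrt_map intro!: sorted_wrt_mono_rel[OF _ sorted_upt])
  show "?h \<in> chain_words g n \<rightarrow> graded_multichains n g"
  proof
    fix p assume p: "p \<in> chain_words g n"
    have "card {i \<in> {1..n}. p ! (i - 1) \<le> j + 1} = g ! j" if "j < length g" for j
    proof -
      have "card {i \<in> {1..n}. p ! (i - 1) \<le> j + 1} = length (filter (\<lambda>x. x \<le> j + 1) p)"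
        using p card_shift[of n "\<lambda>i. p ! i \<le> j + 1"] by (simp add: length_filter_conv_card chain_words_def)
      then show ?thesis using p that by (simp add: chain_words_def)
    qed
    then have "map card (?h p) = g" by (intro nth_equalityI) simp_all
    then show "?h p \<in> graded_multichains n g" using mc by (simp add: graded_multichains_def)
  qed
  show "?h (chain_word n M) = M" if "M \<in> graded_multichains n g" for M
  proof (rule nth_equalityI)
    have M: "multichain n M" and g: "length g = length M" using that by (auto simp: graded_multichains_def)
    show "length (?h (chain_word n M)) = length M" using g by simp
    fix j assume j: "j < length (?h (chain_word n M))"
    then have "?h (chain_word n M) ! j = {i \<in> {1..n}. p_index n M i \<le> j + 1}"
      using chain_word_nth by auto
    also have "\<dots> = {i \<in> {1..n}. i \<in> M ! j}" using p_index_le_iff[OF M, of _ j] j g by auto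
    also have "\<dots> = M ! j"
    proof -
      have "M ! j \<subseteq> {1..n}" using M j g by (simp add: multichain_def)
      then show ?thesis by blast
    qed
    finally show "?h (chain_word n M) ! j = M ! j" .
  qed
  show "chain_word n (?h p) = p" if p: "p \<in> chain_words g n" for p
  proof (rule nth_equalityI)
    show len: "length (chain_word n (?h p)) = length p" using p by (simp add: chain_word_def chain_words_def)
    fix i assume "i < length (chain_word n (?h p))"
    then have i: "i < n" "i < length p" using len p by (auto simp: chain_words_def)
    let ?x = "p_index n (?h p) (i + 1)"
    have iff: "?x \<le> j + 1 \<longleftrightarrow> p ! i \<le> j + 1" if "j < length g" for j
      using p_index_le_iff[OF mc, of "i + 1" j p] that i by simp
    have x: "?x \<in> {1..length g + 1}" using p_index_props(1)[of "i + 1" n "?h p"] i by simp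
    have y: "p ! i \<in> {1..length g + 1}" using p i(2) nth_mem unfolding chain_words_def by blast
    \<comment> \<open>Both numbers lie between 1 and \<open>length g + 1\<close>, and the thresholds
      from 1 to \<open>length g\<close> separate any two such values.\<close>
    have "?x = p ! i"
    proof (rule antisym; rule ccontr)
      assume "\<not> ?x \<le> p ! i"
      moreover from this have "p ! i - 1 < length g" using x y by simp
      ultimately show False using iff[of "p ! i - 1"] y by simp
    next
      assume "\<not> p ! i \<le> ?x"
      moreover from this have "?x - 1 < length g" using x y by simp
      ultimately show False using iff[of "?x - 1"] x by simp
    qed
    then show "chain_word n (?h p) ! i = p ! i" using chain_word_nth[of "i + 1" n "?h p"] i by simp
  qed
qed

text \<open>Rebuilds a shuffle from its nonzero letters and their places. The default 0 for an
  exhausted \<open>u\<close> keeps \<open>length_fill\<close> and \<open>set_fill\<close>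
  unconditional.\<close>

fun fill :: "nat list \<Rightarrow> bool list \<Rightarrow> nat list" where
  "fill u [] = []"
| "fill u (False # b) = 0 # fill u b"
| "fill [] (True # b) = 0 # fill [] b"
| "fill (x # u) (True # b) = x # fill u b"

lemma fill_filter: "fill (filter (\<lambda>x. x \<noteq> 0) q) (map (\<lambda>x. x \<noteq> 0) q) = q"
  by (induction q) auto

lemma filter_fill:
  assumes "0 \<notin> set u" "length (filter id b) = length u"
  shows "filter (\<lambda>x. x \<noteq> 0) (fill u b) = u" "map (\<lambda>x. x \<noteq> 0) (fill u b) = b"
  using assms by (induction u b rule: fill.induct) auto

lemma length_fill: "length (fill u b) = length b"
  by (induction u b rule: fill.induct) auto

lemma set_fill: "set (fill u b) \<subseteq> insert 0 (set u)"
  by (induction u b rule: fill.induct) auto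

definition support_positions :: "nat list \<Rightarrow> nat set"
  where "support_positions q = {i \<in> {1..length q}. q ! (i - 1) \<noteq> 0}"

lemma card_positions: "card (support_positions q \<inter> {1..i}) = length (filter (\<lambda>x. x \<noteq> 0) (take i q))"
proof -
  have "support_positions q \<inter> {1..i} = {x \<in> {1..length (take i q)}. take i q ! (x - 1) \<noteq> 0}"
    by (auto simp: support_positions_def)
  then show ?thesis
    using card_shift[of "length (take i q)" "\<lambda>x. take i q ! x \<noteq> 0"] by (simp add: length_filter_conv_card)
qed

lemma card_support_positions: "card (support_positions q) = length (filter (\<lambda>x. x \<noteq> 0) q)"
proof -
  have "support_positions q \<inter> {1..length q} = support_positions q" by (auto simp: support_positions_def)
  then show ?thesis using card_positions[of q "length q"] by simp
qed

lemma nth_filter_take: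
  assumes "i < length q" "P (q ! i)"
  shows "filter P q ! length (filter P (take i q)) = q ! i"
    and "length (filter P (take i q)) < length (filter P q)"
proof -
  have "filter P q = filter P (take i q) @ q ! i # filter P (drop (Suc i) q)"
    using assms by (subst id_take_nth_drop[OF assms(1)]) simp
  then show "filter P q ! length (filter P (take i q)) = q ! i"
    "length (filter P (take i q)) < length (filter P q)" by (simp_all add: nth_append)
qed

text \<open>If one of two neighbouring letters is 0, a descent means a nonzero letter followed by 0.
  Two neighbouring nonzero letters stay neighbours when the zeros are deleted, and the count of
  nonzero letters up to the left one is the index to look up.\<close>

lemma word_descents_dummy:
  "word_descents q = shuffle_descents (word_descents (filter (\<lambda>x. x \<noteq> 0) q)) (length q) (support_positions q)"
  (is "_ = shuffle_descents ?D ?n ?S")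
proof -
  let ?u = "filter (\<lambda>x. x \<noteq> 0) q"
  have "i \<in> word_descents q \<longleftrightarrow> i \<in> shuffle_descents ?D ?n ?S" if i: "1 \<le> i" "i < ?n" for i
  proof -
    obtain l where l: "i = Suc l" using i by (cases i) auto
    have iS: "i \<in> ?S \<longleftrightarrow> q ! l \<noteq> 0" "i + 1 \<in> ?S \<longleftrightarrow> q ! i \<noteq> 0" using i l by (auto simp: support_positions_def)
    show ?thesis
    proof (cases "q ! l \<noteq> 0 \<and> q ! i \<noteq> 0")
      case False
      then show ?thesis using i l iS by (auto simp: word_descents_def shuffle_descents_def)
    next
      case True
      let ?c = "length (filter (\<lambda>x. x \<noteq> 0) (take i q))"
      have c: "card (?S \<inter> {1..i}) = ?c" by (rule card_positions)
      have take: "?c = Suc (length (filter (\<lambda>x. x \<noteq> 0) (take l q)))"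
        using True i l by (simp add: take_Suc_conv_app_nth)
      have "?u ! ?c = q ! i" "?c < length ?u" using nth_filter_take[of i q "\<lambda>x. x \<noteq> 0"] True i by auto
      moreover have "?u ! (?c - 1) = q ! l" using nth_filter_take(1)[of l q "\<lambda>x. x \<noteq> 0"] True i l take by simp
      ultimately have "?c \<in> ?D \<longleftrightarrow> q ! i < q ! l" using take by (simp add: word_descents_def)
      then show ?thesis using True i l iS c by (auto simp: word_descents_def shuffle_descents_def)
    qed
  qed
  then show ?thesis by (auto simp: word_descents_def shuffle_descents_def)
qed

text \<open>The number \<open>r\<^sub>k\<close> of positions that are not dummies; for the empty
  multigrading every position is a dummy, hence the value 0.\<close>

definition top_rank :: "nat list \<Rightarrow> nat"
  where "top_rank g = (if g = [] then 0 else last g)"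

text \<open>A shuffle consists of the word left after deleting the zeros and the places where its
  letters stand; the two can be chosen independently.\<close>

lemma bij_dummy_words:
  assumes "top_rank g \<le> n"
  shows "bij_betw (\<lambda>q. (filter (\<lambda>x. x \<noteq> 0) q, support_positions q)) (dummy_words g n)
    (chain_words g (top_rank g) \<times> subsets (top_rank g) n)"
proof -
  let ?r = "top_rank g" and ?k = "length g"
  let ?nz = "\<lambda>x :: nat. x \<noteq> 0"
  let ?b = "\<lambda>S. map (\<lambda>i. i \<in> S) [1..<n + 1]"
  have top: "length (filter (\<lambda>x. x \<le> ?k) p) = ?r"
    if "set p \<subseteq> {1..?k + 1}" "\<forall>j<?k. length (filter (\<lambda>x. x \<le> j + 1) p) = g ! j" for p
  proof (cases "g = []")
    case True
    have "filter (\<lambda>x. x \<le> ?k) p = []" using that(1) True by (auto simp: filter_empty_conv)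
    then show ?thesis using True by (simp add: top_rank_def)
  next
    case False
    then have "?k - 1 < ?k" "?k - 1 + 1 = ?k" by auto
    then show ?thesis using that(2)[rule_format, of "?k - 1"] False by (simp add: top_rank_def last_conv_nth)
  qed
  \<comment> \<open>In a word of length \<open>?r\<close> all \<open>?r\<close> letters are at most
    \<open>?k\<close>, which leaves no room for the letter \<open>?k + 1\<close>. So these words
    avoid the letter that depends on n.\<close>
  have letters: "set p \<subseteq> {1..?k}" if p: "p \<in> chain_words g ?r" for p
  proof -
    have "length (filter (\<lambda>x. x \<le> ?k) p) = length p" using top[of p] p by (simp add: chain_words_def)
    then have "\<forall>x\<in>set p. x \<le> ?k" by (metis length_filter_less less_irrefl)
    then show ?thesis using p by (fastforce simp: chain_words_def)
  qed
  have ff: "filter (\<lambda>x. x \<le> j + 1) (filter ?nz q) = filter (\<lambda>x. 1 \<le> x \<and> x \<le> j + 1) q" for j q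
    by (auto simp: filter_filter intro!: filter_cong)
  show ?thesis
  proof (rule bij_betwI[where g = "\<lambda>(u, S). fill u (?b S)"])
    show "(\<lambda>q. (filter ?nz q, support_positions q)) \<in> dummy_words g n \<rightarrow> chain_words g ?r \<times> subsets ?r n"
    proof
      fix q assume q: "q \<in> dummy_words g n"
      let ?u = "filter ?nz q"
      have u: "set ?u \<subseteq> {1..?k}" using q by (auto simp: dummy_words_def)
      have counts: "\<forall>j<?k. length (filter (\<lambda>x. x \<le> j + 1) ?u) = g ! j"
        using q unfolding ff by (simp add: dummy_words_def)
      have "filter (\<lambda>x. x \<le> ?k) ?u = ?u" unfolding filter_id_conv using u by auto
      moreover have "set ?u \<subseteq> {1..?k + 1}" using u by auto
      ultimately have len: "length ?u = ?r" using top[of ?u] counts by simp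
      have "?u \<in> chain_words g ?r"
        using len counts \<open>set ?u \<subseteq> {1..?k + 1}\<close> unfolding chain_words_def by blast
      moreover have "support_positions q \<in> subsets ?r n"
        using len q card_support_positions[of q]
        by (auto simp: subsets_def support_positions_def dummy_words_def)
      ultimately show "(?u, support_positions q) \<in> chain_words g ?r \<times> subsets ?r n" by blast
    qed
    have inv: "fill u (?b S) \<in> dummy_words g n \<and> filter ?nz (fill u (?b S)) = u \<and> support_positions (fill u (?b S)) = S"
      if u: "u \<in> chain_words g ?r" and S: "S \<in> subsets ?r n" for u S
    proof -
      let ?q = "fill u (?b S)"
      have 0: "0 \<notin> set u" using letters[OF u] by auto
      have "length (filter id (?b S)) = card (set (filter (\<lambda>i. i \<in> S) [1..<n + 1]))"
        by (subst distinct_card) (simp_all add: filter_map o_def del: upt_Suc)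
      also have "set (filter (\<lambda>i. i \<in> S) [1..<n + 1]) = S" using S by (auto simp: subsets_def simp del: upt_Suc)
      finally have "length (filter id (?b S)) = card S" .
      also have "card S = length u" using S u by (simp add: subsets_def chain_words_def)
      finally have b: "length (filter id (?b S)) = length u" .
      note f = filter_fill[OF 0 b]
      have len: "length ?q = n" by (simp add: length_fill del: upt_Suc)
      have "set ?q \<subseteq> {0..?k}" using set_fill[of u "?b S"] letters[OF u] by fastforce
      moreover have "\<forall>j<?k. length (filter (\<lambda>x. 1 \<le> x \<and> x \<le> j + 1) ?q) = g ! j"
        unfolding ff[symmetric] f(1) using u by (simp add: chain_words_def)
      ultimately have "?q \<in> dummy_words g n" using len unfolding dummy_words_def by blast
      moreover have "support_positions ?q = S"
      proof -
        have "?q ! (i - 1) \<noteq> 0 \<longleftrightarrow> i \<in> S" if "i \<in> {1..n}" for i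
        proof -
          have "map ?nz ?q ! (i - 1) = ?b S ! (i - 1)" by (simp only: f(2))
          then show ?thesis using that len by (auto simp: nth_upt simp del: upt_Suc)
        qed
        then have "{i \<in> {1..n}. ?q ! (i - 1) \<noteq> 0} = {i \<in> {1..n}. i \<in> S}" by blast
        also have "\<dots> = S" using S by (auto simp: subsets_def)
        finally show ?thesis by (simp only: support_positions_def len)
      qed
      ultimately show ?thesis using f(1) by blast
    qed
    then show "(\<lambda>(u, S). fill u (?b S)) \<in> chain_words g ?r \<times> subsets ?r n \<rightarrow> dummy_words g n" by auto
    show "(filter ?nz (case y of (u, S) \<Rightarrow> fill u (?b S)), support_positions (case y of (u, S) \<Rightarrow> fill u (?b S))) = y"
      if "y \<in> chain_words g ?r \<times> subsets ?r n" for y using that inv by auto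
    show "(case (filter ?nz q, support_positions q) of (u, S) \<Rightarrow> fill u (?b S)) = q" if q: "q \<in> dummy_words g n" for q
    proof -
      have len: "length q = n" using q by (simp add: dummy_words_def)
      have "?b (support_positions q) = map ?nz q"
        by (rule nth_equalityI) (auto simp: support_positions_def len nth_upt simp del: upt_Suc)
      then show ?thesis using fill_filter[of q] by simp
    qed
  qed
qed


section \<open>Subsets of {1..r-1} as descent sets of compositions of r\<close>

section \<open>Compositions with a given descent set\<close>

text \<open>Remove the largest element \<open>d\<close>; the composition of \<open>d\<close> given
  by induction is prolonged by the last part \<open>r - d\<close>, which adds exactly
  \<open>d\<close> to the partial sums.\<close>

lemma composition_exists:
  assumes "D \<subseteq> {1..<r}"
  shows "\<exists>\<alpha>. composition \<alpha> \<and> sum_list \<alpha> = r \<and> descent_set \<alpha> = D"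
proof -
  have "finite D" using assms by (rule finite_subset) simp
  then show ?thesis using assms
  proof (induction "card D" arbitrary: D r)
    case 0
    then have "D = {}" by simp
    show ?case
    proof (cases "r = 0")
      case True
      then show ?thesis using \<open>D = {}\<close> by (intro exI[of _ "[]"]) (auto simp: composition_def descent_set_def)
    next
      case False
      then show ?thesis using \<open>D = {}\<close> by (intro exI[of _ "[r]"]) (auto simp: composition_def descent_set_def)
    qed
  next
    case (Suc c)
    let ?d = "Max D"
    have "D \<noteq> {}" using Suc.hyps(2) by auto
    then have d: "?d \<in> D" using Suc.prems(1) by simp
    then have dr: "1 \<le> ?d" "?d < r" using Suc.prems(2) by auto
    have "x < ?d" if "x \<in> D - {?d}" for x using that Max_ge[OF Suc.prems(1), of x] by (auto simp: le_less)
    then have "D - {?d} \<subseteq> {1..<?d}" using Suc.prems(2) by fastforce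
    moreover have "c = card (D - {?d})" using Suc.hyps(2) d Suc.prems(1) by simp
    ultimately obtain \<alpha> where \<alpha>: "composition \<alpha>" "sum_list \<alpha> = ?d" "descent_set \<alpha> = D - {?d}"
      using Suc.hyps(1)[of "D - {?d}" ?d] Suc.prems(1) by auto
    let ?\<beta> = "\<alpha> @ [r - ?d]"
    have "\<alpha> \<noteq> []" using \<alpha>(2) dr by auto
    then have len: "length \<alpha> \<ge> 1" by (simp add: Suc_le_eq)
    have "descent_set ?\<beta> = insert (sum_list \<alpha>) (descent_set \<alpha>)"
    proof (intro equalityI subsetI)
      fix x assume "x \<in> descent_set ?\<beta>"
      then obtain j where j: "x = sum_list (take j ?\<beta>)" "1 \<le> j" "j < length \<alpha> + 1" by (auto simp: descent_set_def)
      then show "x \<in> insert (sum_list \<alpha>) (descent_set \<alpha>)"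
        by (cases "j = length \<alpha>") (auto simp: descent_set_def)
    next
      fix x assume "x \<in> insert (sum_list \<alpha>) (descent_set \<alpha>)"
      then consider "x = sum_list \<alpha>" | j where "x = sum_list (take j \<alpha>)" "1 \<le> j" "j < length \<alpha>"
        by (auto simp: descent_set_def)
      then show "x \<in> descent_set ?\<beta>"
      proof cases
        case 1
        then show ?thesis unfolding descent_set_def using len by (intro CollectI exI[of _ "length \<alpha>"]) auto
      next
        case (2 j)
        then show ?thesis unfolding descent_set_def by (intro CollectI exI[of _ j]) auto
      qed
    qed
    then have "descent_set ?\<beta> = D" using \<alpha> d by auto
    moreover have "composition ?\<beta>" "sum_list ?\<beta> = r" using \<alpha> dr by (auto simp: composition_def)
    ultimately show ?case by blast
  qed
qed

section \<open>Regrouping products of one-dimensional classes\<close>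

section \<open>Assembling the classes\<close>

context comm_monoid
begin

lemma finprod_fibers:
  assumes "finite A" "finite B" "d ` A \<subseteq> B" "f \<in> B \<rightarrow> carrier G"
  shows "finprod G (\<lambda>x. f (d x)) A = finprod G (\<lambda>y. f y [^] card {x \<in> A. d x = y}) B"
  using assms(1,3)
proof (induction A)
  case empty
  have "finprod G (\<lambda>y. f y [^] card {x \<in> {}. d x = y}) B = finprod G (\<lambda>y. \<one>) B"
    using assms(4) by (intro finprod_cong') auto
  then show ?case by simp
next
  case (insert a A)
  have f: "f y \<in> carrier G" if "y \<in> B" for y using assms(4) that by blast
  have da: "d a \<in> B" using insert.prems by blast
  have card: "card {x \<in> insert a A. d x = y} = card {x \<in> A. d x = y} + (if y = d a then 1 else 0)" for y
  proof -
    have "{x \<in> insert a A. d x = y} = (if y = d a then insert a {x \<in> A. d x = y} else {x \<in> A. d x = y})" by auto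
    then show ?thesis using insert.hyps by simp
  qed
  have "finprod G (\<lambda>y. f y [^] card {x \<in> insert a A. d x = y}) B =
    finprod G (\<lambda>y. f y [^] card {x \<in> A. d x = y} \<otimes> (if y = d a then f y else \<one>)) B"
  proof (rule finprod_cong'[OF refl])
    fix y assume "y \<in> B"
    then show "f y [^] card {x \<in> insert a A. d x = y} = f y [^] card {x \<in> A. d x = y} \<otimes> (if y = d a then f y else \<one>)"
      unfolding card using f[of y] f[OF da] by (simp add: nat_pow_mult[symmetric])
  qed (use f in auto)
  also have "\<dots> = finprod G (\<lambda>y. f y [^] card {x \<in> A. d x = y}) B \<otimes> finprod G (\<lambda>y. if y = d a then f y else \<one>) B"
    using f by (intro finprod_multf) auto
  also have "finprod G (\<lambda>y. if y = d a then f y else \<one>) B = f (d a)"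
    using finprod_singleton_swap[OF da assms(2), of f] assms(4) by simp
  also have "finprod G (\<lambda>y. f y [^] card {x \<in> A. d x = y}) B = finprod G (\<lambda>x. f (d x)) A"
    using insert.IH insert.prems by simp
  also have "finprod G (\<lambda>x. f (d x)) A \<otimes> f (d a) = finprod G (\<lambda>x. f (d x)) (insert a A)"
    using insert f da by (subst finprod_insert) (auto simp: m_comm)
  finally show ?case ..
qed

lemma finprod_product:
  assumes "finite A" "finite B" "\<And>x y. x \<in> A \<Longrightarrow> y \<in> B \<Longrightarrow> f x y \<in> carrier G"
  shows "finprod G (\<lambda>x. finprod G (f x) B) A = finprod G (\<lambda>(x, y). f x y) (A \<times> B)"
  using assms(1,3)
proof (induction A)
  case empty then show ?case by simp
next
  case (insert a A)
  have split: "insert a A \<times> B = Pair a ` B \<union> A \<times> B" by auto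
  have "finprod G (\<lambda>(x, y). f x y) (insert a A \<times> B) =
    finprod G (\<lambda>(x, y). f x y) (Pair a ` B) \<otimes> finprod G (\<lambda>(x, y). f x y) (A \<times> B)"
    unfolding split by (rule finprod_Un_disjoint) (use insert assms(2) in auto)
  also have "finprod G (\<lambda>(x, y). f x y) (Pair a ` B) = finprod G (f a) B"
    by (subst finprod_reindex) (use insert.prems in \<open>auto simp: inj_on_def\<close>)
  also have "finprod G (\<lambda>(x, y). f x y) (A \<times> B) = finprod G (\<lambda>x. finprod G (f x) B) A"
    using insert by simp
  finally show ?case using insert by (subst finprod_insert) (auto intro!: finprod_closed)
qed

end

theorem corollary12p1p3:
  fixes g :: "nat list"
  assumes "sorted g"
  shows "\<exists>(A :: nat list set) (K :: int set) (c :: nat list \<Rightarrow> int \<Rightarrow> nat) (N :: nat).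
    finite A \<and> finite K \<and> (\<forall>\<alpha>\<in>A. composition \<alpha>) \<and> (\<forall>k\<in>K. k \<ge> -1) \<and>
    (\<forall>n\<ge>N.
      K0_class (hecke n) (boolean_piece n g :: ('a::field hecke, 'a mpoly set) module) =
      (\<Otimes>\<^bsub>K0 (hecke n)\<^esub>\<alpha>\<in>A. \<Otimes>\<^bsub>K0 (hecke n)\<^esub>k\<in>{k \<in> K. k \<le> int (sum_list \<alpha>)}.
         K0_class (hecke n) (degree_part (Mk_hmod \<alpha> k :: ('a, 'a tensor set) hmodule) n)
           [^]\<^bsub>K0 (hecke n)\<^esub> c \<alpha> k))"
proof -
  define r where "r = top_rank g"
  define U where "U = chain_words g r"
  \<comment> \<open>All these compositions have size \<open>r\<close>, so \<open>k = r\<close> is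
    the case in which M(\<alpha>, k) is M(\<alpha>) itself.\<close>
  define co where "co u = (SOME \<alpha>. composition \<alpha> \<and> sum_list \<alpha> = r \<and> descent_set \<alpha> = word_descents u)" for u
  \<comment> \<open>Different words can share a descent set, hence the multiplicity. It is constant
    in \<open>k\<close> because \<open>r\<close> is the only value offered by the witness for
    \<open>K\<close>.\<close>
  define c :: "nat list \<Rightarrow> int \<Rightarrow> nat" where "c \<alpha> k = card {u \<in> U. co u = \<alpha>}" for \<alpha> k
  have finw: "finite (chain_words g n)" "finite (dummy_words g n)" for n
    using finite_lists_length_eq[of "{1..length g + 1}" n] finite_lists_length_eq[of "{0..length g}" n]
    by (auto simp: chain_words_def dummy_words_def intro: rev_finite_subset)
  have finU: "finite U" unfolding U_def by (rule finw)
  have co: "composition (co u)" "sum_list (co u) = r" "descent_set (co u) = word_descents u" if "u \<in> U" for u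
  proof -
    have "word_descents u \<subseteq> {1..<r}" using that by (auto simp: word_descents_def U_def chain_words_def)
    from someI_ex[OF composition_exists[OF this]]
    show "composition (co u)" "sum_list (co u) = r" "descent_set (co u) = word_descents u"
      unfolding co_def by blast+
  qed
  have "K0_class (hecke n) (boolean_piece n g :: ('a hecke, 'a mpoly set) module) =
      (\<Otimes>\<^bsub>K0 (hecke n)\<^esub>\<alpha>\<in>co ` U. \<Otimes>\<^bsub>K0 (hecke n)\<^esub>k\<in>{k \<in> {int r}. k \<le> int (sum_list \<alpha>)}.
         K0_class (hecke n) (degree_part (Mk_hmod \<alpha> k :: ('a, 'a tensor set) hmodule) n)
           [^]\<^bsub>K0 (hecke n)\<^esub> c \<alpha> k)" if n: "r \<le> n" for n
  proof -
    let ?K = "K0 (hecke n :: ('a, 'a hecke) module)"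
    let ?cls = "one_class n :: nat set \<Rightarrow> (('a hecke, nat \<Rightarrow>\<^sub>0 'a) module \<Rightarrow>\<^sub>0 int) set"
    interpret K: comm_group ?K by (rule K0_comm_group)
    have cls: "?cls D \<in> carrier ?K" for D by (rule one_class_carrier)
    let ?E = "Pow {1..<n}"
    define M_cls where "M_cls D = finprod ?K (\<lambda>S. ?cls (shuffle_descents D n S)) (subsets r n)" for D
    have M_cls: "M_cls D \<in> carrier ?K" for D unfolding M_cls_def by (rule K.finprod_closed) (use cls in auto)
    have bij: "bij_betw (chain_word n) (graded_multichains n g) (chain_words g n)" by (rule bij_chain_word)
    have "K0_class (hecke n) (boolean_piece n g :: ('a hecke, 'a mpoly set) module) =
        finprod ?K (\<lambda>M. ?cls (word_descents (chain_word n M))) (graded_multichains n g)"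
      unfolding K0_class_boolean word_descents_chain_word ..
    also have "\<dots> = finprod ?K (\<lambda>p. ?cls (word_descents p)) (chain_word n ` graded_multichains n g)"
      by (rule K.finprod_reindex[symmetric]) (use bij cls in \<open>auto simp: bij_betw_def\<close>)
    also have "chain_word n ` graded_multichains n g = chain_words g n" using bij by (simp add: bij_betw_def)
    \<comment> \<open>Grouping by descent set leaves only multiplicities, and these are the same for
      the words with dummies.\<close>
    also have "finprod ?K (\<lambda>p. ?cls (word_descents p)) (chain_words g n) =
        finprod ?K (\<lambda>D. ?cls D [^]\<^bsub>?K\<^esub> card {p \<in> chain_words g n. word_descents p = D}) ?E"
      by (rule K.finprod_fibers) (use finw cls in \<open>auto simp: word_descents_def chain_words_def\<close>)
    also have "\<dots> = finprod ?K (\<lambda>D. ?cls D [^]\<^bsub>?K\<^esub> card {q \<in> dummy_words g n. word_descents q = D}) ?E"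
    proof (rule K.finprod_cong'[OF refl])
      fix D assume "D \<in> ?E"
      then have "finite D" using finite_subset by blast
      then show "?cls D [^]\<^bsub>?K\<^esub> card {p \<in> chain_words g n. word_descents p = D} =
        ?cls D [^]\<^bsub>?K\<^esub> card {q \<in> dummy_words g n. word_descents q = D}"
        by (simp only: card_chain_dummy_descents)
    qed (use cls in auto)
    also have "\<dots> = finprod ?K (\<lambda>q. ?cls (word_descents q)) (dummy_words g n)"
      by (rule K.finprod_fibers[symmetric]) (use finw cls in \<open>auto simp: word_descents_def dummy_words_def\<close>)
    \<comment> \<open>Each word splits into its nonzero letters and their positions; for fixed
      letters the product over the positions is the class of one M(\<alpha>) in degree n.\<close>
    also have "\<dots> = finprod ?K (\<lambda>(u, S). ?cls (shuffle_descents (word_descents u) n S)) (U \<times> subsets r n)"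
    proof -
      let ?h = "\<lambda>q :: nat list. (filter (\<lambda>x. x \<noteq> 0) q, support_positions q)"
      have b: "bij_betw ?h (dummy_words g n) (U \<times> subsets r n)"
        using bij_dummy_words[of g n] n by (simp add: U_def r_def)
      have "finprod ?K (\<lambda>q. ?cls (word_descents q)) (dummy_words g n) =
          finprod ?K (\<lambda>q. (\<lambda>(u, S). ?cls (shuffle_descents (word_descents u) n S)) (?h q)) (dummy_words g n)"
      proof (rule K.finprod_cong'[OF refl])
        fix q assume "q \<in> dummy_words g n"
        then show "?cls (word_descents q) = (\<lambda>(u, S). ?cls (shuffle_descents (word_descents u) n S)) (?h q)"
          by (simp add: word_descents_dummy[of q] dummy_words_def)
      qed (use cls in auto)
      also have "\<dots> = finprod ?K (\<lambda>(u, S). ?cls (shuffle_descents (word_descents u) n S)) (?h ` dummy_words g n)"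
        by (rule K.finprod_reindex[symmetric]) (use b cls in \<open>auto simp: bij_betw_def\<close>)
      also have "?h ` dummy_words g n = U \<times> subsets r n" using b by (simp add: bij_betw_def)
      finally show ?thesis .
    qed
    also have "\<dots> = finprod ?K (\<lambda>u. M_cls (word_descents u)) U"
      unfolding M_cls_def by (rule K.finprod_product[symmetric]) (use finU subsets_finite cls in auto)
    also have "\<dots> = finprod ?K (\<lambda>u. M_cls (descent_set (co u))) U"
      by (rule K.finprod_cong') (use M_cls co in auto)
    \<comment> \<open>The class depends on the word only through its composition, so words with the
      same composition are collected into a power.\<close>
    also have "\<dots> = finprod ?K (\<lambda>\<alpha>. M_cls (descent_set \<alpha>) [^]\<^bsub>?K\<^esub> card {u \<in> U. co u = \<alpha>}) (co ` U)"
      by (rule K.finprod_fibers) (use finU M_cls in auto)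
    also have "\<dots> = (\<Otimes>\<^bsub>?K\<^esub>\<alpha>\<in>co ` U. \<Otimes>\<^bsub>?K\<^esub>k\<in>{k \<in> {int r}. k \<le> int (sum_list \<alpha>)}.
         K0_class (hecke n) (degree_part (Mk_hmod \<alpha> k :: ('a, 'a tensor set) hmodule) n) [^]\<^bsub>?K\<^esub> c \<alpha> k)"
    proof (rule K.finprod_cong'[OF refl, symmetric])
      show "(\<lambda>\<alpha>. M_cls (descent_set \<alpha>) [^]\<^bsub>?K\<^esub> card {u \<in> U. co u = \<alpha>}) \<in> co ` U \<rightarrow> carrier ?K" using M_cls by auto
      fix \<alpha> assume "\<alpha> \<in> co ` U"
      then have \<alpha>: "sum_list \<alpha> = r" using co by blast
      have M: "K0_class (hecke n) (degree_part (Mk_hmod \<alpha> (int r) :: ('a, 'a tensor set) hmodule) n) = M_cls (descent_set \<alpha>)"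
        using K0_class_M[of \<alpha> n, where 'a = 'a] n \<alpha> by (simp add: M_cls_def)
      have ks: "{k \<in> {int r}. k \<le> int (sum_list \<alpha>)} = {int r}" using \<alpha> by auto
      show "(\<Otimes>\<^bsub>?K\<^esub>k\<in>{k \<in> {int r}. k \<le> int (sum_list \<alpha>)}.
         K0_class (hecke n) (degree_part (Mk_hmod \<alpha> k :: ('a, 'a tensor set) hmodule) n) [^]\<^bsub>?K\<^esub> c \<alpha> k) =
         M_cls (descent_set \<alpha>) [^]\<^bsub>?K\<^esub> card {u \<in> U. co u = \<alpha>}"
        unfolding ks using M_cls M by (simp add: c_def)
    qed
    finally show ?thesis .
  qed
  moreover have "finite (co ` U)" "\<forall>\<alpha>\<in>co ` U. composition \<alpha>" using finU co by auto
  moreover have "finite {int r}" "\<forall>k\<in>{int r}. k \<ge> -1" by auto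
  ultimately show ?thesis
    by (intro exI[of _ "co ` U"] exI[of _ "{int r}"] exI[of _ c] exI[of _ r]) blast
qed

end
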